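(* Let $k\in\mathbb Z_+$ and let $f,g\in\mathcal L_k$, i.e. $f,g:E^k\to[0,\infty]$ are measurable and vanish on the diagonals. Then: (i) (max-linearity) for any constants $a,b\ge0$, $I_k^e(af\vee bg)=aI_k^e(f)\vee bI_k^e(g)$ a.s.; (ii) (monotonicity) if $f(\boldsymbol u)\le g(\boldsymbol u)$ for $\mu^k$-a.e. $\boldsymbol u\in E^k$, then $I_k^e(f)\le I_k^e(g)$ a.s.; (iii) (triangle inequality) $I_k^e(f+g)\le I_k^e(f)+I_k^e(g)$ a.s. In addition, one has the LePage representation, as equality of finite-dimensional distributions, $$\bigl(I_k^e(f)\bigr)_{f\in\mathcal L_k,\,k\in\mathbb Z_+}\overset{d}{=}\bigl(S_k^e(f)\bigr)_{f\in\mathcal L_k,\,k\in\mathbb Z_+}:=\Biggl(\bigvee_{\boldsymbol j\in\mathcal D_k}f(T_{j_1},\dots,T_{j_k})\Bigl(\prod_{r=1}^k\Gamma_{j_r}^{-1/\alpha}\psi(T_{j_r})^{1/\alpha}\Bigr)\Biggr)_{f\in\mathcal L_k,\,k\in\mathbb Z_+}.$$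
   Context: $\mathbb Z_+=\{1,2,\dots\}$, $\alpha\in(0,\infty)$, $\bigvee$ denotes supremum, $0\cdot\infty=0$. $(E,\mathcal E)$ is a Borel space (there is a measurable bijection, with measurable inverse, onto a Borel subset of $[0,1]$) and $\mu$ is a nonzero $\sigma$-finite measure on it. $M_\alpha=(M_\alpha(A))_{A\in\mathcal E}$ is an independently scattered $\alpha$-Fréchet random sup measure with control measure $\mu$: $[0,\infty]$-valued random variables such that (i) $M_\alpha(A_1),\dots,M_\alpha(A_n)$ are independent for disjoint $A_i\in\mathcal E$; (ii) $\mathbb P(M_\alpha(A)\le x)=\exp\{-\mu(A)x^{-\alpha}\}$, $x\in(0,\infty)$ (so $M_\alpha(A)=\infty$ a.s. if $\mu(A)=\infty$); (iii) $M_\alpha(\bigcup_{j\ge1}A_j)=\bigvee_{j\ge1}M_\alpha(A_j)$ a.s. for $A_j\in\mathcal E$. Off-diagonal space: $D^{(k)}=\{(x_1,\dots,x_k)\in E^k:x_i=x_j\text{ for some }i\ne j\}$, $E^{(k)}=E^k\setminus D^{(k)}$, $\mathcal E^{(k)}=\{A\cap E^{(k)}:A\in\mathcal E^k\}$. "Vanishes on the diagonals" means vanishes on $D^{(k)}$. $\mathcal L_k$ is the class of measurable $f:E^k\to[0,\infty]$ vanishing on the diagonals. Product random sup measure $M_\alpha^{(k)}$ on $\mathcal E^{(k)}$: when the control measure is finite, $M_\alpha^{(k)}(A_1\times\cdots\times A_k)=M_\alpha(A_1)\cdots M_\alpha(A_k)$ for pairwise disjoint $A_i\in\mathcal E$;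 $M_\alpha^{(k)}(\bigcup_{i=1}^mB_i)=\bigvee_{i=1}^mM_\alpha^{(k)}(B_i)$ for such off-diagonal rectangles $B_i$; and for $A\in\mathcal E^{(k)}$, $M_\alpha^{(k)}(A)$ is the $L^\gamma$-limit ($\gamma\in(0,\alpha)$) of $M_\alpha^{(k)}(A_n)$ for finite unions $A_n$ of off-diagonal rectangles with $\mu^k(A_n\Delta A)\to0$. For $\sigma$-finite $\mu$, take $E_n\uparrow E$ with $\mu(E_n)\in(0,\infty)$, let $M_{\alpha,E_n}(\cdot)=M_\alpha(\cdot\cap E_n)$ (finite control measure $\mu(\cdot\cap E_n)$) and $M_\alpha^{(k)}(A)=\bigvee_nM_{\alpha,E_n}^{(k)}(A)$. All of this is a.s. independent of choices. Multiple extremal integral: for a simple function $f=\sum_{i=1}^Na_i\mathbf 1_{A_i}$ with $a_i\in(0,\infty)$ and disjoint $A_i\in\mathcal E^{(k)}$, $I_k^e(f)=\bigvee_{i=1}^Na_iM_\alpha^{(k)}(A_i)$. For $f\in\mathcal L_k$, $I_k^e(f)$ is the a.s. limit of $I_k^e(f_n)$ for any such simple $f_n$ with $f_n\le f_{n+1}$ and $f_n\to f$ $\mu^k$-a.e. (a.s. independent of the choice of $(f_n)$). LePage data: $m$ is a probability measure on $(E,\mathcal E)$ equivalent to $\mu$ with $\psi=d\mu/dm\in(0,\infty)$ $m$-a.e.; $(\Gamma_i)_{i\in\mathbb Z_+}$ are the arrival times of a standard Poisson process on $[0,\infty)$; $(T_i)_{i\in\mathbb Z_+}$ are i.i.d.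 with law $m$, independent of $(\Gamma_i)$; $\mathcal D_k=\{\boldsymbol j\in\mathbb Z_+^k:j_1,\dots,j_k\text{ all distinct}\}$. *)

theory Defs
  imports "HOL-Probability.Probability"
begin

section \<open>Spaces\<close>

definition is_borel_space :: "'e measure \<Rightarrow> bool" where
  "is_borel_space E \<longleftrightarrow>
     (\<exists>B \<phi>. B \<in> sets (borel :: real measure) \<and> B \<subseteq> {0..1} \<and> bij_betw \<phi> (space E) B \<and>
       \<phi> \<in> E \<rightarrow>\<^sub>M restrict_space borel B \<and>
       inv_into (space E) \<phi> \<in> restrict_space borel B \<rightarrow>\<^sub>M E)"

text \<open>Points of the \<open>k\<close>-fold power are extensional functions on \<open>{1..k}\<close>.\<close>

abbreviation power_measure :: "nat \<Rightarrow> 'e measure \<Rightarrow> (nat \<Rightarrow> 'e) measure" where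
  "power_measure k \<mu> \<equiv> PiM {1..k} (\<lambda>_. \<mu>)"

definition diagonals :: "nat \<Rightarrow> 'e measure \<Rightarrow> (nat \<Rightarrow> 'e) set" where
  "diagonals k \<mu> =
     {x \<in> space (power_measure k \<mu>). \<exists>i\<in>{1..k}. \<exists>j\<in>{1..k}. i \<noteq> j \<and> x i = x j}"

definition off_diagonal_sets :: "nat \<Rightarrow> 'e measure \<Rightarrow> (nat \<Rightarrow> 'e) set set" where
  "off_diagonal_sets k \<mu> =
     (\<lambda>A. A \<inter> (space (power_measure k \<mu>) - diagonals k \<mu>)) ` sets (power_measure k \<mu>)"

definition integrand_class :: "nat \<Rightarrow> 'e measure \<Rightarrow> ((nat \<Rightarrow> 'e) \<Rightarrow> ennreal) set" where
  "integrand_class k \<mu> =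
     {f \<in> borel_measurable (power_measure k \<mu>). \<forall>x\<in>diagonals k \<mu>. f x = 0}"

section \<open>Random sup measures\<close>

locale frechet_random_sup_measure = prob_space P
  for \<alpha> :: real and \<mu> :: "'e measure" and P :: "'w measure" and M :: "'e set \<Rightarrow> 'w \<Rightarrow> ennreal" +
  assumes random_variable: "\<And>A. A \<in> sets \<mu> \<Longrightarrow> M A \<in> borel_measurable P"
    and independently_scattered:
      "\<And>A n. (\<And>i. i \<in> {1..n::nat} \<Longrightarrow> A i \<in> sets \<mu>) \<Longrightarrow> disjoint_family_on A {1..n} \<Longrightarrow>
         indep_vars (\<lambda>_. borel) (\<lambda>i. M (A i)) {1..n}"
    and frechet_distribution:
      "\<And>A x. A \<in> sets \<mu> \<Longrightarrow> x > 0 \<Longrightarrow>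
         \<P>(w in P. M A w \<le> ennreal x) =
           (if emeasure \<mu> A = \<infinity> then 0 else exp (- (measure \<mu> A * x powr (- \<alpha>))))"
    and sup_measure:
      "\<And>A :: nat \<Rightarrow> 'e set. range A \<subseteq> sets \<mu> \<Longrightarrow>
         AE w in P. M (\<Union>j. A j) w = (SUP j. M (A j) w)"

text \<open>For exponents \<open>p > 0\<close>.\<close>

definition ennreal_powr :: "ennreal \<Rightarrow> real \<Rightarrow> ennreal" where
  "ennreal_powr x p = (if x = \<infinity> then \<infinity> else ennreal (enn2real x powr p))"

text \<open>The integrand is \<open>\<bar>Y n - X\<bar>\<close> to the power \<open>\<gamma>\<close>. Since \<open>\<infinity> - \<infinity> = \<infinity>\<close> in \<^typ>\<open>ennreal\<close>,
  convergence forces \<open>X\<close> to be almost surely finite.\<close>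

definition Lp_tendsto ::
    "'w measure \<Rightarrow> real \<Rightarrow> (nat \<Rightarrow> 'w \<Rightarrow> ennreal) \<Rightarrow> ('w \<Rightarrow> ennreal) \<Rightarrow> bool" where
  "Lp_tendsto P \<gamma> Y X \<longleftrightarrow>
     (\<lambda>n. \<integral>\<^sup>+ w. ennreal_powr (max (Y n w) (X w) - min (Y n w) (X w)) \<gamma> \<partial>P) \<longlonglongrightarrow> 0"

text \<open>A family \<open>R\<close> with \<open>R i r\<close> the \<open>r\<close>-th side of the \<open>i\<close>-th rectangle, \<open>i \<in> {1..m}\<close>,
  describes a finite union of off-diagonal rectangles.\<close>

definition off_diagonal_rectangles ::
    "nat \<Rightarrow> 'e measure \<Rightarrow> nat \<Rightarrow> (nat \<Rightarrow> nat \<Rightarrow> 'e set) \<Rightarrow> bool" where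
  "off_diagonal_rectangles k \<mu> m R \<longleftrightarrow>
     (\<forall>i\<in>{1..m}. (\<forall>r\<in>{1..k}. R i r \<in> sets \<mu>) \<and> disjoint_family_on (R i) {1..k})"

definition rectangles_union :: "nat \<Rightarrow> nat \<Rightarrow> (nat \<Rightarrow> nat \<Rightarrow> 'e set) \<Rightarrow> (nat \<Rightarrow> 'e) set" where
  "rectangles_union k m R = (\<Union>i\<in>{1..m}. PiE {1..k} (R i))"

definition rectangles_value ::
    "('e set \<Rightarrow> 'w \<Rightarrow> ennreal) \<Rightarrow> nat \<Rightarrow> nat \<Rightarrow> (nat \<Rightarrow> nat \<Rightarrow> 'e set) \<Rightarrow> 'w \<Rightarrow> ennreal" where
  "rectangles_value M k m R w = (SUP i\<in>{1..m}. \<Prod>r\<in>{1..k}. M (R i r) w)"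

text \<open>The product sup measure and the integral are determined only up to null sets. They are
  modelled by choosing a version with the required property for every admissible approximating
  sequence; existence of such a version is not assumed anywhere.\<close>

definition product_sup_measure_finite ::
    "real \<Rightarrow> 'e measure \<Rightarrow> 'w measure \<Rightarrow> ('e set \<Rightarrow> 'w \<Rightarrow> ennreal) \<Rightarrow> nat \<Rightarrow>
     (nat \<Rightarrow> 'e) set \<Rightarrow> 'w \<Rightarrow> ennreal" where
  "product_sup_measure_finite \<alpha> \<mu> P M k A =
     (SOME X. X \<in> borel_measurable P \<and>
       (\<forall>m R. (\<forall>n. off_diagonal_rectangles k \<mu> (m n) (R n)) \<longrightarrow>
          (\<lambda>n. emeasure (power_measure k \<mu>)
             ((rectangles_union k (m n) (R n) - A) \<union> (A - rectangles_union k (m n) (R n))))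
            \<longlonglongrightarrow> 0 \<longrightarrow>
          (\<forall>\<gamma>. 0 < \<gamma> \<and> \<gamma> < \<alpha> \<longrightarrow>
             Lp_tendsto P \<gamma> (\<lambda>n. rectangles_value M k (m n) (R n)) X)))"

definition exhausting_sequence :: "'e measure \<Rightarrow> (nat \<Rightarrow> 'e set) \<Rightarrow> bool" where
  "exhausting_sequence \<mu> S \<longleftrightarrow>
     range S \<subseteq> sets \<mu> \<and> incseq S \<and> (\<Union>n. S n) = space \<mu> \<and>
     (\<forall>n. 0 < emeasure \<mu> (S n) \<and> emeasure \<mu> (S n) < \<infinity>)"

text \<open>\<^term>\<open>density \<mu> (indicator (S n))\<close> is the measure \<open>\<lambda>B. \<mu> (B \<inter> S n)\<close> on the whole space.\<close>

definition product_sup_measure ::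
    "real \<Rightarrow> 'e measure \<Rightarrow> 'w measure \<Rightarrow> ('e set \<Rightarrow> 'w \<Rightarrow> ennreal) \<Rightarrow> nat \<Rightarrow>
     (nat \<Rightarrow> 'e) set \<Rightarrow> 'w \<Rightarrow> ennreal" where
  "product_sup_measure \<alpha> \<mu> P M k A =
     (SOME X. X \<in> borel_measurable P \<and>
       (\<forall>S. exhausting_sequence \<mu> S \<longrightarrow>
         (AE w in P. X w =
            (SUP n. product_sup_measure_finite \<alpha> (density \<mu> (indicator (S n))) P
                      (\<lambda>B. M (B \<inter> S n)) k A w))))"

section \<open>Multiple extremal integrals\<close>

text \<open>Simple functions are given by a representation \<open>N, a, A\<close>, \<open>i \<in> {1..N}\<close>.\<close>

definition simple_representation ::
    "nat \<Rightarrow> 'e measure \<Rightarrow> nat \<Rightarrow> (nat \<Rightarrow> real) \<Rightarrow> (nat \<Rightarrow> (nat \<Rightarrow> 'e) set) \<Rightarrow> bool" where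
  "simple_representation k \<mu> N a A \<longleftrightarrow>
     (\<forall>i\<in>{1..N}. 0 < a i \<and> A i \<in> off_diagonal_sets k \<mu>) \<and> disjoint_family_on A {1..N}"

definition simple_value ::
    "nat \<Rightarrow> (nat \<Rightarrow> real) \<Rightarrow> (nat \<Rightarrow> (nat \<Rightarrow> 'e) set) \<Rightarrow> (nat \<Rightarrow> 'e) \<Rightarrow> ennreal" where
  "simple_value N a A x = (\<Sum>i\<in>{1..N}. ennreal (a i) * indicator (A i) x)"

definition simple_extremal_integral ::
    "real \<Rightarrow> 'e measure \<Rightarrow> 'w measure \<Rightarrow> ('e set \<Rightarrow> 'w \<Rightarrow> ennreal) \<Rightarrow> nat \<Rightarrow>
     nat \<Rightarrow> (nat \<Rightarrow> real) \<Rightarrow> (nat \<Rightarrow> (nat \<Rightarrow> 'e) set) \<Rightarrow> 'w \<Rightarrow> ennreal" where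
  "simple_extremal_integral \<alpha> \<mu> P M k N a A w =
     (SUP i\<in>{1..N}. ennreal (a i) * product_sup_measure \<alpha> \<mu> P M k (A i) w)"

definition extremal_integral ::
    "real \<Rightarrow> 'e measure \<Rightarrow> 'w measure \<Rightarrow> ('e set \<Rightarrow> 'w \<Rightarrow> ennreal) \<Rightarrow> nat \<Rightarrow>
     ((nat \<Rightarrow> 'e) \<Rightarrow> ennreal) \<Rightarrow> 'w \<Rightarrow> ennreal" where
  "extremal_integral \<alpha> \<mu> P M k f =
     (SOME X. X \<in> borel_measurable P \<and>
       (\<forall>N a A.
          (\<forall>n. simple_representation k \<mu> (N n) (a n) (A n)) \<longrightarrow>
          (\<forall>n. \<forall>x\<in>space (power_measure k \<mu>).
             simple_value (N n) (a n) (A n) x \<le> simple_value (N (Suc n)) (a (Suc n)) (A (Suc n)) x) \<longrightarrow>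
          (AE x in power_measure k \<mu>. (\<lambda>n. simple_value (N n) (a n) (A n) x) \<longlonglongrightarrow> f x) \<longrightarrow>
          (AE w in P.
             (\<lambda>n. simple_extremal_integral \<alpha> \<mu> P M k (N n) (a n) (A n) w) \<longlonglongrightarrow> X w)))"

section \<open>LePage representation\<close>

definition poisson_arrival_times :: "'v measure \<Rightarrow> (nat \<Rightarrow> 'v \<Rightarrow> real) \<Rightarrow> bool" where
  "poisson_arrival_times Q \<Gamma> \<longleftrightarrow>
     (let W = (\<lambda>i w. \<Gamma> i w - (if i = 1 then 0 else \<Gamma> (i - 1) w)) in
       prob_space.indep_vars Q (\<lambda>_. borel) W {1..} \<and>
       (\<forall>i\<ge>1. distributed Q lborel (W i) (exponential_density 1)))"

text \<open>\<open>indep_var\<close> only relates variables with values in the same type, so independence of the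
  sequences \<open>T\<close> and \<open>\<Gamma>\<close> is stated for the \<open>\<sigma>\<close>-algebras they generate.\<close>

locale lepage_data = prob_space Q
  for \<mu> m :: "'e measure" and \<psi> :: "'e \<Rightarrow> ennreal" and Q :: "'v measure"
    and \<Gamma> :: "nat \<Rightarrow> 'v \<Rightarrow> real" and T :: "nat \<Rightarrow> 'v \<Rightarrow> 'e" +
  assumes prob_m: "prob_space m"
    and sets_m: "sets m = sets \<mu>"
    and equivalent: "absolutely_continuous m \<mu>" "absolutely_continuous \<mu> m"
    and psi_measurable: "\<psi> \<in> borel_measurable m"
    and psi_density: "\<mu> = density m \<psi>"
    and psi_pos_finite: "AE x in m. 0 < \<psi> x \<and> \<psi> x < \<infinity>"
    and arrival_times: "poisson_arrival_times Q \<Gamma>"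
    and T_law: "\<And>i. i \<ge> 1 \<Longrightarrow> T i \<in> Q \<rightarrow>\<^sub>M m \<and> distr Q m (T i) = m"
    and T_indep: "indep_vars (\<lambda>_. m) T {1..}"
    and T_Gamma_indep:
      "indep_set
         (sets (vimage_algebra (space Q) (\<lambda>w. \<lambda>i\<in>{1..}. T i w) (PiM {1..} (\<lambda>_. m))))
         (sets (vimage_algebra (space Q) (\<lambda>w. \<lambda>i\<in>{1..}. \<Gamma> i w) (PiM {1..} (\<lambda>_. borel))))"

definition distinct_indices :: "nat \<Rightarrow> (nat \<Rightarrow> nat) set" where
  "distinct_indices k = {j \<in> {1..k} \<rightarrow>\<^sub>E {1..}. inj_on j {1..k}}"

definition lepage_series ::
    "real \<Rightarrow> ('e \<Rightarrow> ennreal) \<Rightarrow> (nat \<Rightarrow> 'v \<Rightarrow> real) \<Rightarrow> (nat \<Rightarrow> 'v \<Rightarrow> 'e) \<Rightarrow> nat \<Rightarrow>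
     ((nat \<Rightarrow> 'e) \<Rightarrow> ennreal) \<Rightarrow> 'v \<Rightarrow> ennreal" where
  "lepage_series \<alpha> \<psi> \<Gamma> T k f w =
     (SUP j\<in>distinct_indices k.
        f (\<lambda>r\<in>{1..k}. T (j r) w) *
        (\<Prod>r\<in>{1..k}. ennreal (\<Gamma> (j r) w powr (- 1 / \<alpha>)) * ennreal_powr (\<psi> (T (j r) w)) (1 / \<alpha>)))"

definition same_fdd ::
    "'i set \<Rightarrow> 'w measure \<Rightarrow> ('i \<Rightarrow> 'w \<Rightarrow> ennreal) \<Rightarrow> 'v measure \<Rightarrow> ('i \<Rightarrow> 'v \<Rightarrow> ennreal) \<Rightarrow> bool" where
  "same_fdd J P X Q Y \<longleftrightarrow>
     (\<forall>i\<in>J. X i \<in> borel_measurable P \<and> Y i \<in> borel_measurable Q) \<and>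
     (\<forall>F. finite F \<and> F \<subseteq> J \<longrightarrow>
        distr P (PiM F (\<lambda>_. borel)) (\<lambda>w. \<lambda>i\<in>F. X i w) =
        distr Q (PiM F (\<lambda>_. borel)) (\<lambda>w. \<lambda>i\<in>F. Y i w))"

end

theory Submission
  imports Defs "HOL-Real_Asymp.Real_Asymp"
begin

text \<open>On the space of exponential gaps and independent marks, the sup measure
  \<open>mass A = SUP {\<Gamma>\<^sub>i powr (- 1 / \<alpha>) * \<psi> (\<tau>\<^sub>i) powr (1 / \<alpha>) | \<tau>\<^sub>i \<in> A}\<close> and the series over tuples of distinct
  indices are defined path by path, and there max-linearity, monotonicity and the triangle
  inequality are immediate. The void probabilities of the marked Poisson arrivals show that \<open>mass\<close>
  has the same finite-dimensional laws as \<open>M\<close>. Each step of the construction of the integral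
  (values on rectangles, \<open>L\<^sup>\<gamma>\<close> limits, suprema along exhausting sequences, monotone limits) is almost
  surely a fixed measurable functional of countably many values of \<open>M\<close>; applied to \<open>mass\<close>, the same
  functional yields the series. Hence existence and uniqueness of the chosen versions, the almost sure
  statements and the equality of laws all transfer from the series.

  The analytic input is that the \<open>\<gamma>\<close>-th moment of the series of \<open>indicator B\<close> tends to \<open>0\<close> with the
  \<open>\<mu>\<^sup>k\<close>-measure of \<open>B\<close>. Over a set of finite measure only finitely many points exceed a given level,
  which gives almost sure convergence along fast subsequences. A dominating \<open>\<gamma>\<close>-th moment exists because
  a maximum of products of \<open>M\<close> over distinct cells of a partition is at most the product of
  \<open>max 1 M\<close> over all cells, whose factors are independent.\<close>

section \<open>Marked Poisson arrivals\<close>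

text \<open>The space \<open>P\<close> may be too poor to carry arrival times and marks, so
  \<open>M\<close> is never coupled with a series on the same space; whatever passes between the two
  sides has to be a statement about laws. This is why equality of joint distribution functions comes
  before any construction. A second obstacle is that the product sup measure and the integral are
  chosen with \<open>SOME\<close>: nothing can be said about the chosen version until some version
  is exhibited. Each time a candidate is defined as a limsup or a supremum along one fixed sequence,
  which is measurable on every path; the specification is checked on the side of the series, and the
  chosen version is then shown to agree with the candidate almost surely. The void probabilities are
  derived from the renewal structure of the gaps: discarding the first arrival and its mark leaves a
  process with the same law, started at a later time. Gaps, arrivals and marks are numbered from 0
  on the auxiliary space, so \<open>arrival v n\<close> stands for the arrival time with index n +
  1.\<close>

definition unit_exponential :: "real measure" where
  "unit_exponential = density lborel (exponential_density 1)"

definition lepage_space :: "'e measure \<Rightarrow> ((nat \<Rightarrow> real) \<times> (nat \<Rightarrow> 'e)) measure" where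
  "lepage_space m = PiM UNIV (\<lambda>_. unit_exponential) \<Otimes>\<^sub>M PiM UNIV (\<lambda>_. m)"

definition arrival :: "(nat \<Rightarrow> real) \<Rightarrow> nat \<Rightarrow> real" where
  "arrival v n = (\<Sum>l\<le>n. v l)"

lemma prob_space_unit_exponential: "prob_space unit_exponential"
  unfolding unit_exponential_def by (rule prob_space_exponential_density) simp

lemma sets_unit_exponential [measurable_cong, simp]: "sets unit_exponential = sets borel"
  by (simp add: unit_exponential_def)

lemma space_unit_exponential [simp]: "space unit_exponential = UNIV"
  by (simp add: unit_exponential_def)

lemma AE_unit_exponential: "AE s in unit_exponential. 0 < s"
proof -
  have "AE s in lborel. s \<noteq> (0::real)"
    by (rule AE_lborel_singleton)
  then show ?thesis
    unfolding unit_exponential_def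
    by (subst AE_density) (auto simp: exponential_density_def elim: eventually_mono)
qed

lemma prob_space_lepage_space:
  assumes "prob_space m" shows "prob_space (lepage_space m)"
proof -
  interpret E: prob_space unit_exponential by (rule prob_space_unit_exponential)
  interpret m: prob_space m by fact
  interpret A: product_prob_space "\<lambda>_. unit_exponential" "UNIV :: nat set" by standard
  interpret B: product_prob_space "\<lambda>_. m" "UNIV :: nat set" by standard
  interpret pair_prob_space "PiM (UNIV :: nat set) (\<lambda>_. unit_exponential)" "PiM (UNIV :: nat set) (\<lambda>_. m)"
    by standard
  show ?thesis unfolding lepage_space_def by (rule prob_space_axioms)
qed

lemma measurable_arrival [measurable]:
  "(\<lambda>x. arrival (fst x) n) \<in> borel_measurable (lepage_space m)"
  unfolding arrival_def lepage_space_def by measurable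

lemma measurable_mark [measurable]: "(\<lambda>x. snd x n) \<in> lepage_space m \<rightarrow>\<^sub>M m"
  unfolding lepage_space_def by measurable

text \<open>Regeneration at the first arrival: both factors are sequences of independent identically
  distributed variables, so splitting off the heads leaves tails with the law of the whole.
  Iterating the integral this way is the source of the recursions on
  \<open>lepage_space\<close>.\<close>

lemma nn_integral_lepage_space_iter:
  assumes "prob_space m" and f [measurable]: "f \<in> borel_measurable (lepage_space m)"
  shows "(\<integral>\<^sup>+x. f x \<partial>lepage_space m) =
    (\<integral>\<^sup>+s. \<integral>\<^sup>+y. \<integral>\<^sup>+x. f (case_nat s (fst x), case_nat y (snd x)) \<partial>lepage_space m \<partial>m \<partial>unit_exponential)"
proof -
  interpret E: prob_space unit_exponential by (rule prob_space_unit_exponential)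
  interpret m: prob_space m by fact
  interpret A: sequence_space unit_exponential by standard
  interpret B: sequence_space m by standard
  have f' [measurable]: "f \<in> borel_measurable (A.S \<Otimes>\<^sub>M B.S)"
    using f by (simp add: lepage_space_def)
  have "(\<integral>\<^sup>+x. f x \<partial>lepage_space m) = (\<integral>\<^sup>+v. \<integral>\<^sup>+t. f (v, t) \<partial>B.S \<partial>A.S)"
    unfolding lepage_space_def by (rule B.P.nn_integral_fst[symmetric]) simp
  also have "\<dots> = (\<integral>\<^sup>+v. \<integral>\<^sup>+t. f (v, t) \<partial>B.S \<partial>distr (unit_exponential \<Otimes>\<^sub>M A.S) A.S (\<lambda>(s, v). case_nat s v))"
    by (simp add: A.PiM_iter)
  also have "\<dots> = (\<integral>\<^sup>+s. \<integral>\<^sup>+v. \<integral>\<^sup>+t. f (case_nat s v, t) \<partial>B.S \<partial>A.S \<partial>unit_exponential)"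
    by (subst nn_integral_distr) (auto simp: A.P.nn_integral_fst[symmetric])
  also have "\<dots> = (\<integral>\<^sup>+s. \<integral>\<^sup>+v. (\<integral>\<^sup>+t. f (case_nat s v, t) \<partial>distr (m \<Otimes>\<^sub>M B.S) B.S (\<lambda>(s, v). case_nat s v)) \<partial>A.S \<partial>unit_exponential)"
    by (simp add: B.PiM_iter)
  also have "\<dots> = (\<integral>\<^sup>+s. \<integral>\<^sup>+v. \<integral>\<^sup>+y. \<integral>\<^sup>+t. f (case_nat s v, case_nat y t) \<partial>B.S \<partial>m \<partial>A.S \<partial>unit_exponential)"
    by (intro nn_integral_cong, subst nn_integral_distr) (auto simp: B.P.nn_integral_fst[symmetric])
  \<comment> \<open>The first mark is moved outside the remaining gaps, so that the tails of both
    sequences stand together again as one point of \<open>lepage_space\<close>.\<close>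
  also have "\<dots> = (\<integral>\<^sup>+s. \<integral>\<^sup>+y. \<integral>\<^sup>+v. \<integral>\<^sup>+t. f (case_nat s v, case_nat y t) \<partial>B.S \<partial>A.S \<partial>m \<partial>unit_exponential)"
  proof (intro nn_integral_cong)
    fix s :: real
    interpret pair_sigma_finite A.S m by standard
    show "(\<integral>\<^sup>+v. \<integral>\<^sup>+y. \<integral>\<^sup>+t. f (case_nat s v, case_nat y t) \<partial>B.S \<partial>m \<partial>A.S) =
          (\<integral>\<^sup>+y. \<integral>\<^sup>+v. \<integral>\<^sup>+t. f (case_nat s v, case_nat y t) \<partial>B.S \<partial>A.S \<partial>m)"
      by (rule Fubini'[symmetric]) measurable
  qed
  also have "\<dots> = (\<integral>\<^sup>+s. \<integral>\<^sup>+y. \<integral>\<^sup>+x. f (case_nat s (fst x), case_nat y (snd x)) \<partial>lepage_space m \<partial>m \<partial>unit_exponential)"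
    unfolding lepage_space_def
    by (intro nn_integral_cong, subst B.P.nn_integral_fst[symmetric]) auto
  finally show ?thesis .
qed

lemma arrival_case_nat: "arrival (case_nat s v) 0 = s" "arrival (case_nat s v) (Suc n) = s + arrival v n"
  unfolding arrival_def by (simp, subst sum.atMost_Suc_shift) simp

lemma AE_lepage_gap_pos:
  assumes "prob_space m"
  shows "AE x in lepage_space m. \<forall>n. 0 < fst x n"
proof -
  interpret E: prob_space unit_exponential by (rule prob_space_unit_exponential)
  interpret m: prob_space m by fact
  interpret A: sequence_space unit_exponential by standard
  interpret B: sequence_space m by standard
  interpret pair_prob_space A.S B.S by standard
  have *: "AE v in A.S. 0 < v n" for n
    by (intro AE_PiM_component AE_unit_exponential prob_space_unit_exponential) auto
  have "AE x in A.S \<Otimes>\<^sub>M B.S. \<forall>n. 0 < fst x n"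
    using * by (subst AE_all_countable) (auto intro!: AE_pair_measure)
  then show ?thesis unfolding lepage_space_def .
qed

lemma AE_lepage_mark:
  assumes "prob_space m" "AE y in m. R y" and [measurable]: "Measurable.pred m R"
  shows "AE x in lepage_space m. \<forall>n. R (snd x n)"
proof -
  interpret E: prob_space unit_exponential by (rule prob_space_unit_exponential)
  interpret m: prob_space m by fact
  interpret A: sequence_space unit_exponential by standard
  interpret B: sequence_space m by standard
  interpret pair_prob_space A.S B.S by standard
  have *: "AE v in B.S. R (v n)" for n
    by (intro AE_PiM_component assms) auto
  have "AE x in A.S \<Otimes>\<^sub>M B.S. \<forall>n. R (snd x n)"
    using * by (subst AE_all_countable) (auto intro!: AE_pair_measure)
  then show ?thesis unfolding lepage_space_def .
qed

section \<open>Void probabilities by a renewal equation\<close>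

definition exp_neg :: "ennreal \<Rightarrow> ennreal" where
  "exp_neg x = (if x = \<infinity> then 0 else ennreal (exp (- enn2real x)))"

text \<open>The probability that no marked point lies strictly below the graph of \<open>h\<close>
  when the clock already shows \<open>t\<close>. Void probabilities are the case t = 0; the extra
  time makes the family closed under removal of the first arrival.\<close>

definition survival :: "'e measure \<Rightarrow> ('e \<Rightarrow> real) \<Rightarrow> real \<Rightarrow> real" where
  "survival m h t = measure (lepage_space m) {x \<in> space (lepage_space m). \<forall>n. h (snd x n) \<le> t + arrival (fst x) n}"

text \<open>The first gap s and the first mark y satisfy their own constraint h y \<le> t + s, and
  all later constraints are those of a fresh process whose clock shows t + s. Integrating over y and
  s gives the renewal equation.\<close>

lemma survival_iter:
  assumes "prob_space m" and h [measurable]: "h \<in> borel_measurable m"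
  shows "survival m h \<in> borel_measurable borel"
    and "survival m h t = (\<integral>s. measure m {y \<in> space m. h y \<le> t + s} * survival m h (t + s) \<partial>unit_exponential)"
proof -
  interpret E: prob_space unit_exponential by (rule prob_space_unit_exponential)
  interpret m: prob_space m by fact
  interpret L: prob_space "lepage_space m" by (rule prob_space_lepage_space) fact
  define I where "I t x = (indicator {x. \<forall>n. h (snd x n) \<le> t + arrival (fst x) n} x :: ennreal)" for t x
  have I_meas [measurable]: "(\<lambda>z. I (fst z) (snd z)) \<in> borel_measurable (borel \<Otimes>\<^sub>M lepage_space m)"
    unfolding I_def indicator_def mem_Collect_eq by measurable
  have I_meas' [measurable]: "I t \<in> borel_measurable (lepage_space m)" for t
    unfolding I_def[abs_def] indicator_def mem_Collect_eq by measurable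
  have em: "ennreal (survival m h t) = (\<integral>\<^sup>+x. I t x \<partial>lepage_space m)" for t
  proof -
    have "(\<integral>\<^sup>+x. I t x \<partial>lepage_space m) =
      (\<integral>\<^sup>+x. indicator {x \<in> space (lepage_space m). \<forall>n. h (snd x n) \<le> t + arrival (fst x) n} x \<partial>lepage_space m)"
      unfolding I_def by (intro nn_integral_cong) (auto simp: indicator_def)
    then show ?thesis
      by (simp add: survival_def L.emeasure_eq_measure)
  qed
  have "(\<lambda>t. enn2real (ennreal (survival m h t))) \<in> borel_measurable borel"
    unfolding em by measurable
  then show meas: "survival m h \<in> borel_measurable borel"
    by (simp add: survival_def[abs_def])
  note [measurable] = meas
  have I_it: "I t (case_nat s (fst x), case_nat y (snd x)) = indicator {y. h y \<le> t + s} y * I (t + s) x" for t s x y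
  proof -
    have "(\<forall>n. Q n) \<longleftrightarrow> Q 0 \<and> (\<forall>n. Q (Suc n))" for Q :: "nat \<Rightarrow> bool"
      by (metis not0_implies_Suc)
    from this[of "\<lambda>n. h (case_nat y (snd x) n) \<le> t + arrival (case_nat s (fst x)) n"] show ?thesis
      by (simp add: I_def indicator_def arrival_case_nat add.assoc)
  qed
  have "ennreal (survival m h t) = (\<integral>\<^sup>+x. I t x \<partial>lepage_space m)"
    by (rule em)
  also have "\<dots> = (\<integral>\<^sup>+s. \<integral>\<^sup>+y. \<integral>\<^sup>+x. I t (case_nat s (fst x), case_nat y (snd x)) \<partial>lepage_space m \<partial>m \<partial>unit_exponential)"
    by (rule nn_integral_lepage_space_iter[OF assms(1)]) (unfold I_def indicator_def mem_Collect_eq, measurable)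
  also have "\<dots> = (\<integral>\<^sup>+s. \<integral>\<^sup>+y. indicator {y. h y \<le> t + s} y * ennreal (survival m h (t + s)) \<partial>m \<partial>unit_exponential)"
    unfolding I_it em by (intro nn_integral_cong nn_integral_cmult) measurable
  also have "\<dots> = (\<integral>\<^sup>+s. ennreal (measure m {y \<in> space m. h y \<le> t + s} * survival m h (t + s)) \<partial>unit_exponential)"
  proof (intro nn_integral_cong)
    fix s
    have "(\<integral>\<^sup>+y. indicator {y. h y \<le> t + s} y * ennreal (survival m h (t + s)) \<partial>m) =
          (\<integral>\<^sup>+y. indicator {y \<in> space m. h y \<le> t + s} y \<partial>m) * ennreal (survival m h (t + s))"
      by (subst nn_integral_multc[symmetric]) (auto intro!: nn_integral_cong simp: indicator_def)
    also have "(\<integral>\<^sup>+y. indicator {y \<in> space m. h y \<le> t + s} y \<partial>m) = ennreal (measure m {y \<in> space m. h y \<le> t + s})"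
      by (simp add: m.emeasure_eq_measure)
    finally show "(\<integral>\<^sup>+y. indicator {y. h y \<le> t + s} y * ennreal (survival m h (t + s)) \<partial>m) =
       ennreal (measure m {y \<in> space m. h y \<le> t + s} * survival m h (t + s))"
      by (simp add: ennreal_mult' survival_def)
  qed
  finally have *: "ennreal (survival m h t) =
    (\<integral>\<^sup>+s. ennreal (measure m {y \<in> space m. h y \<le> t + s} * survival m h (t + s)) \<partial>unit_exponential)" .
  have rho: "(\<lambda>s. measure m {y \<in> space m. h y \<le> t + s}) \<in> borel_measurable borel"
  proof -
    have "(\<lambda>s. emeasure m {y \<in> space m. h y \<le> t + s}) \<in> borel_measurable borel"
      by measurable
    then show ?thesis unfolding measure_def by measurable
  qed
  note [measurable] = this
  show "survival m h t = (\<integral>s. measure m {y \<in> space m. h y \<le> t + s} * survival m h (t + s) \<partial>unit_exponential)"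
    by (subst integral_eq_nn_integral) (simp_all add: *[symmetric], simp_all add: survival_def)
qed


lemma nn_integral_unit_exponential:
  assumes [measurable]: "f \<in> borel_measurable borel"
  shows "(\<integral>\<^sup>+s. f s \<partial>unit_exponential) = (\<integral>\<^sup>+s. ennreal (exp (- s)) * f s * indicator {0..} s \<partial>lborel)"
  unfolding unit_exponential_def
  by (subst nn_integral_density)
     (auto simp: exponential_density_def indicator_def intro!: nn_integral_cong)

lemma nn_integral_exp_atLeast: "(\<integral>\<^sup>+s. ennreal (exp (- s)) * indicator {b..} s \<partial>lborel) = ennreal (exp (- b))" for b :: real
proof -
  have "(\<integral>\<^sup>+s. ennreal (exp (- s)) * indicator {b..} s \<partial>lborel) = ennreal (0 - (- exp (- b)))"
  proof (rule nn_integral_FTC_atLeast)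
    show "((\<lambda>s::real. - exp (- s)) \<longlongrightarrow> 0) at_top"
      by real_asymp
  qed (auto intro!: derivative_eq_intros)
  then show ?thesis by simp
qed

lemma measure_unit_exponential_lessThan:
  assumes "0 \<le> L" shows "measure unit_exponential {..<L} = 1 - exp (- L)"
proof -
  interpret E: prob_space unit_exponential by (rule prob_space_unit_exponential)
  have "emeasure unit_exponential {L..} = (\<integral>\<^sup>+s. indicator {L..} s \<partial>unit_exponential)"
    by simp
  also have "\<dots> = (\<integral>\<^sup>+s. ennreal (exp (- s)) * indicator {L..} s \<partial>lborel)"
    using assms by (subst nn_integral_unit_exponential) (auto intro!: nn_integral_cong simp: indicator_def)
  finally have "emeasure unit_exponential {L..} = ennreal (exp (- L))"
    by (simp add: nn_integral_exp_atLeast)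
  then have "measure unit_exponential {L..} = exp (- L)"
    by (simp add: measure_def)
  moreover have "measure unit_exponential (UNIV - {L..}) = 1 - measure unit_exponential {L..}"
    using E.prob_compl[of "{L..}"] by simp
  moreover have "UNIV - {L..} = {..<L}" by auto
  ultimately show ?thesis by simp
qed

text \<open>\<open>F t = exp (- \<integral> max 0 (h - t) dm)\<close> solves the renewal equation satisfied by \<open>survival m h\<close>;
  for simple \<open>h\<close> it is differentiable off the finite range of \<open>h\<close>.\<close>

lemma exp_excess_renewal:
  fixes h :: "'e \<Rightarrow> real"
  assumes "prob_space m" and h: "simple_function m h" and L: "\<And>y. y \<in> space m \<Longrightarrow> h y \<le> L"
  defines "F \<equiv> \<lambda>t. exp (- (\<Sum>v\<in>h ` space m. measure m {y \<in> space m. h y = v} * max 0 (v - t)))"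
  shows "F t = (\<integral>s. measure m {y \<in> space m. h y \<le> t + s} * F (t + s) \<partial>unit_exponential)"
    and "F \<in> borel_measurable borel"
    and "\<And>t. 0 \<le> F t" "\<And>t. F t \<le> 1" "\<And>t. L \<le> t \<Longrightarrow> F t = 1"
    and "(\<lambda>s. measure m {y \<in> space m. h y \<le> t + s}) \<in> borel_measurable borel"
proof -
  interpret m: prob_space m by fact
  define V where "V = h ` space m"
  define p where "p v = measure m {y \<in> space m. h y = v}" for v
  define \<rho> where "\<rho> t = (\<Sum>v\<in>V. p v * (if v \<le> t then 1 else 0))" for t
  have fin: "finite V" unfolding V_def using h by (simp add: simple_function_def)
  have [measurable]: "h \<in> borel_measurable m" by (rule borel_measurable_simple_function) fact
  have p: "0 \<le> p v" for v by (simp add: p_def)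
  have sum_p: "(\<Sum>v\<in>W. p v) = measure m {y \<in> space m. h y \<in> W}" if "W \<subseteq> V" for W
  proof -
    have "finite W" using that fin by (rule finite_subset)
    then have "measure m (\<Union>v\<in>W. {y \<in> space m. h y = v}) = (\<Sum>v\<in>W. p v)"
      unfolding p_def by (intro m.finite_measure_finite_Union) (auto simp: disjoint_family_on_def)
    moreover have "(\<Union>v\<in>W. {y \<in> space m. h y = v}) = {y \<in> space m. h y \<in> W}" by auto
    ultimately show ?thesis by simp
  qed
  have rho: "measure m {y \<in> space m. h y \<le> t} = \<rho> t" for t
  proof -
    have "{y \<in> space m. h y \<le> t} = {y \<in> space m. h y \<in> {v \<in> V. v \<le> t}}"
      by (auto simp: V_def)
    then show ?thesis
      using sum_p[of "{v \<in> V. v \<le> t}"] fin by (simp add: \<rho>_def sum.inter_filter if_distrib cong: if_cong)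
  qed
  have rho01: "0 \<le> \<rho> t" "\<rho> t \<le> 1" for t by (simp_all add: rho[symmetric])
  have rho1: "\<rho> t = 1" if "L \<le> t" for t
  proof -
    have "{y \<in> space m. h y \<le> t} = space m" using L that by (auto intro: order_trans)
    then show ?thesis by (simp add: rho[symmetric] m.prob_space)
  qed
  have sum1: "(\<Sum>v\<in>V. p v) = 1"
  proof -
    have "{y \<in> space m. h y \<in> V} = space m" by (auto simp: V_def)
    then show ?thesis using sum_p[of V] by (simp add: m.prob_space)
  qed
  have F: "F t = exp (- (\<Sum>v\<in>V. p v * max 0 (v - t)))" for t
    by (simp add: F_def V_def p_def)
  show Fm: "F \<in> borel_measurable borel" unfolding F_def by measurable
  show F0: "0 \<le> F t" for t by (simp add: F)
  show Fle: "F t \<le> 1" for t by (auto simp: F intro!: sum_nonneg mult_nonneg_nonneg p)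
  show F1: "F t = 1" if "L \<le> t" for t
  proof -
    have "max 0 (v - t) = 0" if "v \<in> V" for v using L that \<open>L \<le> t\<close> by (force simp: V_def max_def)
    then show ?thesis by (simp add: F)
  qed
  have [measurable]: "\<rho> \<in> borel_measurable borel" unfolding \<rho>_def by measurable
  show "(\<lambda>s. measure m {y \<in> space m. h y \<le> t + s}) \<in> borel_measurable borel"
    unfolding rho by measurable
  note [measurable] = Fm
  \<comment> \<open>From time t + b on, \<open>F\<close> and \<open>\<rho>\<close> both equal 1, so
    beyond b the integrand is the plain exponential tail.\<close>
  define b where "b = max 0 (L - t)"
  have b: "0 \<le> b" "L \<le> t + b" by (auto simp: b_def)
  \<comment> \<open>Away from the kinks F' = (1 - \<rho>) F, hence the derivative of -exp(-s) F(t +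
    s) is exp(-s) \<rho>(t + s) F(t + s), which is the integrand of the renewal equation.\<close>
  define G where "G s = - exp (- s) * F (t + s)" for s
  have hint: "((\<lambda>s. exp (- s) * (\<rho> (t + s) * F (t + s))) has_integral (G b - G 0)) {0..b}"
  \<comment> \<open>The finitely many exceptional points are the s at which t + s crosses a value of
    \<open>h\<close>; continuity of \<open>G\<close> suffices there.\<close>
  proof (rule fundamental_theorem_of_calculus_strong[where S = "(\<lambda>v. v - t) ` V"])
    show "continuous_on {0..b} G" unfolding G_def F by (intro continuous_intros)
    fix s assume s: "s \<in> {0..b} - (\<lambda>v. v - t) ` V"
    have d: "((\<lambda>s. max 0 (v - (t + s))) has_real_derivative ((if v \<le> t + s then 1 else 0) - 1)) (at s)" if "v \<in> V" for v
    proof -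
      have "v - t \<noteq> s" using s that by auto
      then consider "v < t + s" | "t + s < v" by linarith
      then show ?thesis
      proof cases
        case 1
        have "\<forall>\<^sub>F x in nhds s. max 0 (v - (t + x)) = 0"
          using eventually_nhds_in_open[of "{v - t<..}" s] 1 by (auto elim!: eventually_mono)
        then have "((\<lambda>s. max 0 (v - (t + s))) has_real_derivative 0) (at s) \<longleftrightarrow> ((\<lambda>s. 0) has_real_derivative 0) (at s)"
          by (intro DERIV_cong_ev refl)
        then show ?thesis using 1 by simp
      next
        case 2
        have "\<forall>\<^sub>F x in nhds s. max 0 (v - (t + x)) = v - (t + x)"
          using eventually_nhds_in_open[of "{..<v - t}" s] 2 by (auto elim!: eventually_mono)
        then have "((\<lambda>s. max 0 (v - (t + s))) has_real_derivative -1) (at s) \<longleftrightarrow> ((\<lambda>s. v - (t + s)) has_real_derivative -1) (at s)"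
          by (intro DERIV_cong_ev refl)
        then show ?thesis using 2 by (auto intro!: derivative_eq_intros)
      qed
    qed
    have K: "((\<lambda>s. - (\<Sum>v\<in>V. p v * max 0 (v - (t + s)))) has_real_derivative (1 - \<rho> (t + s))) (at s)"
    proof -
      have "((\<lambda>s. - (\<Sum>v\<in>V. p v * max 0 (v - (t + s)))) has_real_derivative
        - (\<Sum>v\<in>V. p v * ((if v \<le> t + s then 1 else 0) - 1))) (at s)"
        by (intro DERIV_minus DERIV_sum DERIV_cmult d)
      also have "- (\<Sum>v\<in>V. p v * ((if v \<le> t + s then 1 else 0) - 1)) = 1 - \<rho> (t + s)"
        by (simp add: \<rho>_def right_diff_distrib sum_subtractf sum1 del: mult_minus_right)
      finally show ?thesis .
    qed
    have "((\<lambda>s. F (t + s)) has_real_derivative (F (t + s) * (1 - \<rho> (t + s)))) (at s)"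
      unfolding F by (rule DERIV_chain'[OF K DERIV_exp, THEN DERIV_cong]) simp
    then have "(G has_real_derivative (exp (- s) * (\<rho> (t + s) * F (t + s)))) (at s)"
      unfolding G_def by (auto intro!: derivative_eq_intros simp: algebra_simps)
    then show "(G has_vector_derivative (exp (- s) * (\<rho> (t + s) * F (t + s)))) (at s)"
      by (simp add: has_real_derivative_iff_has_vector_derivative)
  qed (use fin b in auto)
  have "(\<integral>\<^sup>+s. ennreal (\<rho> (t + s) * F (t + s)) \<partial>unit_exponential) =
    (\<integral>\<^sup>+s. ennreal (exp (- s)) * ennreal (\<rho> (t + s) * F (t + s)) * indicator {0..} s \<partial>lborel)"
    by (rule nn_integral_unit_exponential) measurable
  also have "\<dots> = (\<integral>\<^sup>+s. ennreal (indicator {0..b} s * (exp (- s) * (\<rho> (t + s) * F (t + s)))) +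
      ennreal (exp (- s)) * indicator {b..} s \<partial>lborel)"
  \<comment> \<open>The two pieces overlap at the single point b, a null set.\<close>
  proof (rule nn_integral_cong_AE)
    have "AE s in lborel. s \<noteq> b" by (rule AE_lborel_singleton)
    then show "AE s in lborel. ennreal (exp (- s)) * ennreal (\<rho> (t + s) * F (t + s)) * indicator {0..} s =
      ennreal (indicator {0..b} s * (exp (- s) * (\<rho> (t + s) * F (t + s)))) + ennreal (exp (- s)) * indicator {b..} s"
    proof eventually_elim
      case (elim s)
      show ?case
      proof (cases "s < b")
        case True then show ?thesis by (auto simp: indicator_def ennreal_mult' rho01 F0)
      next
        case False
        then have "L \<le> t + s" using b by auto
        then show ?thesis using False elim b by (auto simp: indicator_def rho1 F1)
      qed
    qed
  qed
  also have "\<dots> = (\<integral>\<^sup>+s. ennreal (indicator {0..b} s * (exp (- s) * (\<rho> (t + s) * F (t + s)))) \<partial>lborel) + ennreal (exp (- b))"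
    by (subst nn_integral_add) (auto simp: nn_integral_exp_atLeast)
  also have "(\<integral>\<^sup>+s. ennreal (indicator {0..b} s * (exp (- s) * (\<rho> (t + s) * F (t + s)))) \<partial>lborel) = ennreal (G b - G 0)"
    by (rule nn_integral_has_integral_lebesgue[OF _ hint]) (simp add: rho01 F0)
  also have "G b - G 0 = F t - exp (- b)"
    by (simp add: G_def F1 b)
  also have "ennreal (F t - exp (- b)) + ennreal (exp (- b)) = ennreal (F t)"
  proof -
    \<comment> \<open>Truncation at 0 in \<open>ennreal\<close> would falsify a negative difference;
      the sign comes from the integral of a nonnegative function.\<close>
    have "0 \<le> F t - exp (- b)"
      using has_integral_nonneg[OF hint] by (simp add: rho01 F0 G_def F1 b)
    then show ?thesis by (subst ennreal_plus[symmetric]) auto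
  qed
  finally have "(\<integral>\<^sup>+s. ennreal (\<rho> (t + s) * F (t + s)) \<partial>unit_exponential) = ennreal (F t)" .
  then show "F t = (\<integral>s. measure m {y \<in> space m. h y \<le> t + s} * F (t + s) \<partial>unit_exponential)"
    unfolding rho by (subst integral_eq_nn_integral) (auto simp: F0 rho01)
qed

text \<open>On \<open>t \<ge> 0\<close> the renewal equation is a contraction with factor \<open>1 - exp (- L)\<close>, because two solutions
  bounded by \<open>1\<close> agree beyond \<open>L\<close>.\<close>

lemma survival_simple:
  fixes h :: "'e \<Rightarrow> real"
  assumes "prob_space m" and h: "simple_function m h" and t: "0 \<le> t"
  shows "survival m h t = exp (- (\<Sum>v\<in>h ` space m. measure m {y \<in> space m. h y = v} * max 0 (v - t)))"
proof -
  interpret m: prob_space m by fact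
  interpret E: prob_space unit_exponential by (rule prob_space_unit_exponential)
  interpret S: prob_space "lepage_space m" by (rule prob_space_lepage_space) fact
  define V where "V = h ` space m"
  have fin: "finite V" unfolding V_def using h by (simp add: simple_function_def)
  \<comment> \<open>The inserted 1 keeps the set nonempty and \<open>L\<close> positive.\<close>
  define L where "L = Max (insert 1 V)"
  have L: "h y \<le> L" if "y \<in> space m" for y unfolding L_def using fin that by (auto simp: V_def)
  have Lpos: "0 < L" unfolding L_def using fin by (subst Max_gr_iff) auto
  have hm: "h \<in> borel_measurable m" by (rule borel_measurable_simple_function) fact
  define F where "F t = exp (- (\<Sum>v\<in>h ` space m. measure m {y \<in> space m. h y = v} * max 0 (v - t)))" for t
  note F = exp_excess_renewal[OF assms(1) h L, folded F_def]
  define G where "G = survival m h"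
  note G = survival_iter[OF assms(1) hm, folded G_def]
  note [measurable] = F(2) G(1) F(6)
  have G01: "0 \<le> G t" "G t \<le> 1" for t by (simp_all add: G_def survival_def)
  have arr: "AE x in lepage_space m. \<forall>n. 0 \<le> arrival (fst x) n"
    using AE_lepage_gap_pos[OF assms(1)]
    by eventually_elim (auto simp: arrival_def less_imp_le intro!: sum_nonneg)
  have G1: "G t = 1" if "L \<le> t" for t
    unfolding G_def survival_def
  proof (subst S.prob_eq_1)
    show "AE x in lepage_space m. x \<in> {x \<in> space (lepage_space m). \<forall>n. h (snd x n) \<le> t + arrival (fst x) n}"
      using arr AE_space
    proof eventually_elim
      case (elim x)
      have "h (snd x n) \<le> t + arrival (fst x) n" for n
        using L[OF measurable_space[OF measurable_mark elim(2), of n]] elim(1)[rule_format, of n] that by linarith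
      then show ?case using elim by simp
    qed
  qed (use hm in measurable)
  define D where "D t = \<bar>G t - F t\<bar>" for t
  have D01: "0 \<le> D t" "D t \<le> 1" for t
    using G01[of t] F(3,4)[of t] by (auto simp: D_def)
  have D0: "D t = 0" if "L \<le> t" for t using that by (simp add: D_def G1 F(5))
  define d where "d = (SUP t\<in>{0..}. D t)"
  have bdd: "bdd_above (D ` {0..})" using D01 by (auto intro!: bdd_aboveI)
  have Dd: "D t \<le> d" if "0 \<le> t" for t unfolding d_def using that by (intro cSUP_upper bdd) auto
  have d0: "0 \<le> d" using Dd[of 0] D01(1)[of 0] by linarith
  have step: "D t \<le> (1 - exp (- L)) * d" if t: "0 \<le> t" for t
  proof -
    let ?r = "\<lambda>s. measure m {y \<in> space m. h y \<le> t + s}"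
    have i1: "integrable unit_exponential (\<lambda>s. ?r s * G (t + s))"
      by (rule E.integrable_const_bound[where B=1]) (auto intro!: mult_le_one G01 AE_I2 simp: abs_mult G01)
    have i2: "integrable unit_exponential (\<lambda>s. ?r s * F (t + s))"
      by (rule E.integrable_const_bound[where B=1]) (auto intro!: mult_le_one F(3,4) AE_I2 simp: abs_mult F(3))
    have e1: "G t = (\<integral>s. ?r s * G (t + s) \<partial>unit_exponential)" by (rule G(2))
    have e2: "F t = (\<integral>s. ?r s * F (t + s) \<partial>unit_exponential)" by (rule F(1))
    have "G t - F t = (\<integral>s. ?r s * G (t + s) - ?r s * F (t + s) \<partial>unit_exponential)"
      unfolding Bochner_Integration.integral_diff[OF i1 i2] by (rule arg_cong2[of _ _ _ _ minus, OF e1 e2])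
    then have "D t \<le> (\<integral>s. \<bar>?r s * G (t + s) - ?r s * F (t + s)\<bar> \<partial>unit_exponential)"
      unfolding D_def by (simp only: integral_abs_bound)
    \<comment> \<open>For s \<ge> L both solutions are 1 at t + s because t \<ge> 0, so only s < L
      contributes, and there the difference is at most the supremum \<open>d\<close>.\<close>
    also have "\<dots> \<le> (\<integral>s. indicator {..<L} s * d \<partial>unit_exponential)"
    proof (rule integral_mono_AE)
      show "integrable unit_exponential (\<lambda>s. \<bar>?r s * G (t + s) - ?r s * F (t + s)\<bar>)"
        using i1 i2 by auto
      show "AE s in unit_exponential. \<bar>?r s * G (t + s) - ?r s * F (t + s)\<bar> \<le> indicator {..<L} s * d"
        using AE_unit_exponential
      proof eventually_elim
        case (elim s)
        have "\<bar>?r s * G (t + s) - ?r s * F (t + s)\<bar> = ?r s * D (t + s)"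
          by (simp add: D_def abs_mult flip: right_diff_distrib)
        also have "\<dots> \<le> 1 * D (t + s)" by (intro mult_right_mono D01) simp
        also have "\<dots> \<le> indicator {..<L} s * d"
          using Dd[of "t + s"] D0[of "t + s"] elim t d0 by (auto simp: indicator_def)
        finally show ?case .
      qed
      show "integrable unit_exponential (\<lambda>s. indicator {..<L} s * d)"
        by (rule E.integrable_const_bound[where B=d]) (use d0 in \<open>auto simp: indicator_def\<close>)
    qed
    also have "\<dots> = (1 - exp (- L)) * d"
      using Lpos by (simp add: measure_unit_exponential_lessThan)
    finally show ?thesis .
  qed
  \<comment> \<open>The factor is strictly below 1, so the finite supremum \<open>d\<close> must
    vanish.\<close>
  have "d \<le> (1 - exp (- L)) * d"
    unfolding d_def by (rule cSUP_least) (use step in \<open>auto simp: d_def\<close>)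
  then have "exp (- L) * d \<le> 0" by (simp add: algebra_simps)
  then have "d \<le> 0" by (simp add: mult_le_0_iff)
  then have "D t = 0" using Dd[OF t] D01(1)[of t] by linarith
  then show ?thesis by (simp add: D_def G_def F_def)
qed

lemma exp_neg_antimono: "x \<le> y \<Longrightarrow> exp_neg y \<le> exp_neg x"
  unfolding exp_neg_def by (auto simp: top_unique enn2real_mono less_top)

text \<open>Continuity from below, used to let simple functions increase to a general one. An
  infinite supremum is treated apart, since \<open>enn2real\<close> is not continuous at
  infinity.\<close>

lemma exp_neg_SUP:
  fixes x :: "nat \<Rightarrow> ennreal"
  assumes "incseq x" shows "exp_neg (SUP n. x n) = (INF n. exp_neg (x n))"
proof (cases "(SUP n. x n) = \<infinity>")
  case True
  have "(INF n. exp_neg (x n)) \<le> ennreal e" if "0 < e" for e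
  proof -
    \<comment> \<open>Chosen so that exp(-K) \<le> e; the maximum with 0 prevents truncation by
      \<open>ennreal\<close>.\<close>
    define K where "K = max 0 (- ln e)"
    have K: "0 \<le> K" "- K \<le> ln e" by (auto simp: K_def)
    have "ennreal (K) < (SUP n. x n)" by (simp add: True)
    then obtain n where n: "ennreal (K) < x n" by (auto simp: less_SUP_iff)
    have "exp_neg (x n) \<le> exp_neg (ennreal (K))"
      using n by (intro exp_neg_antimono less_imp_le)
    also have "\<dots> = ennreal (exp (- K))"
      using K by (simp add: exp_neg_def)
    also have "\<dots> \<le> ennreal e"
    proof (rule ennreal_leI)
      have "exp (- K) \<le> exp (ln e)" using K by simp
      then show "exp (- K) \<le> e" using that by simp
    qed
    finally show ?thesis by (rule INF_lower2[OF UNIV_I])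
  qed
  then have "(INF n. exp_neg (x n)) \<le> 0"
    by (intro ennreal_le_epsilon[where y = 0]) simp
  then show ?thesis using True by (simp add: exp_neg_def)
next
  case False
  have fin: "x n \<noteq> \<infinity>" for n
    using False SUP_upper[of n UNIV x] by (metis UNIV_I infinity_ennreal_def top.extremum_uniqueI)
  have "x \<longlonglongrightarrow> (SUP n. x n)" by (rule LIMSEQ_SUP) fact
  then have "(\<lambda>n. enn2real (x n)) \<longlonglongrightarrow> enn2real (SUP n. x n)"
    using ennreal_enn2real[of "SUP n. x n"] False
    by (intro tendsto_enn2real) (metis infinity_ennreal_def less_top, simp)
  then have "(\<lambda>n. ennreal (exp (- enn2real (x n)))) \<longlonglongrightarrow> ennreal (exp (- enn2real (SUP n. x n)))"
    by (intro tendsto_ennrealI tendsto_exp tendsto_minus)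
  then have "(\<lambda>n. exp_neg (x n)) \<longlonglongrightarrow> exp_neg (SUP n. x n)"
    unfolding exp_neg_def by (simp only: False fin if_False)
  moreover have "(\<lambda>n. exp_neg (x n)) \<longlonglongrightarrow> (INF n. exp_neg (x n))"
    using assms by (intro LIMSEQ_INF) (auto simp: decseq_def incseq_def intro: exp_neg_antimono)
  ultimately show ?thesis by (rule LIMSEQ_unique)
qed

lemma exp_neg_sum: "finite I \<Longrightarrow> exp_neg (\<Sum>i\<in>I. x i) = (\<Prod>i\<in>I. exp_neg (x i))"
proof (induction I rule: finite_induct)
  case (insert i I)
  have "exp_neg (a + b) = exp_neg a * exp_neg b" for a b
    by (cases a; cases b) (auto simp: exp_neg_def exp_add ennreal_mult[symmetric] simp flip: ennreal_plus exp_add)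
  then show ?case using insert by simp
qed (simp add: exp_neg_def)

text \<open>The case t = 0 of \<open>survival_simple\<close>, where the sum over the range of h
  becomes its integral; almost sure positivity of the arrivals lets \<open>ennreal\<close> and real
  inequalities be exchanged.\<close>

lemma void_probability_simple:
  assumes "prob_space m" and h: "simple_function m h" and fin: "\<And>y. y \<in> space m \<Longrightarrow> h y < \<infinity>"
  shows "emeasure (lepage_space m) {x \<in> space (lepage_space m). \<forall>n. h (snd x n) \<le> ennreal (arrival (fst x) n)} =
    exp_neg (\<integral>\<^sup>+y. h y \<partial>m)"
proof -
  interpret m: prob_space m by fact
  interpret S: prob_space "lepage_space m" by (rule prob_space_lepage_space) fact
  define r where "r y = enn2real (h y)" for y
  have hr: "h y = ennreal (r y)" if "y \<in> space m" for y using fin[OF that] by (simp add: r_def)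
  have r: "simple_function m r" unfolding r_def by (rule simple_function_compose1[OF h])
  have [measurable]: "h \<in> borel_measurable m" by (rule borel_measurable_simple_function) fact
  have [measurable]: "r \<in> borel_measurable m" by (rule borel_measurable_simple_function) fact
  have "emeasure (lepage_space m) {x \<in> space (lepage_space m). \<forall>n. h (snd x n) \<le> ennreal (arrival (fst x) n)} =
    emeasure (lepage_space m) {x \<in> space (lepage_space m). \<forall>n. r (snd x n) \<le> 0 + arrival (fst x) n}"
  proof (rule emeasure_eq_AE)
    show "AE x in lepage_space m. (x \<in> {x \<in> space (lepage_space m). \<forall>n. h (snd x n) \<le> ennreal (arrival (fst x) n)}) =
      (x \<in> {x \<in> space (lepage_space m). \<forall>n. r (snd x n) \<le> 0 + arrival (fst x) n})"
      using AE_lepage_gap_pos[OF assms(1)] AE_space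
    proof eventually_elim
      case (elim x)
      have "0 \<le> arrival (fst x) n" for n
        using elim by (auto simp: arrival_def less_imp_le intro!: sum_nonneg)
      moreover have "snd x n \<in> space m" for n
        using measurable_space[OF measurable_mark elim(2)] .
      ultimately show ?case by (simp add: hr ennreal_le_iff)
    qed
  qed measurable
  also have "\<dots> = ennreal (survival m r 0)"
    by (simp add: survival_def S.emeasure_eq_measure)
  also have "survival m r 0 = exp (- (\<Sum>v\<in>r ` space m. measure m {y \<in> space m. r y = v} * max 0 (v - 0)))"
    by (rule survival_simple[OF assms(1) r]) simp
  also have "(\<Sum>v\<in>r ` space m. measure m {y \<in> space m. r y = v} * max 0 (v - 0)) = enn2real (\<integral>\<^sup>+y. h y \<partial>m)"
  proof -
    have "(\<integral>\<^sup>+y. h y \<partial>m) = (\<integral>\<^sup>+y. ennreal (\<Sum>v\<in>r ` space m. v * indicator {y \<in> space m. r y = v} y) \<partial>m)"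
    proof (intro nn_integral_cong)
      fix y assume y: "y \<in> space m"
      have "(\<Sum>v\<in>r ` space m. v * indicator {y \<in> space m. r y = v} y) = (\<Sum>v\<in>r ` space m. if r y = v then v else 0)"
        using y by (intro sum.cong) (auto simp: indicator_def)
      also have "\<dots> = r y" using y r by (subst sum.delta') (auto simp: simple_function_def)
      finally show "h y = ennreal (\<Sum>v\<in>r ` space m. v * indicator {y \<in> space m. r y = v} y)" using hr[OF y] by simp
    qed
    also have "\<dots> = (\<integral>\<^sup>+y. (\<Sum>v\<in>r ` space m. ennreal v * indicator {y \<in> space m. r y = v} y) \<partial>m)"
      by (intro nn_integral_cong, subst sum_ennreal[symmetric])
         (auto simp: r_def indicator_def intro!: sum.cong)
    also have "\<dots> = (\<Sum>v\<in>r ` space m. ennreal v * emeasure m {y \<in> space m. r y = v})"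
      by (subst nn_integral_sum) (auto intro!: sum.cong simp: nn_integral_cmult_indicator)
    also have "\<dots> = (\<Sum>v\<in>r ` space m. ennreal (measure m {y \<in> space m. r y = v} * max 0 (v - 0)))"
      by (intro sum.cong) (auto simp: m.emeasure_eq_measure r_def ennreal_mult' mult.commute)
    also have "\<dots> = ennreal (\<Sum>v\<in>r ` space m. measure m {y \<in> space m. r y = v} * max 0 (v - 0))"
      by (rule sum_ennreal) auto
    finally show ?thesis by (simp add: sum_nonneg)
  qed
  also have "ennreal (exp (- enn2real (\<integral>\<^sup>+y. h y \<partial>m))) = exp_neg (\<integral>\<^sup>+y. h y \<partial>m)"
  proof -
    have "finite (h ` space m)" using h by (simp add: simple_function_def)
    then have "(\<integral>\<^sup>+y. h y \<partial>m) \<noteq> \<infinity>"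
      unfolding nn_integral_eq_simple_integral[OF h] simple_integral_def
      using fin by (auto simp: ennreal_mult_eq_top_iff m.emeasure_eq_measure less_top[symmetric]) metis
    then show ?thesis by (simp add: exp_neg_def)
  qed
  finally show ?thesis .
qed

text \<open>The points (arrival, mark) form a Poisson process of intensity ds \<times> m, and the
  integral of h is the area under its graph. Simple functions increasing to h give decreasing
  events, so both sides converge.\<close>

lemma void_probability:
  assumes "prob_space m" and h: "h \<in> borel_measurable m"
  shows "emeasure (lepage_space m) {x \<in> space (lepage_space m). \<forall>n. h (snd x n) \<le> ennreal (arrival (fst x) n)} =
    exp_neg (\<integral>\<^sup>+y. h y \<partial>m)"
proof -
  interpret S: prob_space "lepage_space m" by (rule prob_space_lepage_space) fact
  note [measurable] = h
  obtain g where g: "\<And>i. simple_function m (g i)" "incseq g" "\<And>i x. g i x < top" "\<And>x. (SUP i. g i x) = h x"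
    by (rule borel_measurable_implies_simple_function_sequence'[OF h]) blast
  have [measurable]: "g i \<in> borel_measurable m" for i by (rule borel_measurable_simple_function) (rule g)
  define A where "A i = {x \<in> space (lepage_space m). \<forall>n. g i (snd x n) \<le> ennreal (arrival (fst x) n)}" for i
  have [measurable]: "A i \<in> sets (lepage_space m)" for i unfolding A_def by measurable
  have g_le: "g i x \<le> c \<Longrightarrow> j \<le> i \<Longrightarrow> g j x \<le> c" for i j x c
    using g(2) by (auto simp: incseq_def le_fun_def intro: order_trans)
  have "decseq A" unfolding A_def decseq_def by (auto intro: g_le)
  moreover have "(\<Inter>i. A i) = {x \<in> space (lepage_space m). \<forall>n. h (snd x n) \<le> ennreal (arrival (fst x) n)}"
    unfolding A_def g(4)[symmetric] by (auto simp: SUP_le_iff)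
  ultimately have "emeasure (lepage_space m) {x \<in> space (lepage_space m). \<forall>n. h (snd x n) \<le> ennreal (arrival (fst x) n)} =
    (INF i. emeasure (lepage_space m) (A i))"
    using INF_emeasure_decseq[of A "lepage_space m"] by (auto simp: image_subset_iff)
  also have "\<dots> = (INF i. exp_neg (\<integral>\<^sup>+y. g i y \<partial>m))"
    unfolding A_def using g by (subst void_probability_simple[OF assms(1)]) auto
  also have "\<dots> = exp_neg (SUP i. \<integral>\<^sup>+y. g i y \<partial>m)"
    using g(2) by (intro exp_neg_SUP[symmetric]) (auto simp: incseq_def le_fun_def intro!: nn_integral_mono)
  also have "(SUP i. \<integral>\<^sup>+y. g i y \<partial>m) = (\<integral>\<^sup>+y. h y \<partial>m)"
    unfolding g(4)[symmetric] using g(2) by (intro nn_integral_monotone_convergence_SUP[symmetric]) auto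
  finally show ?thesis .
qed

section \<open>Equality of laws\<close>

text \<open>Frechet distribution functions are given at positive finite thresholds only. These still
  generate the product \<sigma>-algebra: threshold 0 is the countable intersection over the
  thresholds 1/(n + 1), and threshold infinity is the whole space.\<close>

lemma measure_eqI_PiM_ennreal:
  fixes A B :: "(nat \<Rightarrow> ennreal) measure"
  assumes "sets A = sets (PiM UNIV (\<lambda>_. borel))" "sets B = sets (PiM UNIV (\<lambda>_. borel))"
    and "prob_space A"
    and eq: "\<And>F x. finite F \<Longrightarrow> (\<And>i. i \<in> F \<Longrightarrow> 0 < x i) \<Longrightarrow>
      emeasure A {y. \<forall>i\<in>F. y i \<le> ennreal (x i)} = emeasure B {y. \<forall>i\<in>F. y i \<le> ennreal (x i)}"
  shows "A = B"
proof -
  interpret A: prob_space A by fact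
  define E where "E = {{y :: nat \<Rightarrow> ennreal. \<forall>i\<in>F. y i \<le> ennreal (x i)} | F x. finite F \<and> (\<forall>i\<in>F. 0 < x i)}"
  have E_sets: "E \<subseteq> sets (PiM UNIV (\<lambda>_. borel))"
  proof
    fix X assume "X \<in> E"
    then obtain F x where X: "X = {y. \<forall>i\<in>F. y i \<le> ennreal (x i)}" and F: "finite F"
      by (auto simp: E_def)
    have "{y \<in> space (PiM UNIV (\<lambda>_. borel)). \<forall>i\<in>F. y i \<le> ennreal (x i)} \<in> sets (PiM UNIV (\<lambda>_. borel))"
      using F by measurable
    then show "X \<in> sets (PiM UNIV (\<lambda>_. borel))" by (simp add: X space_PiM)
  qed
  define S where "S = sigma UNIV E"
  have spS [simp]: "space S = UNIV" by (simp add: S_def)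
  have E_S: "X \<in> E \<Longrightarrow> X \<in> sets S" for X by (auto simp: S_def)
  have "(\<lambda>y. y i) \<in> borel_measurable S" for i
  proof (rule borel_measurableI_le)
    fix c :: ennreal
    have pos: "{y \<in> space S. y i \<le> ennreal r} \<in> sets S" if "0 < r" for r
      using that by (intro E_S) (auto simp: E_def intro!: exI[of _ "{i}"] exI[of _ "\<lambda>_. r"])
    consider "c = 0" | r where "c = ennreal r" "0 < r" | "c = \<infinity>"
      by (cases c) (auto simp: le_less)
    then show "{y \<in> space S. y i \<le> c} \<in> sets S"
    proof cases
      case 1
      have "y \<le> 0 \<longleftrightarrow> (\<forall>n. y \<le> ennreal (1 / real (Suc n)))" for y :: ennreal
      proof
        assume le: "\<forall>n. y \<le> ennreal (1 / real (Suc n))"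
        show "y \<le> 0"
        proof (rule ennreal_le_epsilon)
          fix e :: real assume "0 < e"
          then obtain n where "1 / real (Suc n) < e" using nat_approx_posE by blast
          then show "y \<le> 0 + ennreal e" using order_trans[OF le[rule_format, of n] ennreal_leI[of _ e]] by simp
        qed
      qed auto
      then have "{y \<in> space S. y i \<le> c} = (\<Inter>n. {y \<in> space S. y i \<le> ennreal (1 / real (Suc n))})"
        unfolding 1 by auto
      moreover have "range (\<lambda>n. {y \<in> space S. y i \<le> ennreal (1 / real (Suc n))}) \<subseteq> sets S"
        by (intro image_subsetI pos) simp
      ultimately show ?thesis by (simp only:) (rule sets.countable_INT, auto)
    next
      case 2 then show ?thesis using pos by simp
    next
      case 3 then show ?thesis using sets.top[of S] by simp
    qed
  qed
  then have "(\<lambda>y. y) \<in> S \<rightarrow>\<^sub>M PiM UNIV (\<lambda>_. borel)"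
    by (intro measurable_PiM_single') auto
  then have "sets (PiM UNIV (\<lambda>_. borel)) \<subseteq> sets S"
    using measurable_sets[of "\<lambda>y. y" S "PiM UNIV (\<lambda>_. borel)"] sets.sets_into_space
    by (auto simp: space_PiM)
  moreover have "sets S \<subseteq> sets (PiM UNIV (\<lambda>_. borel))"
    unfolding S_def using sets.sigma_sets_subset[OF E_sets] by (simp add: space_PiM)
  ultimately have sets_eq: "sets (PiM UNIV (\<lambda>_. borel)) = sigma_sets UNIV E"
    by (simp add: S_def)
  show ?thesis
  proof (rule measure_eqI_generator_eq[where E = E and \<Omega> = UNIV and A = "\<lambda>_. UNIV"])
    show "Int_stable E"
    proof (rule Int_stableI)
      fix X Y assume "X \<in> E" "Y \<in> E"
      then obtain F x G z where X: "X = {y. \<forall>i\<in>F. y i \<le> ennreal (x i)}" "finite F" "\<forall>i\<in>F. 0 < x i"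
        and Y: "Y = {y. \<forall>i\<in>G. y i \<le> ennreal (z i)}" "finite G" "\<forall>i\<in>G. 0 < z i"
        unfolding E_def by auto
      define v where "v i = (if i \<in> F \<inter> G then min (x i) (z i) else if i \<in> F then x i else z i)" for i
      have "X \<inter> Y = {y. \<forall>i\<in>F \<union> G. y i \<le> ennreal (v i)}"
      proof (intro set_eqI)
        fix y
        have "(y i \<le> ennreal (v i)) \<longleftrightarrow> (i \<in> F \<longrightarrow> y i \<le> ennreal (x i)) \<and> (i \<in> G \<longrightarrow> y i \<le> ennreal (z i))"
          if "i \<in> F \<union> G" for i
        proof -
          have "ennreal (min a b) = min (ennreal a) (ennreal b)" for a b
            by (metis ennreal_leI linear min.absorb1 min.absorb2)
          then show ?thesis using that by (auto simp: v_def)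
        qed
        then show "y \<in> X \<inter> Y \<longleftrightarrow> y \<in> {y. \<forall>i\<in>F \<union> G. y i \<le> ennreal (v i)}"
          by (auto simp: X Y)
      qed
      moreover have "\<forall>i\<in>F \<union> G. 0 < v i" using X(3) Y(3) by (auto simp: v_def)
      ultimately show "X \<inter> Y \<in> E" using X(2) Y(2) unfolding E_def by blast
    qed
    show "emeasure A X = emeasure B X" if "X \<in> E" for X
      using that eq by (auto simp: E_def)
    show "range (\<lambda>_::nat. UNIV :: (nat \<Rightarrow> ennreal) set) \<subseteq> E"
      by (auto simp: E_def intro!: exI[of _ "{}"])
    show "emeasure A UNIV \<noteq> \<infinity>" by simp
  qed (auto simp: assms sets_eq)
qed

section \<open>Joint distribution functions of the sup measure\<close>

context frechet_random_sup_measure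
begin

lemma emeasure_le:
  assumes "A \<in> sets \<mu>" "0 < x"
  shows "emeasure P {w \<in> space P. M A w \<le> ennreal x} = exp_neg (emeasure \<mu> A * ennreal (x powr - \<alpha>))"
proof -
  have "emeasure P {w \<in> space P. M A w \<le> ennreal x} =
    ennreal (if emeasure \<mu> A = \<infinity> then 0 else exp (- (measure \<mu> A * x powr - \<alpha>)))"
    by (simp add: emeasure_eq_measure frechet_distribution[OF assms])
  also have "\<dots> = exp_neg (emeasure \<mu> A * ennreal (x powr - \<alpha>))"
  proof (cases "emeasure \<mu> A = \<infinity>")
    case True then show ?thesis using assms(2) by (simp add: exp_neg_def ennreal_top_mult)
  next
    case False
    then have "emeasure \<mu> A = ennreal (measure \<mu> A)" by (simp add: emeasure_eq_ennreal_measure)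
    then show ?thesis using False by (simp add: exp_neg_def flip: ennreal_mult)
  qed
  finally show ?thesis .
qed

text \<open>The sup measure axiom concerns sequences; enumerating the finite set with repetitions
  applies it without padding by empty sets.\<close>

lemma AE_finite_UN:
  assumes "finite X" "X \<noteq> {}" "\<And>s. s \<in> X \<Longrightarrow> C s \<in> sets \<mu>"
  shows "AE w in P. M (\<Union>s\<in>X. C s) w = (SUP s\<in>X. M (C s) w)"
proof -
  have r: "range (from_nat_into X) = X"
    using assms by (intro range_from_nat_into countable_finite)
  have "AE w in P. M (\<Union>j. C (from_nat_into X j)) w = (SUP j. M (C (from_nat_into X j)) w)"
    using assms from_nat_into[OF assms(2)] by (intro sup_measure) auto
  moreover have "(\<Union>j. C (from_nat_into X j)) = (\<Union>s\<in>X. C s)"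
    by (subst r[symmetric]) auto
  moreover have "(SUP j. M (C (from_nat_into X j)) w) = (SUP s\<in>X. M (C s) w)" for w
    by (subst r[symmetric]) (simp only: image_image)
  ultimately show ?thesis by simp
qed

lemma emeasure_disjoint_le:
  assumes X: "finite X" and C: "\<And>s. s \<in> X \<Longrightarrow> C s \<in> sets \<mu>" "disjoint_family_on C X"
    and c: "\<And>s. s \<in> X \<Longrightarrow> 0 < c s"
  shows "emeasure P {w \<in> space P. \<forall>s\<in>X. M (C s) w \<le> ennreal (c s)} =
    exp_neg (\<Sum>s\<in>X. emeasure \<mu> (C s) * ennreal (c s powr - \<alpha>))"
proof (cases "X = {}")
  case True then show ?thesis by (simp add: emeasure_space_1 exp_neg_def)
next
  case False
  obtain g where g: "bij_betw g {1..card X} X" using ex_bij_betw_nat_finite_1[OF X] by blast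
  have gX: "g i \<in> X" if "i \<in> {1..card X}" for i using g that by (auto simp: bij_betw_def)
  have "indep_vars (\<lambda>_. borel) (\<lambda>i. M (C (g i))) {1..card X}"
  proof (rule independently_scattered)
    show "disjoint_family_on (\<lambda>i. C (g i)) {1..card X}"
      using C(2) g unfolding disjoint_family_on_def bij_betw_def inj_on_def by blast
  qed (use C gX in auto)
  then have "prob (\<Inter>i\<in>{1..card X}. M (C (g i)) -` {..ennreal (c (g i))} \<inter> space P) =
    (\<Prod>i\<in>{1..card X}. prob (M (C (g i)) -` {..ennreal (c (g i))} \<inter> space P))"
    using False X by (intro indep_varsD_finite) (auto simp: Suc_le_eq card_gt_0_iff)
  also have "\<dots> = (\<Prod>s\<in>X. prob (M (C s) -` {..ennreal (c s)} \<inter> space P))"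
    using g by (rule prod.reindex_bij_betw)
  also have "(\<Inter>i\<in>{1..card X}. M (C (g i)) -` {..ennreal (c (g i))} \<inter> space P) =
    (\<Inter>s\<in>g ` {1..card X}. M (C s) -` {..ennreal (c s)} \<inter> space P)"
    by blast
  also have "g ` {1..card X} = X" using g by (simp add: bij_betw_def)
  also have "(\<Inter>s\<in>X. M (C s) -` {..ennreal (c s)} \<inter> space P) = {w \<in> space P. \<forall>s\<in>X. M (C s) w \<le> ennreal (c s)}"
    using False by auto
  finally have "emeasure P {w \<in> space P. \<forall>s\<in>X. M (C s) w \<le> ennreal (c s)} =
    (\<Prod>s\<in>X. emeasure P (M (C s) -` {..ennreal (c s)} \<inter> space P))"
    by (simp add: emeasure_eq_measure prod_ennreal)
  also have "\<dots> = (\<Prod>s\<in>X. exp_neg (emeasure \<mu> (C s) * ennreal (c s powr - \<alpha>)))"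
  proof (rule prod.cong)
    fix s assume s: "s \<in> X"
    have "M (C s) -` {..ennreal (c s)} \<inter> space P = {w \<in> space P. M (C s) w \<le> ennreal (c s)}" by auto
    then show "emeasure P (M (C s) -` {..ennreal (c s)} \<inter> space P) = exp_neg (emeasure \<mu> (C s) * ennreal (c s powr - \<alpha>))"
      using emeasure_le[OF C(1)[OF s] c[OF s]] by simp
  qed simp
  finally show ?thesis by (simp add: exp_neg_sum[OF X])
qed

text \<open>The sets are refined into the disjoint atoms of points lying in exactly the sets indexed
  by s. On an atom only the smallest threshold counts, and the values on atoms are independent.
  Rewriting the resulting sum as an integral removes the atoms from the statement, so that it can be
  compared with a void probability.\<close>

lemma joint_cdf:
  assumes F: "finite F" and B: "\<And>i. i \<in> F \<Longrightarrow> B i \<in> sets \<mu>" and x: "\<And>i. i \<in> F \<Longrightarrow> 0 < x i" and "\<alpha> > 0"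
  shows "emeasure P {w \<in> space P. \<forall>i\<in>F. M (B i) w \<le> ennreal (x i)} =
    exp_neg (\<integral>\<^sup>+y. (SUP i\<in>{i\<in>F. y \<in> B i}. ennreal (x i powr - \<alpha>)) \<partial>\<mu>)"
proof -
  define C where "C s = {y \<in> space \<mu>. {i\<in>F. y \<in> B i} = s}" for s
  \<comment> \<open>Points in none of the sets impose no constraint, and \<open>Min\<close> needs a
    nonempty index set.\<close>
  define X where "X = Pow F - {{}}"
  define c where "c s = Min (x ` s)" for s
  have fX: "finite X" using F by (simp add: X_def)
  have Xs: "finite s" "s \<noteq> {}" "s \<subseteq> F" if "s \<in> X" for s
    using that F by (auto simp: X_def intro: finite_subset)
  have C: "C s \<in> sets \<mu>" if "s \<in> X" for s
  proof -
    have "C s = {y \<in> space \<mu>. \<forall>i\<in>F. (y \<in> B i) \<longleftrightarrow> i \<in> s}"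
      using Xs(3)[OF that] by (auto simp: C_def)
    also have "\<dots> \<in> sets \<mu>"
    proof (rule sets.sets_Collect_finite_All[OF _ F])
      fix i assume "i \<in> F"
      then have [measurable]: "B i \<in> sets \<mu>" by (rule B)
      show "{y \<in> space \<mu>. (y \<in> B i) \<longleftrightarrow> i \<in> s} \<in> sets \<mu>" by measurable
    qed
    finally show ?thesis .
  qed
  have disj: "disjoint_family_on C X" by (auto simp: disjoint_family_on_def C_def)
  have c: "0 < c s" if "s \<in> X" for s
    using Xs[OF that] x by (auto simp: c_def)
  have le_c: "(a \<le> ennreal (c s)) \<longleftrightarrow> (\<forall>i\<in>s. a \<le> ennreal (x i))" if "s \<in> X" for a s
  proof
    assume "a \<le> ennreal (c s)"
    moreover have "c s \<le> x i" if "i \<in> s" for i using that Xs[OF \<open>s \<in> X\<close>] by (auto simp: c_def)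
    ultimately show "\<forall>i\<in>s. a \<le> ennreal (x i)" by (auto intro: order_trans ennreal_leI)
  next
    assume "\<forall>i\<in>s. a \<le> ennreal (x i)"
    moreover have "c s \<in> x ` s" unfolding c_def using Xs[OF that] by (intro Min_in) auto
    ultimately show "a \<le> ennreal (c s)" by auto
  qed
  have BU: "B i = (\<Union>s\<in>{s\<in>X. i \<in> s}. C s)" if "i \<in> F" for i
    using sets.sets_into_space[OF B[OF that]] that by (auto simp: C_def X_def)
  have "AE w in P. \<forall>i\<in>F. M (B i) w = (SUP s\<in>{s\<in>X. i \<in> s}. M (C s) w)"
  proof (intro AE_finite_allI F)
    fix i assume i: "i \<in> F"
    have "F \<in> {s\<in>X. i \<in> s}" using i by (auto simp: X_def)
    then have "AE w in P. M (\<Union>s\<in>{s\<in>X. i \<in> s}. C s) w = (SUP s\<in>{s\<in>X. i \<in> s}. M (C s) w)"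
      using fX C by (intro AE_finite_UN) auto
    then show "AE w in P. M (B i) w = (SUP s\<in>{s\<in>X. i \<in> s}. M (C s) w)"
      by (simp only: BU[OF i, symmetric])
  qed
  then have ev: "AE w in P. (w \<in> {w \<in> space P. \<forall>i\<in>F. M (B i) w \<le> ennreal (x i)}) =
    (w \<in> {w \<in> space P. \<forall>s\<in>X. M (C s) w \<le> ennreal (c s)})"
  proof eventually_elim
    case (elim w)
    have "(\<forall>i\<in>F. M (B i) w \<le> ennreal (x i)) \<longleftrightarrow> (\<forall>i\<in>F. \<forall>s\<in>{s\<in>X. i \<in> s}. M (C s) w \<le> ennreal (x i))"
      using elim by (intro ball_cong) (auto simp: SUP_le_iff)
    also have "\<dots> \<longleftrightarrow> (\<forall>s\<in>X. \<forall>i\<in>s. M (C s) w \<le> ennreal (x i))"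
      using Xs(3) by blast
    also have "\<dots> \<longleftrightarrow> (\<forall>s\<in>X. M (C s) w \<le> ennreal (c s))"
      by (intro ball_cong refl le_c[symmetric])
    finally show ?case by simp
  qed
  have "emeasure P {w \<in> space P. \<forall>i\<in>F. M (B i) w \<le> ennreal (x i)} =
    emeasure P {w \<in> space P. \<forall>s\<in>X. M (C s) w \<le> ennreal (c s)}"
  proof (rule emeasure_eq_AE[OF ev])
    have sets: "{w \<in> space P. M A w \<le> a} \<in> sets P" if "A \<in> sets \<mu>" for A a
    proof -
      have [measurable]: "M A \<in> borel_measurable P" by (rule random_variable[OF that])
      show ?thesis by measurable
    qed
    show "{w \<in> space P. \<forall>i\<in>F. M (B i) w \<le> ennreal (x i)} \<in> sets P"
      by (intro sets.sets_Collect_finite_All sets B F)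
    show "{w \<in> space P. \<forall>s\<in>X. M (C s) w \<le> ennreal (c s)} \<in> sets P"
      by (intro sets.sets_Collect_finite_All sets C fX)
  qed
  also have "\<dots> = exp_neg (\<Sum>s\<in>X. emeasure \<mu> (C s) * ennreal (c s powr - \<alpha>))"
    by (rule emeasure_disjoint_le[OF fX C disj c])
  also have "(\<Sum>s\<in>X. emeasure \<mu> (C s) * ennreal (c s powr - \<alpha>)) =
    (\<integral>\<^sup>+y. (\<Sum>s\<in>X. ennreal (c s powr - \<alpha>) * indicator (C s) y) \<partial>\<mu>)"
    using C by (subst nn_integral_sum) (simp_all add: nn_integral_cmult_indicator mult.commute[of "emeasure _ _"])
  also have "\<dots> = (\<integral>\<^sup>+y. (SUP i\<in>{i\<in>F. y \<in> B i}. ennreal (x i powr - \<alpha>)) \<partial>\<mu>)"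
  proof (intro nn_integral_cong)
    fix y assume y: "y \<in> space \<mu>"
    define s0 where "s0 = {i\<in>F. y \<in> B i}"
    have "(\<Sum>s\<in>X. ennreal (c s powr - \<alpha>) * indicator (C s) y) = (\<Sum>s\<in>X. if s0 = s then ennreal (c s powr - \<alpha>) else 0)"
      using y by (intro sum.cong) (auto simp: C_def s0_def indicator_def)
    also have "\<dots> = (if s0 \<in> X then ennreal (c s0 powr - \<alpha>) else 0)"
      using fX by (rule sum.delta')
    \<comment> \<open>The exponent is negative, so the smallest threshold gives the largest
      power.\<close>
    also have "\<dots> = (SUP i\<in>s0. ennreal (x i powr - \<alpha>))"
    proof (cases "s0 = {}")
      case False
      then have s0: "s0 \<in> X" by (auto simp: X_def s0_def)
      show ?thesis
      proof (rule antisym)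
        have "c s0 \<in> x ` s0" unfolding c_def using Xs[OF s0] by (intro Min_in) auto
        then show "(if s0 \<in> X then ennreal (c s0 powr - \<alpha>) else 0) \<le> (SUP i\<in>s0. ennreal (x i powr - \<alpha>))"
          using s0 by (auto intro: SUP_upper)
        have "x i powr - \<alpha> \<le> c s0 powr - \<alpha>" if "i \<in> s0" for i
          using that Xs[OF s0] c[OF s0] \<open>\<alpha> > 0\<close> by (intro powr_mono2') (auto simp: c_def)
        then show "(SUP i\<in>s0. ennreal (x i powr - \<alpha>)) \<le> (if s0 \<in> X then ennreal (c s0 powr - \<alpha>) else 0)"
          using s0 by (auto intro!: SUP_least ennreal_leI)
      qed
    qed (auto simp: X_def bot_ennreal)
    finally show "(\<Sum>s\<in>X. ennreal (c s powr - \<alpha>) * indicator (C s) y) = (SUP i\<in>{i\<in>F. y \<in> B i}. ennreal (x i powr - \<alpha>))"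
      by (simp add: s0_def)
  qed
  finally show ?thesis .
qed

end

section \<open>The sup measure of the marked arrivals\<close>

locale lepage_representation =
  fixes \<alpha> :: real and \<mu> m :: "'e measure" and \<psi> :: "'e \<Rightarrow> ennreal"
  assumes alpha_pos: "0 < \<alpha>"
    and prob_m: "prob_space m"
    and sets_m: "sets m = sets \<mu>"
    and psi_measurable: "\<psi> \<in> borel_measurable m"
    and psi_density: "\<mu> = density m \<psi>"
    and psi_pos_finite: "AE x in m. 0 < \<psi> x \<and> \<psi> x < \<infinity>"
begin

abbreviation "\<Omega> \<equiv> lepage_space m"

definition weight :: "nat \<Rightarrow> (nat \<Rightarrow> real) \<times> (nat \<Rightarrow> 'e) \<Rightarrow> ennreal" where
  "weight n x = ennreal (arrival (fst x) n powr (- 1 / \<alpha>)) * ennreal_powr (\<psi> (snd x n)) (1 / \<alpha>)"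

definition mass :: "'e set \<Rightarrow> (nat \<Rightarrow> real) \<times> (nat \<Rightarrow> 'e) \<Rightarrow> ennreal" where
  "mass A x = (SUP n. indicator A (snd x n) * weight n x)"

lemma space_m: "space m = space \<mu>"
  by (rule sets_eq_imp_space_eq[OF sets_m])

lemma mark_in_space: "x \<in> space \<Omega> \<Longrightarrow> snd x n \<in> space \<mu>"
  using measurable_space[OF measurable_mark, of x m n] by (simp add: space_m)

lemma measurable_ennreal_powr [measurable]: "(\<lambda>x. ennreal_powr x p) \<in> borel_measurable borel"
  unfolding ennreal_powr_def by measurable

lemma measurable_mark_mu [measurable]: "(\<lambda>x. snd x n) \<in> \<Omega> \<rightarrow>\<^sub>M \<mu>"
  using measurable_mark[of n m] measurable_cong_sets[OF refl sets_m] by blast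

lemma measurable_weight [measurable]: "weight n \<in> borel_measurable \<Omega>"
proof -
  note [measurable] = psi_measurable
  show ?thesis unfolding weight_def by measurable
qed

lemma measurable_mass [measurable (raw)]:
  assumes [measurable]: "A \<in> sets \<mu>" shows "mass A \<in> borel_measurable \<Omega>"
  unfolding mass_def by measurable

sublocale \<Omega>: prob_space \<Omega>
  by (rule prob_space_lepage_space) (rule prob_m)

lemma AE_regular:
  "AE x in \<Omega>. \<forall>n. 0 < arrival (fst x) n \<and> 0 < \<psi> (snd x n) \<and> \<psi> (snd x n) < \<infinity>"
proof -
  note [measurable] = psi_measurable
  have "AE x in \<Omega>. \<forall>n. 0 < \<psi> (snd x n) \<and> \<psi> (snd x n) < \<infinity>"
    by (rule AE_lepage_mark[OF prob_m psi_pos_finite]) measurable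
  with AE_lepage_gap_pos[OF prob_m] show ?thesis
    by eventually_elim (auto simp: arrival_def intro!: sum_pos)
qed

text \<open>Taking powers with exponent \<alpha> makes the condition linear in the arrival time,
  which is the shape that \<open>void_probability\<close> accepts.\<close>

lemma weight_le_iff:
  assumes w: "0 < arrival (fst w) n" "0 < \<psi> (snd w n)" "\<psi> (snd w n) < \<infinity>" and c: "0 < c"
  shows "weight n w \<le> ennreal c \<longleftrightarrow> \<psi> (snd w n) * ennreal (c powr - \<alpha>) \<le> ennreal (arrival (fst w) n)"
proof -
  obtain p where p: "\<psi> (snd w n) = ennreal p" "0 < p" using w by (cases "\<psi> (snd w n)") auto
  let ?G = "arrival (fst w) n"
  have "weight n w = ennreal ((p / ?G) powr (1 / \<alpha>))"
    using p w by (simp add: weight_def ennreal_powr_def powr_divide powr_minus divide_simps flip: ennreal_mult)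
  then have "weight n w \<le> ennreal c \<longleftrightarrow> (p / ?G) powr (1 / \<alpha>) \<le> c"
    using c by (simp add: ennreal_le_iff)
  also have "\<dots> \<longleftrightarrow> ((p / ?G) powr (1 / \<alpha>)) powr \<alpha> \<le> c powr \<alpha>"
    using alpha_pos c by (smt (verit) powr_less_mono2 powr_mono2 powr_ge_zero)
  also have "\<dots> \<longleftrightarrow> p / ?G \<le> c powr \<alpha>"
    using alpha_pos p w by (simp add: powr_powr)
  also have "\<dots> \<longleftrightarrow> p * c powr - \<alpha> \<le> ?G"
    using w c by (simp add: powr_minus field_simps)
  also have "\<dots> \<longleftrightarrow> \<psi> (snd w n) * ennreal (c powr - \<alpha>) \<le> ennreal ?G"
    using w p by (simp add: ennreal_le_iff flip: ennreal_mult)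
  finally show ?thesis .
qed

text \<open>All constraints on the n-th point combine into \<psi> g \<le> arrival, where g is the
  largest of the active powers of thresholds. The exponent of the void probability is then the
  m-integral of \<psi> g, and the density turns it into the \<mu>-integral found in
  \<open>joint_cdf\<close>.\<close>

lemma mass_cdf:
  assumes F: "finite F" and B: "\<And>i. i \<in> F \<Longrightarrow> B i \<in> sets \<mu>" and x: "\<And>i. i \<in> F \<Longrightarrow> 0 < x i"
  shows "emeasure \<Omega> {w \<in> space \<Omega>. \<forall>i\<in>F. mass (B i) w \<le> ennreal (x i)} =
    exp_neg (\<integral>\<^sup>+y. (SUP i\<in>{i\<in>F. y \<in> B i}. ennreal (x i powr - \<alpha>)) \<partial>\<mu>)"
proof -
  define g where "g y = (SUP i\<in>{i\<in>F. y \<in> B i}. ennreal (x i powr - \<alpha>))" for y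
  \<comment> \<open>A fixed index set with indicators, in place of one depending on y, for
    measurability.\<close>
  have g_alt: "g y = (SUP i\<in>F. indicator (B i) y * ennreal (x i powr - \<alpha>))" for y
    unfolding g_def by (intro antisym SUP_least) (auto simp: indicator_def intro: SUP_upper2 SUP_upper)
  have gm: "g \<in> borel_measurable \<mu>"
    unfolding g_alt using B F by (intro borel_measurable_SUP countable_finite) auto
  then have gm' [measurable]: "g \<in> borel_measurable m"
    using measurable_cong_sets[OF sets_m refl] by blast
  note [measurable] = psi_measurable
  have "emeasure \<Omega> {w \<in> space \<Omega>. \<forall>i\<in>F. mass (B i) w \<le> ennreal (x i)} =
    emeasure \<Omega> {w \<in> space \<Omega>. \<forall>n. \<psi> (snd w n) * g (snd w n) \<le> ennreal (arrival (fst w) n)}"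
  proof (rule emeasure_eq_AE)
    show "AE w in \<Omega>. (w \<in> {w \<in> space \<Omega>. \<forall>i\<in>F. mass (B i) w \<le> ennreal (x i)}) =
      (w \<in> {w \<in> space \<Omega>. \<forall>n. \<psi> (snd w n) * g (snd w n) \<le> ennreal (arrival (fst w) n)})"
      using AE_regular
    proof eventually_elim
      case (elim w)
      have "(\<forall>i\<in>F. mass (B i) w \<le> ennreal (x i)) \<longleftrightarrow>
        (\<forall>n. \<forall>i\<in>F. snd w n \<in> B i \<longrightarrow> weight n w \<le> ennreal (x i))"
        unfolding mass_def by (auto simp: SUP_le_iff indicator_def)
      also have "\<dots> \<longleftrightarrow> (\<forall>n. \<forall>i\<in>F. snd w n \<in> B i \<longrightarrow> \<psi> (snd w n) * ennreal (x i powr - \<alpha>) \<le> ennreal (arrival (fst w) n))"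
        using elim x by (simp add: weight_le_iff cong: ball_cong)
      also have "\<dots> \<longleftrightarrow> (\<forall>n. \<psi> (snd w n) * g (snd w n) \<le> ennreal (arrival (fst w) n))"
        unfolding g_def SUP_mult_left_ennreal by (auto simp: SUP_le_iff)
      finally show ?case by simp
    qed
    show "{w \<in> space \<Omega>. \<forall>i\<in>F. mass (B i) w \<le> ennreal (x i)} \<in> sets \<Omega>"
      using B by (intro sets.sets_Collect_finite_All F borel_measurable_le) auto
  qed measurable
  also have "\<dots> = exp_neg (\<integral>\<^sup>+y. \<psi> y * g y \<partial>m)"
    by (rule void_probability[OF prob_m]) measurable
  also have "(\<integral>\<^sup>+y. \<psi> y * g y \<partial>m) = (\<integral>\<^sup>+y. g y \<partial>\<mu>)"
    by (subst psi_density, subst nn_integral_density) auto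
  finally show ?thesis by (simp add: g_def)
qed

end

locale lepage_transfer = frechet_random_sup_measure \<alpha> \<mu> P M + lepage_representation \<alpha> \<mu> m \<psi>
  for \<alpha> :: real and \<mu> m :: "'e measure" and \<psi> :: "'e \<Rightarrow> ennreal" and P :: "'w measure" and M
begin

text \<open>Both joint distribution functions are the same exponential of an integral over
  \<mu>.\<close>

lemma same_law:
  assumes B: "\<And>i. B i \<in> sets \<mu>"
  shows "distr P (PiM UNIV (\<lambda>_. borel)) (\<lambda>w i. M (B i) w) =
    distr \<Omega> (PiM UNIV (\<lambda>_::nat. borel)) (\<lambda>x i. mass (B i) x)"
proof (rule measure_eqI_PiM_ennreal)
  have m1 [measurable]: "(\<lambda>w i. M (B i) w) \<in> P \<rightarrow>\<^sub>M PiM UNIV (\<lambda>_. borel)"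
    using random_variable[OF B] by (intro measurable_PiM_single') auto
  have m2 [measurable]: "(\<lambda>w i. mass (B i) w) \<in> \<Omega> \<rightarrow>\<^sub>M PiM UNIV (\<lambda>_. borel)"
    using B by (intro measurable_PiM_single') auto
  show "prob_space (distr P (PiM UNIV (\<lambda>_. borel)) (\<lambda>w i. M (B i) w))"
    by (rule prob_space_distr) (rule m1)
  fix F :: "nat set" and x :: "nat \<Rightarrow> real" assume F: "finite F" and x: "\<And>i. i \<in> F \<Longrightarrow> 0 < x i"
  have "{y \<in> space (PiM UNIV (\<lambda>_. borel)). \<forall>i\<in>F. y i \<le> ennreal (x i)} \<in> sets (PiM UNIV (\<lambda>_. borel))"
    using F by measurable
  then have S: "{y. \<forall>i\<in>F. y i \<le> ennreal (x i)} \<in> sets (PiM UNIV (\<lambda>_. borel))"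
    by (simp add: space_PiM)
  have v: "f -` {y. \<forall>i\<in>F. y i \<le> ennreal (x i)} \<inter> space N = {w \<in> space N. \<forall>i\<in>F. f w i \<le> ennreal (x i)}" for f N
    by auto
  show "emeasure (distr P (PiM UNIV (\<lambda>_. borel)) (\<lambda>w i. M (B i) w)) {y. \<forall>i\<in>F. y i \<le> ennreal (x i)} =
    emeasure (distr \<Omega> (PiM UNIV (\<lambda>_. borel)) (\<lambda>w i. mass (B i) w)) {y. \<forall>i\<in>F. y i \<le> ennreal (x i)}"
    unfolding emeasure_distr[OF m1 S] emeasure_distr[OF m2 S] v
    by (simp only: joint_cdf[OF F B x alpha_pos] mass_cdf[OF F B x])
qed auto

end

section \<open>Transfer of functionals\<close>

context lepage_transfer
begin

text \<open>\<open>X\<close> on \<open>P\<close> and \<open>Z\<close> on \<open>\<Omega>\<close> correspond when they are the same measurable functional of countably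
  many values of \<open>M\<close> and of \<open>mass\<close>; by \<open>same_law\<close>, corresponding sequences have the same law.\<close>

definition corr :: "('w \<Rightarrow> ennreal) \<Rightarrow> ((nat \<Rightarrow> real) \<times> (nat \<Rightarrow> 'e) \<Rightarrow> ennreal) \<Rightarrow> bool" where
  "corr X Z \<longleftrightarrow> X \<in> borel_measurable P \<and> Z \<in> borel_measurable \<Omega> \<and>
    (\<exists>B \<Phi>. (\<forall>i. B i \<in> sets \<mu>) \<and> \<Phi> \<in> borel_measurable (PiM UNIV (\<lambda>_::nat. borel)) \<and>
      (AE w in P. X w = \<Phi> (\<lambda>i. M (B i) w)) \<and> (AE x in \<Omega>. Z x = \<Phi> (\<lambda>i. mass (B i) x)))"

lemma corr_measurable:
  assumes "corr X Z" shows "X \<in> borel_measurable P" "Z \<in> borel_measurable \<Omega>"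
  using assms by (auto simp: corr_def)

lemma corr_AE_cong:
  assumes "corr X Z" "AE w in P. X' w = X w" "AE x in \<Omega>. Z' x = Z x"
    and "X' \<in> borel_measurable P" "Z' \<in> borel_measurable \<Omega>"
  shows "corr X' Z'"
proof -
  obtain B \<Phi> where *: "\<forall>i. B i \<in> sets \<mu>" "\<Phi> \<in> borel_measurable (PiM UNIV (\<lambda>_::nat. borel))"
    "AE w in P. X w = \<Phi> (\<lambda>i. M (B i) w)" "AE x in \<Omega>. Z x = \<Phi> (\<lambda>i. mass (B i) x)"
    using assms(1) by (auto simp: corr_def)
  have "AE w in P. X' w = \<Phi> (\<lambda>i. M (B i) w)" using *(3) assms(2) by eventually_elim simp
  moreover have "AE x in \<Omega>. Z' x = \<Phi> (\<lambda>i. mass (B i) x)" using *(4) assms(3) by eventually_elim simp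
  ultimately show ?thesis using *(1,2) assms(4,5) by (auto simp: corr_def)
qed

lemma corr_basic:
  assumes "A \<in> sets \<mu>" shows "corr (M A) (mass A)"
  unfolding corr_def using assms random_variable[OF assms]
  by (intro conjI measurable_mass exI[of _ "\<lambda>_. A"] exI[of _ "\<lambda>y. y 0"]) auto

text \<open>Each pair comes with its own sequence of sets. Encoding pairs of numbers merges them
  into one sequence and one functional, so that countably many correspondences hold jointly and not
  only one by one.\<close>

lemma corr_joint:
  assumes "\<And>n. corr (X n) (Z n)"
  shows "\<exists>C \<Psi>. (\<forall>i. C i \<in> sets \<mu>) \<and> \<Psi> \<in> PiM UNIV (\<lambda>_::nat. borel) \<rightarrow>\<^sub>M PiM UNIV (\<lambda>_::nat. borel) \<and>
    (AE w in P. (\<lambda>n. X n w) = \<Psi> (\<lambda>i. M (C i) w)) \<and> (AE x in \<Omega>. (\<lambda>n. Z n x) = \<Psi> (\<lambda>i. mass (C i) x))"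
proof -
  have "\<forall>n. \<exists>p. (\<forall>i. fst p i \<in> sets \<mu>) \<and> snd p \<in> borel_measurable (PiM UNIV (\<lambda>_::nat. borel)) \<and>
      (AE w in P. X n w = snd p (\<lambda>i. M (fst p i) w)) \<and> (AE x in \<Omega>. Z n x = snd p (\<lambda>i. mass (fst p i) x))"
    using assms unfolding corr_def by simp
  then obtain p where p: "\<forall>n. (\<forall>i. fst (p n) i \<in> sets \<mu>) \<and> snd (p n) \<in> borel_measurable (PiM UNIV (\<lambda>_::nat. borel)) \<and>
      (AE w in P. X n w = snd (p n) (\<lambda>i. M (fst (p n) i) w)) \<and> (AE x in \<Omega>. Z n x = snd (p n) (\<lambda>i. mass (fst (p n) i) x))"
    by (rule choice[THEN exE])
  define B where "B n = fst (p n)" for n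
  define \<Phi> where "\<Phi> n = snd (p n)" for n
  have B: "\<And>n i. B n i \<in> sets \<mu>"
    and \<Phi> [measurable]: "\<And>n. \<Phi> n \<in> borel_measurable (PiM UNIV (\<lambda>_::nat. borel))"
    and X: "\<And>n. AE w in P. X n w = \<Phi> n (\<lambda>i. M (B n i) w)"
    and Z: "\<And>n. AE x in \<Omega>. Z n x = \<Phi> n (\<lambda>i. mass (B n i) x)"
    using p by (simp_all add: B_def \<Phi>_def)
  define C where "C i = B (fst (prod_decode i)) (snd (prod_decode i))" for i
  define \<Psi> where "\<Psi> y n = \<Phi> n (\<lambda>i. y (prod_encode (n, i)))" for y n
  show ?thesis
  proof (intro exI conjI allI)
    show "C i \<in> sets \<mu>" for i using B by (simp add: C_def)
    show "\<Psi> \<in> PiM UNIV (\<lambda>_::nat. borel) \<rightarrow>\<^sub>M PiM UNIV (\<lambda>_::nat. borel)"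
    proof (rule measurable_PiM_single')
      fix n :: nat
      have [measurable]: "(\<lambda>y i. y (prod_encode (n, i))) \<in> PiM UNIV (\<lambda>_::nat. borel) \<rightarrow>\<^sub>M PiM UNIV (\<lambda>_::nat. borel :: ennreal measure)"
        by (rule measurable_PiM_single') auto
      show "(\<lambda>y. \<Psi> y n) \<in> borel_measurable (PiM UNIV (\<lambda>_::nat. borel))"
        unfolding \<Psi>_def by measurable
    qed auto
    have "AE w in P. \<forall>n. X n w = \<Phi> n (\<lambda>i. M (B n i) w)" using X by (simp add: AE_all_countable)
    then show "AE w in P. (\<lambda>n. X n w) = \<Psi> (\<lambda>i. M (C i) w)"
      by eventually_elim (simp add: \<Psi>_def C_def fun_eq_iff)
    have "AE w in \<Omega>. \<forall>n. Z n w = \<Phi> n (\<lambda>i. mass (B n i) w)" using Z by (simp add: AE_all_countable)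
    then show "AE w in \<Omega>. (\<lambda>n. Z n w) = \<Psi> (\<lambda>i. mass (C i) w)"
      by eventually_elim (simp add: \<Psi>_def C_def fun_eq_iff)
  qed
qed

lemma corr_compose:
  assumes "\<And>n. corr (X n) (Z n)" and [measurable]: "\<Theta> \<in> borel_measurable (PiM UNIV (\<lambda>_::nat. borel))"
  shows "corr (\<lambda>w. \<Theta> (\<lambda>n. X n w)) (\<lambda>x. \<Theta> (\<lambda>n. Z n x))"
proof -
  obtain C \<Psi> where C: "\<And>i. C i \<in> sets \<mu>" and [measurable]: "\<Psi> \<in> PiM UNIV (\<lambda>_::nat. borel) \<rightarrow>\<^sub>M PiM UNIV (\<lambda>_::nat. borel)"
    and *: "AE w in P. (\<lambda>n. X n w) = \<Psi> (\<lambda>i. M (C i) w)" "AE x in \<Omega>. (\<lambda>n. Z n x) = \<Psi> (\<lambda>i. mass (C i) x)"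
    using corr_joint[of X Z] assms(1) by blast
  have [measurable]: "(\<lambda>w n. X n w) \<in> P \<rightarrow>\<^sub>M PiM UNIV (\<lambda>_. borel)" "(\<lambda>w n. Z n w) \<in> \<Omega> \<rightarrow>\<^sub>M PiM UNIV (\<lambda>_. borel)"
    using assms(1) by (auto intro!: measurable_PiM_single' dest: corr_measurable)
  have "AE w in P. \<Theta> (\<lambda>n. X n w) = (\<Theta> \<circ> \<Psi>) (\<lambda>i. M (C i) w)" using *(1) by eventually_elim simp
  moreover have "AE w in \<Omega>. \<Theta> (\<lambda>n. Z n w) = (\<Theta> \<circ> \<Psi>) (\<lambda>i. mass (C i) w)" using *(2) by eventually_elim simp
  moreover have "\<Theta> \<circ> \<Psi> \<in> borel_measurable (PiM UNIV (\<lambda>_::nat. borel))" by measurable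
  moreover have "(\<lambda>w. \<Theta> (\<lambda>n. X n w)) \<in> borel_measurable P" "(\<lambda>w. \<Theta> (\<lambda>n. Z n w)) \<in> borel_measurable \<Omega>"
    by measurable
  ultimately show ?thesis unfolding corr_def using C by blast
qed

text \<open>Both sequences are images, under one functional \<Psi>, of sequences whose laws agree by
  \<open>same_law\<close>.\<close>

lemma corr_law:
  assumes "\<And>n. corr (X n) (Z n)"
  shows "distr P (PiM UNIV (\<lambda>_. borel)) (\<lambda>w n. X n w) = distr \<Omega> (PiM UNIV (\<lambda>_::nat. borel)) (\<lambda>x n. Z n x)"
proof -
  obtain C \<Psi> where C: "\<And>i. C i \<in> sets \<mu>" and [measurable]: "\<Psi> \<in> PiM UNIV (\<lambda>_::nat. borel) \<rightarrow>\<^sub>M PiM UNIV (\<lambda>_::nat. borel)"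
    and *: "AE w in P. (\<lambda>n. X n w) = \<Psi> (\<lambda>i. M (C i) w)" "AE x in \<Omega>. (\<lambda>n. Z n x) = \<Psi> (\<lambda>i. mass (C i) x)"
    using corr_joint[of X Z] assms(1) by blast
  have [measurable]: "(\<lambda>w n. X n w) \<in> P \<rightarrow>\<^sub>M PiM UNIV (\<lambda>_. borel)" "(\<lambda>w n. Z n w) \<in> \<Omega> \<rightarrow>\<^sub>M PiM UNIV (\<lambda>_. borel)"
    using assms(1) by (auto intro!: measurable_PiM_single' dest: corr_measurable)
  have [measurable]: "(\<lambda>w n. M (C n) w) \<in> P \<rightarrow>\<^sub>M PiM UNIV (\<lambda>_. borel)" "(\<lambda>w n. mass (C n) w) \<in> \<Omega> \<rightarrow>\<^sub>M PiM UNIV (\<lambda>_. borel)"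
    using C random_variable[OF C] by (auto intro!: measurable_PiM_single')
  have "distr P (PiM UNIV (\<lambda>_. borel)) (\<lambda>w n. X n w) = distr P (PiM UNIV (\<lambda>_. borel)) (\<lambda>w. \<Psi> (\<lambda>i. M (C i) w))"
    by (intro distr_cong_AE refl *) measurable
  also have "\<dots> = distr (distr P (PiM UNIV (\<lambda>_. borel)) (\<lambda>w i. M (C i) w)) (PiM UNIV (\<lambda>_. borel)) \<Psi>"
    by (subst distr_distr) (auto simp: comp_def)
  also have "\<dots> = distr (distr \<Omega> (PiM UNIV (\<lambda>_. borel)) (\<lambda>w i. mass (C i) w)) (PiM UNIV (\<lambda>_. borel)) \<Psi>"
    by (simp only: same_law[OF C])
  also have "\<dots> = distr \<Omega> (PiM UNIV (\<lambda>_. borel)) (\<lambda>w. \<Psi> (\<lambda>i. mass (C i) w))"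
    by (subst distr_distr) (auto simp: comp_def)
  also have "\<dots> = distr \<Omega> (PiM UNIV (\<lambda>_. borel)) (\<lambda>w n. Z n w)"
    by (intro distr_cong_AE refl, use *(2) in eventually_elim) (simp, measurable)
  finally show ?thesis .
qed

text \<open>Whether a measurable property holds almost surely depends on the joint law alone; this
  carries pathwise facts about the series over to \<open>M\<close>.\<close>

lemma corr_AE:
  assumes "\<And>n. corr (X n) (Z n)" and [measurable]: "Measurable.pred (PiM UNIV (\<lambda>_::nat. borel)) R"
    and "AE x in \<Omega>. R (\<lambda>n. Z n x)"
  shows "AE w in P. R (\<lambda>n. X n w)"
proof -
  have [measurable]: "(\<lambda>w n. X n w) \<in> P \<rightarrow>\<^sub>M PiM UNIV (\<lambda>_. borel)" "(\<lambda>w n. Z n w) \<in> \<Omega> \<rightarrow>\<^sub>M PiM UNIV (\<lambda>_. borel)"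
    using assms(1) by (auto intro!: measurable_PiM_single' dest: corr_measurable)
  have "AE y in distr \<Omega> (PiM UNIV (\<lambda>_::nat. borel)) (\<lambda>x n. Z n x). R y"
    using assms(3) by (subst AE_distr_iff) auto
  then have "AE y in distr P (PiM UNIV (\<lambda>_::nat. borel)) (\<lambda>x n. X n x). R y"
    by (simp only: corr_law[OF assms(1)])
  then show ?thesis by (subst (asm) AE_distr_iff) auto
qed

lemma corr_nn_integral:
  assumes "corr X Z" shows "(\<integral>\<^sup>+w. X w \<partial>P) = (\<integral>\<^sup>+x. Z x \<partial>\<Omega>)"
proof -
  note [measurable] = corr_measurable[OF assms]
  have "(\<integral>\<^sup>+w. X w \<partial>P) = (\<integral>\<^sup>+y. y 0 \<partial>distr P (PiM UNIV (\<lambda>_::nat. borel)) (\<lambda>w n. X w))"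
    by (subst nn_integral_distr) (auto intro!: measurable_PiM_single')
  also have "\<dots> = (\<integral>\<^sup>+y. y 0 \<partial>distr \<Omega> (PiM UNIV (\<lambda>_::nat. borel)) (\<lambda>w n. Z w))"
    using corr_law[of "\<lambda>_. X" "\<lambda>_. Z"] assms by simp
  also have "\<dots> = (\<integral>\<^sup>+x. Z x \<partial>\<Omega>)"
    by (subst nn_integral_distr) (auto intro!: measurable_PiM_single')
  finally show ?thesis .
qed

lemma corr_compose2:
  assumes "corr X1 Z1" "corr X2 Z2" and [measurable]: "case_prod f \<in> borel_measurable (borel \<Otimes>\<^sub>M borel)"
  shows "corr (\<lambda>w. f (X1 w) (X2 w)) (\<lambda>x. f (Z1 x) (Z2 x))"
proof -
  \<comment> \<open>The pair is padded to a sequence, the form in which correspondences are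
    composed.\<close>
  have *: "corr (\<lambda>w. if n = 0 then X1 w else X2 w) (\<lambda>w. if n = 0 then Z1 w else Z2 w)" for n :: nat
    using assms(1,2) by (cases "n = 0") auto
  have "corr (\<lambda>w. case_prod f (if (0::nat) = 0 then X1 w else X2 w, if (1::nat) = 0 then X1 w else X2 w))
    (\<lambda>w. case_prod f (if (0::nat) = 0 then Z1 w else Z2 w, if (1::nat) = 0 then Z1 w else Z2 w))"
    by (rule corr_compose[where \<Theta> = "\<lambda>y. case_prod f (y 0, y 1)" and X = "\<lambda>n w. if n = 0 then X1 w else X2 w"
          and Z = "\<lambda>n w. if n = 0 then Z1 w else Z2 w"])
       (use * in auto)
  then show ?thesis by simp
qed

lemma corr_AE2:
  assumes "corr X1 Z1" "corr X2 Z2" and [measurable]: "Measurable.pred (borel \<Otimes>\<^sub>M borel) (case_prod R)"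
    and "AE x in \<Omega>. R (Z1 x) (Z2 x)"
  shows "AE w in P. R (X1 w) (X2 w)"
proof -
  have *: "corr (\<lambda>w. if n = 0 then X1 w else X2 w) (\<lambda>w. if n = 0 then Z1 w else Z2 w)" for n :: nat
    using assms(1,2) by (cases "n = 0") auto
  have "AE w in P. case_prod R (if (0::nat) = 0 then X1 w else X2 w, if (1::nat) = 0 then X1 w else X2 w)"
    by (rule corr_AE[where R = "\<lambda>y. case_prod R (y 0, y 1)" and X = "\<lambda>n w. if n = 0 then X1 w else X2 w"
          and Z = "\<lambda>n w. if n = 0 then Z1 w else Z2 w"])
       (use * assms(4) in auto)
  then show ?thesis by simp
qed

lemma corr_SUP:
  assumes "countable I" "\<And>i. i \<in> I \<Longrightarrow> corr (X i) (Z i)"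
  shows "corr (\<lambda>w. SUP i\<in>I. X i w) (\<lambda>x. SUP i\<in>I. Z i x)"
proof (cases "I = {}")
  case True
  have "corr (\<lambda>w. 0) (\<lambda>x. 0)"
    unfolding corr_def by (intro conjI exI[of _ "\<lambda>_. {}"] exI[of _ "\<lambda>_. 0"]) auto
  then show ?thesis using True by (simp add: bot_ennreal)
next
  case False
  have c: "corr (\<lambda>w. SUP n. X (from_nat_into I n) w) (\<lambda>w. SUP n. Z (from_nat_into I n) w)"
    by (rule corr_compose[where \<Theta> = "\<lambda>y. SUP n. y n"]) (use assms from_nat_into[OF False] in auto)
  have r: "(SUP n. h (from_nat_into I n)) = (SUP i\<in>I. h i)" for h :: "_ \<Rightarrow> ennreal"
    using range_from_nat_into[OF False assms(1)] image_image[of h "from_nat_into I" UNIV] by simp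
  have rX: "(SUP n. X (from_nat_into I n) w) = (SUP i\<in>I. X i w)" for w by (rule r)
  have rZ: "(SUP n. Z (from_nat_into I n) x) = (SUP i\<in>I. Z i x)" for x by (rule r)
  show ?thesis using c by (simp only: rX rZ)
qed

lemma corr_prod:
  assumes "finite I" "\<And>i. i \<in> I \<Longrightarrow> corr (X i) (Z i)"
  shows "corr (\<lambda>w. \<Prod>i\<in>I. X i w) (\<lambda>x. \<Prod>i\<in>I. Z i x)"
  using assms
proof (induction I rule: finite_induct)
  case empty
  show ?case
    unfolding corr_def by (intro conjI exI[of _ "\<lambda>_. {}"] exI[of _ "\<lambda>_. 1"]) auto
next
  case (insert i I)
  then have "corr (\<lambda>w. X i w * (\<Prod>i\<in>I. X i w)) (\<lambda>w. Z i w * (\<Prod>i\<in>I. Z i w))"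
    by (intro corr_compose2[where f = "(*)"]) auto
  then show ?case using insert by simp
qed

lemma corr_compose1:
  assumes "corr X Z" "f \<in> borel_measurable borel"
  shows "corr (\<lambda>w. f (X w)) (\<lambda>x. f (Z x))"
  using corr_compose[of "\<lambda>_. X" "\<lambda>_. Z" "\<lambda>y. f (y 0)"] assms by auto

end

section \<open>Series over tuples of distinct indices\<close>

context lepage_representation
begin

text \<open>\<open>distinct_indices\<close> shifted down by one, because points are numbered from 0
  here.\<close>

definition tuples :: "nat \<Rightarrow> (nat \<Rightarrow> nat) set" where
  "tuples k = {j \<in> {1..k} \<rightarrow>\<^sub>E UNIV. inj_on j {1..k}}"

definition marks :: "nat \<Rightarrow> (nat \<Rightarrow> nat) \<Rightarrow> (nat \<Rightarrow> real) \<times> (nat \<Rightarrow> 'e) \<Rightarrow> nat \<Rightarrow> 'e" where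
  "marks k j x = (\<lambda>r\<in>{1..k}. snd x (j r))"

definition series :: "nat \<Rightarrow> ((nat \<Rightarrow> 'e) \<Rightarrow> ennreal) \<Rightarrow> (nat \<Rightarrow> real) \<times> (nat \<Rightarrow> 'e) \<Rightarrow> ennreal" where
  "series k f x = (SUP j\<in>tuples k. f (marks k j x) * (\<Prod>r\<in>{1..k}. weight (j r) x))"

lemma countable_tuples: "countable (tuples k)"
  unfolding tuples_def by (rule countable_subset[of _ "{1..k} \<rightarrow>\<^sub>E UNIV"]) (auto intro!: countable_PiE)

lemma measurable_marks [measurable]: "marks k j \<in> \<Omega> \<rightarrow>\<^sub>M power_measure k \<mu>"
  unfolding marks_def by measurable

lemma measurable_series [measurable (raw)]:
  assumes [measurable]: "f \<in> borel_measurable (power_measure k \<mu>)"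
  shows "series k f \<in> borel_measurable \<Omega>"
  unfolding series_def using countable_tuples by measurable

lemma series_mono: "(\<And>j. j \<in> tuples k \<Longrightarrow> f (marks k j x) \<le> g (marks k j x)) \<Longrightarrow> series k f x \<le> series k g x"
  unfolding series_def by (intro SUP_subset_mono order_refl mult_right_mono) auto

lemma series_cong: "(\<And>j. j \<in> tuples k \<Longrightarrow> f (marks k j x) = g (marks k j x)) \<Longrightarrow> series k f x = series k g x"
  unfolding series_def by (intro SUP_cong) auto

text \<open>Suprema commute, and multiplication in \<open>ennreal\<close> preserves them. Families
  are arbitrary here, so finite unions of sets and increasing limits of integrands are both
  instances.\<close>

lemma series_SUP: "series k (\<lambda>u. SUP i\<in>I. f i u) x = (SUP i\<in>I. series k (f i) x)"
  unfolding series_def by (subst SUP_commute) (simp add: SUP_mult_right_ennreal)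

lemma series_max: "series k (\<lambda>u. max (f u) (g u)) x = max (series k f x) (series k g x)"
  using series_SUP[of k "\<lambda>b. if b then f else g" UNIV x] by (simp add: UNIV_bool sup_max max.commute)

lemma series_cmult: "series k (\<lambda>u. c * f u) x = c * series k f x"
  unfolding series_def by (simp add: SUP_mult_left_ennreal mult.assoc)

lemma series_add: "series k (\<lambda>u. f u + g u) x \<le> series k f x + series k g x"
  unfolding series_def
  by (rule SUP_least) (auto simp: distrib_right intro!: add_mono SUP_upper)

text \<open>Multiplication in \<open>ennreal\<close> preserves suprema in each factor; since the
  factors choose their indices independently, the supremum runs over all index functions,
  repetitions included.\<close>

lemma prod_SUP_ennreal:
  fixes a :: "'i \<Rightarrow> nat \<Rightarrow> ennreal"
  assumes "finite I"
  shows "(\<Prod>i\<in>I. SUP n. a i n) = (SUP j\<in>I \<rightarrow>\<^sub>E UNIV. \<Prod>i\<in>I. a i (j i))"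
  using assms
proof (induction I rule: finite_induct)
  case (insert i I)
  have "(\<Prod>i\<in>insert i I. SUP n. a i n) = (SUP n. a i n) * (SUP j\<in>I \<rightarrow>\<^sub>E UNIV. \<Prod>i\<in>I. a i (j i))"
    using insert by simp
  also have "\<dots> = (SUP n. SUP j\<in>I \<rightarrow>\<^sub>E UNIV. a i n * (\<Prod>i\<in>I. a i (j i)))"
    unfolding SUP_mult_right_ennreal by (simp only: SUP_mult_left_ennreal)
  also have "\<dots> = (SUP j\<in>insert i I \<rightarrow>\<^sub>E UNIV. \<Prod>l\<in>insert i I. a l (j l))"
  proof (intro antisym SUP_least)
    fix n j assume j: "j \<in> I \<rightarrow>\<^sub>E (UNIV :: nat set)"
    have "(\<Prod>l\<in>I. a l ((j(i := n)) l)) = (\<Prod>l\<in>I. a l (j l))"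
      using insert by (intro prod.cong) auto
    then have "a i n * (\<Prod>i\<in>I. a i (j i)) = (\<Prod>l\<in>insert i I. a l ((j(i := n)) l))"
      using insert by simp
    also have "\<dots> \<le> (SUP j\<in>insert i I \<rightarrow>\<^sub>E UNIV. \<Prod>l\<in>insert i I. a l (j l))"
      using j by (intro SUP_upper) (auto simp: PiE_iff extensional_def)
    finally show "a i n * (\<Prod>i\<in>I. a i (j i)) \<le> (SUP j\<in>insert i I \<rightarrow>\<^sub>E UNIV. \<Prod>l\<in>insert i I. a l (j l))" .
  next
    fix f assume "f \<in> insert i I \<rightarrow>\<^sub>E (UNIV :: nat set)"
    have "(\<Prod>l\<in>insert i I. a l (f l)) = a i (f i) * (\<Prod>l\<in>I. a l (restrict f I l))"
      using insert by simp
    also have "\<dots> \<le> (SUP j\<in>I \<rightarrow>\<^sub>E UNIV. a i (f i) * (\<Prod>i\<in>I. a i (j i)))"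
      by (rule SUP_upper) auto
    also have "\<dots> \<le> (SUP n. SUP j\<in>I \<rightarrow>\<^sub>E UNIV. a i n * (\<Prod>i\<in>I. a i (j i)))"
      by (rule SUP_upper) auto
    finally show "(\<Prod>l\<in>insert i I. a l (f l)) \<le> (SUP n. SUP j\<in>I \<rightarrow>\<^sub>E UNIV. a i n * (\<Prod>i\<in>I. a i (j i)))" .
  qed
  finally show ?case .
qed simp

text \<open>Expanding the product gives all tuples of indices. A tuple using the same index twice
  would put one mark into two disjoint sides, so its term vanishes and only tuples of distinct
  indices remain.\<close>

lemma series_rectangle:
  assumes R: "disjoint_family_on R {1..k}"
  shows "series k (indicator (PiE {1..k} R)) x = (\<Prod>r\<in>{1..k}. mass (R r) x)"
proof -
  define a where "a r n = indicator (R r) (snd x n) * weight n x" for r n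
  have prod_a: "(\<Prod>r\<in>{1..k}. a r (j r)) = indicator (PiE {1..k} R) (marks k j x) * (\<Prod>r\<in>{1..k}. weight (j r) x)" for j
  proof -
    have "(\<Prod>r\<in>{1..k}. indicator (R r) (snd x (j r)) :: ennreal) = indicator (PiE {1..k} R) (marks k j x)"
    proof (cases "\<forall>r\<in>{1..k}. snd x (j r) \<in> R r")
      case True then show ?thesis by (auto simp: marks_def indicator_def)
    next
      case False
      then obtain r where r: "r \<in> {1..k}" "snd x (j r) \<notin> R r" by blast
      then have "(\<Prod>r\<in>{1..k}. indicator (R r) (snd x (j r)) :: ennreal) = 0"
        by (intro prod_zero) (auto intro!: bexI[of _ r])
      moreover have "marks k j x \<notin> PiE {1..k} R" using r by (auto simp: marks_def PiE_iff)
      ultimately show ?thesis by simp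
    qed
    then show ?thesis by (simp add: a_def prod.distrib)
  qed
  have "(\<Prod>r\<in>{1..k}. mass (R r) x) = (\<Prod>r\<in>{1..k}. SUP n. a r n)"
    by (simp add: mass_def a_def)
  also have "\<dots> = (SUP j\<in>{1..k} \<rightarrow>\<^sub>E UNIV. \<Prod>r\<in>{1..k}. a r (j r))"
    by (rule prod_SUP_ennreal) simp
  also have "\<dots> = series k (indicator (PiE {1..k} R)) x"
    unfolding series_def
  proof (intro antisym SUP_least)
    fix j :: "nat \<Rightarrow> nat" assume j: "j \<in> {1..k} \<rightarrow>\<^sub>E UNIV"
    show "(\<Prod>r\<in>{1..k}. a r (j r)) \<le> (SUP j\<in>tuples k. indicator (PiE {1..k} R) (marks k j x) * (\<Prod>r\<in>{1..k}. weight (j r) x))"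
    proof (cases "inj_on j {1..k}")
      case True
      then show ?thesis using j by (subst prod_a, intro SUP_upper) (auto simp: tuples_def)
    next
      case False
      then obtain r s where rs: "r \<in> {1..k}" "s \<in> {1..k}" "r \<noteq> s" "j r = j s" by (auto simp: inj_on_def)
      then have "marks k j x r = marks k j x s" by (simp add: marks_def)
      moreover have "R r \<inter> R s = {}" using R rs by (auto simp: disjoint_family_on_def)
      ultimately have "marks k j x \<notin> PiE {1..k} R" using PiE_mem[of "marks k j x"] rs by (metis disjoint_iff)
      then show ?thesis by (subst prod_a) simp
    qed
  next
    fix j assume "j \<in> tuples k"
    then show "indicator (PiE {1..k} R) (marks k j x) * (\<Prod>r\<in>{1..k}. weight (j r) x) \<le> (SUP j\<in>{1..k} \<rightarrow>\<^sub>E UNIV. \<Prod>r\<in>{1..k}. a r (j r))"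
      by (subst prod_a[symmetric], intro SUP_upper) (auto simp: tuples_def)
  qed
  finally show ?thesis by simp
qed

definition cube :: "nat \<Rightarrow> 'e set \<Rightarrow> (nat \<Rightarrow> 'e) set" where
  "cube k S = {u. \<forall>r\<in>{1..k}. u r \<in> S}"

text \<open>Cutting every side with \<open>S\<close> amounts to cutting the union with a cube. The
  right-hand side depends on the union alone, so for \<open>mass\<close> the value attached to a
  family of rectangles does not depend on how the union is represented.\<close>

lemma rectangles_value_mass:
  assumes "off_diagonal_rectangles k \<nu> n R"
  shows "rectangles_value (\<lambda>B. mass (B \<inter> S)) k n R x = series k (indicator (rectangles_union k n R \<inter> cube k S)) x"
proof -
  have "(\<lambda>u. indicator (rectangles_union k n R \<inter> cube k S) u :: ennreal) =
    (\<lambda>u. SUP i\<in>{1..n}. indicator (PiE {1..k} (\<lambda>r. R i r \<inter> S)) u)"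
  proof
    fix u
    have *: "PiE {1..k} (\<lambda>r. R i r \<inter> S) = PiE {1..k} (R i) \<inter> cube k S" for i
      by (auto simp: cube_def PiE_iff)
    show "(indicator (rectangles_union k n R \<inter> cube k S) u :: ennreal) = (SUP i\<in>{1..n}. indicator (PiE {1..k} (\<lambda>r. R i r \<inter> S)) u)"
      unfolding * rectangles_union_def by (intro antisym SUP_least) (auto simp: indicator_def intro: SUP_upper2)
  qed
  then have "series k (indicator (rectangles_union k n R \<inter> cube k S)) x =
    (SUP i\<in>{1..n}. series k (indicator (PiE {1..k} (\<lambda>r. R i r \<inter> S))) x)"
    by (simp add: series_SUP)
  also have "\<dots> = (SUP i\<in>{1..n}. \<Prod>r\<in>{1..k}. mass (R i r \<inter> S) x)"
  proof (intro SUP_cong refl series_rectangle)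
    fix i assume "i \<in> {1..n}"
    then have "disjoint_family_on (R i) {1..k}" using assms by (auto simp: off_diagonal_rectangles_def)
    then show "disjoint_family_on (\<lambda>r. R i r \<inter> S) {1..k}" unfolding disjoint_family_on_def by blast
  qed
  finally show ?thesis by (simp add: rectangles_value_def)
qed

end

section \<open>Off-diagonal rectangles\<close>

text \<open>The sets describable by \<open>off_diagonal_rectangles\<close>, without a numbering of
  the rectangles, so that closure properties can be stated for sets.\<close>

definition rectangle_unions :: "nat \<Rightarrow> 'e measure \<Rightarrow> (nat \<Rightarrow> 'e) set set" where
  "rectangle_unions k \<mu> = {U. \<exists>F. finite F \<and>
     (\<forall>A\<in>F. (\<forall>r\<in>{1..k}. A r \<in> sets \<mu>) \<and> disjoint_family_on A {1..k}) \<and> U = (\<Union>A\<in>F. PiE {1..k} A)}"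

lemma rectangle_unions_cases:
  assumes "U \<in> rectangle_unions k \<mu>"
  obtains F where "finite F" "\<forall>A\<in>F. \<forall>r\<in>{1..k}. A r \<in> sets \<mu>"
    "\<forall>A\<in>F. disjoint_family_on A {1..k}" "U = (\<Union>A\<in>F. PiE {1..k} A)"
proof -
  have "\<exists>F. finite F \<and> (\<forall>A\<in>F. (\<forall>r\<in>{1..k}. A r \<in> sets \<mu>) \<and> disjoint_family_on A {1..k}) \<and> U = (\<Union>A\<in>F. PiE {1..k} A)"
    using assms unfolding rectangle_unions_def by (rule CollectD)
  then show thesis by (elim exE conjE) (rule that; simp)
qed

lemma rectangle_unionsE:
  assumes "U \<in> rectangle_unions k \<mu>"
  obtains n R where "off_diagonal_rectangles k \<mu> n R" "rectangles_union k n R = U"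
proof -
  obtain F where F0: "finite F" "\<forall>A\<in>F. \<forall>r\<in>{1..k}. A r \<in> sets \<mu>" "\<forall>A\<in>F. disjoint_family_on A {1..k}" and U: "U = (\<Union>A\<in>F. PiE {1..k} A)"
    by (rule rectangle_unions_cases[OF assms])
  note F = F0(1) F0(2)[rule_format] F0(3)[rule_format]
  obtain g where g: "bij_betw g {1..card F} F" using ex_bij_betw_nat_finite_1[OF F(1)] by blast
  then have gF: "g ` {1..card F} = F" by (simp add: bij_betw_def)
  then have gF': "g i \<in> F" if "i \<in> {1..card F}" for i using that by blast
  show thesis
  proof
    show "off_diagonal_rectangles k \<mu> (card F) g"
      using F(2)[OF gF'] F(3)[OF gF'] by (simp add: off_diagonal_rectangles_def)
    show "rectangles_union k (card F) g = U"
      unfolding rectangles_union_def U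
      using image_image[of "PiE {1..k}" g "{1..card F}"] by (simp only: gF)
  qed
qed

lemma rectangles_union_in:
  assumes "off_diagonal_rectangles k \<mu> n R" shows "rectangles_union k n R \<in> rectangle_unions k \<mu>"
  unfolding rectangle_unions_def
proof (intro CollectI exI[of _ "R ` {1..n}"] conjI ballI)
  fix A assume A: "A \<in> R ` {1..n}"
  then show "A r \<in> sets \<mu>" if "r \<in> {1..k}" for r
    using assms that by (auto simp: off_diagonal_rectangles_def)
  show "disjoint_family_on A {1..k}"
    using assms A by (auto simp: off_diagonal_rectangles_def)
qed (simp_all add: rectangles_union_def)

lemma disjoint_family_on_shrink:
  assumes "disjoint_family_on B I" "\<And>i. i \<in> I \<Longrightarrow> A i \<subseteq> B i" shows "disjoint_family_on A I"
  unfolding disjoint_family_on_def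
proof (intro ballI impI)
  fix i j assume "i \<in> I" "j \<in> I" "i \<noteq> j"
  then show "A i \<inter> A j = {}" using assms(2)[of i] assms(2)[of j] disjoint_family_onD[OF assms(1), of i j] by blast
qed

lemma rectangle_unions_empty: "{} \<in> rectangle_unions k \<mu>"
  by (auto simp: rectangle_unions_def intro!: exI[of _ "{}"])

lemma rectangle_unions_Un:
  assumes "U \<in> rectangle_unions k \<mu>" "V \<in> rectangle_unions k \<mu>" shows "U \<union> V \<in> rectangle_unions k \<mu>"
proof -
  obtain F where F0: "finite F" "\<forall>A\<in>F. \<forall>r\<in>{1..k}. A r \<in> sets \<mu>" "\<forall>A\<in>F. disjoint_family_on A {1..k}" "U = (\<Union>A\<in>F. PiE {1..k} A)"
    by (rule rectangle_unions_cases[OF assms(1)])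
  note F = F0(1) F0(2)[rule_format] F0(3)[rule_format] F0(4)
  obtain H where H0: "finite H" "\<forall>A\<in>H. \<forall>r\<in>{1..k}. A r \<in> sets \<mu>" "\<forall>A\<in>H. disjoint_family_on A {1..k}" "V = (\<Union>A\<in>H. PiE {1..k} A)"
    by (rule rectangle_unions_cases[OF assms(2)])
  note H = H0(1) H0(2)[rule_format] H0(3)[rule_format] H0(4)
  show ?thesis unfolding rectangle_unions_def
  proof (intro CollectI exI[of _ "F \<union> H"] conjI ballI)
    fix A assume A: "A \<in> F \<union> H"
    then show "A r \<in> sets \<mu>" if "r \<in> {1..k}" for r
      using F0(2) H0(2) that by blast
    show "disjoint_family_on A {1..k}" using A F0(3) H0(3) by blast
  qed (use F(1,4) H(1,4) in auto)
qed

lemma rectangle_unions_UN: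
  assumes "finite I" "\<And>i. i \<in> I \<Longrightarrow> U i \<in> rectangle_unions k \<mu>"
  shows "(\<Union>i\<in>I. U i) \<in> rectangle_unions k \<mu>"
  using assms by (induction I rule: finite_induct) (auto intro: rectangle_unions_empty rectangle_unions_Un)

lemma rectangle_unions_rectangle:
  assumes "\<And>r. r \<in> {1..k} \<Longrightarrow> A r \<in> sets \<mu>" "disjoint_family_on A {1..k}"
  shows "PiE {1..k} A \<in> rectangle_unions k \<mu>"
  unfolding rectangle_unions_def by (intro CollectI exI[of _ "{A}"]) (simp add: assms del: One_nat_def)

text \<open>The second set may be any rectangle: shrinking the sides of an off-diagonal rectangle
  keeps them disjoint.\<close>

lemma rectangle_unions_Int:
  assumes "U \<in> rectangle_unions k \<mu>" and B: "\<And>r. r \<in> {1..k} \<Longrightarrow> B r \<in> sets \<mu>"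
  shows "U \<inter> PiE {1..k} B \<in> rectangle_unions k \<mu>"
proof -
  obtain F where F0: "finite F" "\<forall>A\<in>F. \<forall>r\<in>{1..k}. A r \<in> sets \<mu>" "\<forall>A\<in>F. disjoint_family_on A {1..k}" and U: "U = (\<Union>A\<in>F. PiE {1..k} A)"
    by (rule rectangle_unions_cases[OF assms(1)])
  note F = F0(1) F0(2)[rule_format] F0(3)[rule_format]
  have "U \<inter> PiE {1..k} B = (\<Union>A\<in>F. PiE {1..k} (\<lambda>r. A r \<inter> B r))"
    unfolding U by (auto simp: PiE_iff)
  also have "\<dots> \<in> rectangle_unions k \<mu>"
  proof (intro rectangle_unions_UN rectangle_unions_rectangle F(1))
    fix A assume A: "A \<in> F"
    show "disjoint_family_on (\<lambda>r. A r \<inter> B r) {1..k}"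
      by (rule disjoint_family_on_shrink[OF F(3)[OF A]]) auto
    show "A r \<inter> B r \<in> sets \<mu>" if "r \<in> {1..k}" for r
      by (rule sets.Int[OF F(2)[OF A that] B[OF that]])
  qed
  finally show ?thesis .
qed

text \<open>A point outside a rectangle violates it in some coordinate r, so removing the rectangle
  leaves a union over r of rectangles with the r-th side cut. These may overlap, which is harmless
  for unions, and shrinking keeps the sides disjoint.\<close>

lemma rectangle_unions_diff:
  assumes "U \<in> rectangle_unions k \<mu>" "V \<in> rectangle_unions k \<mu>"
  shows "U - V \<in> rectangle_unions k \<mu>"
proof -
  have rect: "U - PiE {1..k} B \<in> rectangle_unions k \<mu>"
    if U': "U \<in> rectangle_unions k \<mu>" and B: "\<And>r. r \<in> {1..k} \<Longrightarrow> B r \<in> sets \<mu>" for U B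
  proof -
    obtain F where F0: "finite F" "\<forall>A\<in>F. \<forall>r\<in>{1..k}. A r \<in> sets \<mu>" "\<forall>A\<in>F. disjoint_family_on A {1..k}" and U: "U = (\<Union>A\<in>F. PiE {1..k} A)"
      by (rule rectangle_unions_cases[OF U'])
  note F = F0(1) F0(2)[rule_format] F0(3)[rule_format]
    have "U - PiE {1..k} B = (\<Union>A\<in>F. \<Union>r\<in>{1..k}. PiE {1..k} (A(r := A r - B r)))"
    proof (intro set_eqI iffI)
      fix x assume "x \<in> U - PiE {1..k} B"
      then obtain A r where "A \<in> F" "x \<in> PiE {1..k} A" "r \<in> {1..k}" "x r \<notin> B r"
        by (auto simp: U PiE_iff)
      then show "x \<in> (\<Union>A\<in>F. \<Union>r\<in>{1..k}. PiE {1..k} (A(r := A r - B r)))"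
        by (intro UN_I[of A] UN_I[of r]) (auto simp: PiE_iff)
    next
      fix x assume "x \<in> (\<Union>A\<in>F. \<Union>r\<in>{1..k}. PiE {1..k} (A(r := A r - B r)))"
      then obtain A r where x: "A \<in> F" "r \<in> {1..k}" "x \<in> PiE {1..k} (A(r := A r - B r))" by blast
      then have "x r \<in> A r - B r" using PiE_mem[OF x(3) x(2)] by simp
      moreover have "x \<in> PiE {1..k} A"
        using x(3) by (auto simp: PiE_iff split: if_splits)
      ultimately show "x \<in> U - PiE {1..k} B" using x by (auto simp: U PiE_iff)
    qed
    also have "\<dots> \<in> rectangle_unions k \<mu>"
    proof (intro rectangle_unions_UN rectangle_unions_rectangle)
      fix A r s assume *: "A \<in> F" "r \<in> {1..k}" "s \<in> {1..k}"
      then have "A r \<in> sets \<mu>" "A s \<in> sets \<mu>" "B r \<in> sets \<mu>" by (simp_all add: F(2)[OF *(1)] B)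
      then show "(A(r := A r - B r)) s \<in> sets \<mu>" by auto
    next
      fix A r assume A: "A \<in> F"
      show "disjoint_family_on (A(r := A r - B r)) {1..k}"
        by (rule disjoint_family_on_shrink[OF F(3)[OF A]]) auto
    qed (use F(1) in auto)
    finally show ?thesis .
  qed
  obtain G where G0: "finite G" "\<forall>A\<in>G. \<forall>r\<in>{1..k}. A r \<in> sets \<mu>" "\<forall>A\<in>G. disjoint_family_on A {1..k}"
    and V: "V = (\<Union>A\<in>G. PiE {1..k} A)"
    by (rule rectangle_unions_cases[OF assms(2)])
  note G = G0(1) G0(2)[rule_format]
  have "U - (\<Union>A\<in>G. PiE {1..k} A) \<in> rectangle_unions k \<mu>"
    using G
  proof (induction G rule: finite_induct)
    case (insert A G)
    have "(U - (\<Union>A\<in>G. PiE {1..k} A)) - PiE {1..k} A \<in> rectangle_unions k \<mu>"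
      by (intro rect insert.IH insert.prems) auto
    also have "(U - (\<Union>A\<in>G. PiE {1..k} A)) - PiE {1..k} A = U - (\<Union>A\<in>insert A G. PiE {1..k} A)" by auto
    finally show ?case .
  qed (use assms in simp)
  then show ?thesis by (simp add: V)
qed

lemma rectangle_unions_sets:
  assumes "U \<in> rectangle_unions k \<mu>" shows "U \<in> sets (power_measure k \<mu>)"
proof -
  obtain F where F0: "finite F" "\<forall>A\<in>F. \<forall>r\<in>{1..k}. A r \<in> sets \<mu>" "\<forall>A\<in>F. disjoint_family_on A {1..k}" "U = (\<Union>A\<in>F. PiE {1..k} A)"
    by (rule rectangle_unions_cases[OF assms(1)])
  note F = F0(1) F0(2)[rule_format] F0(3)[rule_format] F0(4)
  show ?thesis unfolding F(4) using F(1)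
    by (rule sets.finite_UN) (intro sets_PiM_I_finite F(2), auto)
qed

definition off_diagonal :: "nat \<Rightarrow> 'e measure \<Rightarrow> (nat \<Rightarrow> 'e) set" where
  "off_diagonal k \<mu> = space (power_measure k \<mu>) - diagonals k \<mu>"

lemma off_diagonal_alt: "off_diagonal k \<mu> = {x \<in> space (power_measure k \<mu>). inj_on x {1..k}}"
  by (auto simp: off_diagonal_def diagonals_def inj_on_def)

lemma rectangle_unions_off_diagonal:
  assumes "U \<in> rectangle_unions k \<mu>" shows "U \<subseteq> off_diagonal k \<mu>"
proof
  fix x assume x: "x \<in> U"
  obtain F where F0: "finite F" "\<forall>A\<in>F. \<forall>r\<in>{1..k}. A r \<in> sets \<mu>" "\<forall>A\<in>F. disjoint_family_on A {1..k}" and U: "U = (\<Union>A\<in>F. PiE {1..k} A)"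
    by (rule rectangle_unions_cases[OF assms])
  note F = F0(1) F0(2)[rule_format] F0(3)[rule_format]
  obtain A where "A \<in> F" and A: "x \<in> PiE {1..k} A" using x U by blast
  have "inj_on x {1..k}"
  proof (rule inj_onI, rule ccontr)
    fix r s assume rs: "r \<in> {1..k}" "s \<in> {1..k}" "x r = x s" "r \<noteq> s"
    then have "A r \<inter> A s = {}" by (intro disjoint_family_onD[OF F(3)[OF \<open>A \<in> F\<close>]])
    then show False using PiE_mem[OF A rs(1)] PiE_mem[OF A rs(2)] rs(3) by auto
  qed
  moreover have "x \<in> space (power_measure k \<mu>)"
    using sets.sets_into_space[OF rectangle_unions_sets[OF assms]] x by auto
  ultimately show "x \<in> off_diagonal k \<mu>" by (simp add: off_diagonal_alt)
qed

section \<open>Dyadic cells and approximation by off-diagonal rectangles\<close>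

locale coded_space =
  fixes \<mu> :: "'e measure" and \<phi> :: "'e \<Rightarrow> real"
  assumes code_measurable: "\<phi> \<in> borel_measurable \<mu>"
    and code_inj: "inj_on \<phi> (space \<mu>)"
    and code_range: "\<And>y. y \<in> space \<mu> \<Longrightarrow> \<phi> y \<in> {0..1}"
begin

definition cell :: "nat \<Rightarrow> nat \<Rightarrow> 'e set" where
  "cell n i = {y \<in> space \<mu>. nat \<lfloor>\<phi> y * 2 ^ n\<rfloor> = i}"

text \<open>The union of the rectangles whose sides are pairwise different cells of level n. The
  index 2^n belongs to the range because the code may take the value 1.\<close>

definition dyadic_union :: "nat \<Rightarrow> nat \<Rightarrow> (nat \<Rightarrow> 'e) set" where
  "dyadic_union k n = (\<Union>t\<in>{t \<in> {1..k} \<rightarrow>\<^sub>E {0..2 ^ n}. inj_on t {1..k}}. PiE {1..k} (\<lambda>r. cell n (t r)))"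

lemma cell_sets: "cell n i \<in> sets \<mu>"
proof -
  note [measurable] = code_measurable
  show ?thesis unfolding cell_def by measurable
qed

lemma cell_disjoint: "i \<noteq> j \<Longrightarrow> cell n i \<inter> cell n j = {}"
  by (auto simp: cell_def)

lemma finite_dyadic_index: "finite {t \<in> {1..k :: nat} \<rightarrow>\<^sub>E {0..2 ^ n :: nat}. inj_on t {1..k}}"
  by (rule finite_subset[of _ "{1..k} \<rightarrow>\<^sub>E {0..2 ^ n}"]) (auto intro!: finite_PiE)

lemma dyadic_union_in: "dyadic_union k n \<in> rectangle_unions k \<mu>"
  unfolding dyadic_union_def
proof (intro rectangle_unions_UN finite_dyadic_index rectangle_unions_rectangle cell_sets)
  fix t :: "nat \<Rightarrow> nat" assume "t \<in> {t \<in> {1..k} \<rightarrow>\<^sub>E {0..2 ^ n}. inj_on t {1..k}}"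
  then have "inj_on t {1..k}" by simp
  then show "disjoint_family_on (\<lambda>r. cell n (t r)) {1..k}"
    unfolding disjoint_family_on_def by (intro ballI impI cell_disjoint) (auto dest: inj_onD)
qed

lemma dyadic_union_alt:
  "dyadic_union k n = {x \<in> space (power_measure k \<mu>). inj_on (\<lambda>r. nat \<lfloor>\<phi> (x r) * 2 ^ n\<rfloor>) {1..k}}"
proof (intro set_eqI iffI)
  fix x assume "x \<in> dyadic_union k n"
  then obtain t where t: "t \<in> {1..k} \<rightarrow>\<^sub>E {0..2 ^ n}" "inj_on t {1..k}" "x \<in> PiE {1..k} (\<lambda>r. cell n (t r))"
    by (auto simp: dyadic_union_def)
  have "nat \<lfloor>\<phi> (x r) * 2 ^ n\<rfloor> = t r" if "r \<in> {1..k}" for r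
    using PiE_mem[OF t(3) that] by (simp add: cell_def)
  then have "inj_on (\<lambda>r. nat \<lfloor>\<phi> (x r) * 2 ^ n\<rfloor>) {1..k}"
    using t(2) inj_on_cong[of "{1..k}" "\<lambda>r. nat \<lfloor>\<phi> (x r) * 2 ^ n\<rfloor>" t] by simp
  moreover have "x \<in> space (power_measure k \<mu>)"
    using t(3) by (auto simp: space_PiM PiE_iff cell_def)
  ultimately show "x \<in> {x \<in> space (power_measure k \<mu>). inj_on (\<lambda>r. nat \<lfloor>\<phi> (x r) * 2 ^ n\<rfloor>) {1..k}}" by simp
next
  fix x assume "x \<in> {x \<in> space (power_measure k \<mu>). inj_on (\<lambda>r. nat \<lfloor>\<phi> (x r) * 2 ^ n\<rfloor>) {1..k}}"
  then have x: "x \<in> {1..k} \<rightarrow>\<^sub>E space \<mu>" "inj_on (\<lambda>r. nat \<lfloor>\<phi> (x r) * 2 ^ n\<rfloor>) {1..k}"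
    by (auto simp: space_PiM)
  define t where "t = (\<lambda>r\<in>{1..k}. nat \<lfloor>\<phi> (x r) * 2 ^ n\<rfloor>)"
  have le: "nat \<lfloor>\<phi> (x r) * 2 ^ n\<rfloor> \<le> 2 ^ n" if "r \<in> {1..k}" for r
  proof -
    have "\<phi> (x r) * 2 ^ n \<le> 1 * 2 ^ n"
      using code_range[of "x r"] PiE_mem[OF x(1) that] by (intro mult_right_mono) auto
    then have "\<phi> (x r) * 2 ^ n \<le> real_of_int (2 ^ n)" by simp
    then have "\<lfloor>\<phi> (x r) * 2 ^ n\<rfloor> \<le> 2 ^ n" by (metis floor_mono floor_of_int)
    then show ?thesis by (simp add: nat_le_iff)
  qed
  have "t \<in> {1..k} \<rightarrow>\<^sub>E {0..2 ^ n}" using le by (auto simp: t_def)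
  moreover have "inj_on t {1..k}"
    using x(2) inj_on_cong[of "{1..k}" "\<lambda>r. nat \<lfloor>\<phi> (x r) * 2 ^ n\<rfloor>" t] by (simp add: t_def)
  moreover have "x \<in> PiE {1..k} (\<lambda>r. cell n (t r))"
    using x(1) by (auto simp: PiE_iff cell_def t_def)
  ultimately show "x \<in> dyadic_union k n" unfolding dyadic_union_def by blast
qed

text \<open>The cell number at level n is half of the one at level n + 1, rounded down, so
  coordinates sharing a cell at the finer level share one at the coarser level.\<close>

lemma dyadic_union_incseq: "incseq (dyadic_union k)"
proof (rule incseq_SucI, rule subsetI)
  fix n x assume x: "x \<in> dyadic_union k n"
  have "nat \<lfloor>a * 2 ^ n\<rfloor> = nat \<lfloor>b * 2 ^ n\<rfloor>" if "nat \<lfloor>a * 2 ^ Suc n\<rfloor> = nat \<lfloor>b * 2 ^ Suc n\<rfloor>" "0 \<le> a" "0 \<le> b" for a b :: real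
  proof -
    have *: "\<lfloor>c * 2 ^ n\<rfloor> = \<lfloor>c * 2 ^ Suc n\<rfloor> div 2" for c :: real
      using floor_divide_real_eq_div[of 2 "c * 2 ^ Suc n"] by simp
    have "0 \<le> \<lfloor>a * 2 ^ Suc n\<rfloor>" "0 \<le> \<lfloor>b * 2 ^ Suc n\<rfloor>" using that by simp_all
    then have "\<lfloor>a * 2 ^ Suc n\<rfloor> = \<lfloor>b * 2 ^ Suc n\<rfloor>" using that(1) by linarith
    then show ?thesis by (simp only: *)
  qed
  moreover have "0 \<le> \<phi> (x r)" if "r \<in> {1..k}" for r
    using x that code_range[of "x r"] by (auto simp: dyadic_union_alt space_PiM PiE_iff)
  ultimately show "x \<in> dyadic_union k (Suc n)"
    using x unfolding dyadic_union_alt inj_on_def by blast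
qed

text \<open>Distinct coordinates have distinct codes, and once the mesh is smaller than their
  finitely many distances all cells differ. This is where injectivity of the code enters: it makes
  the off-diagonal set an increasing limit of finite unions of rectangles.\<close>

lemma dyadic_union_UN: "(\<Union>n. dyadic_union k n) = off_diagonal k \<mu>"
proof (intro antisym subsetI)
  fix x assume "x \<in> (\<Union>n. dyadic_union k n)"
  then show "x \<in> off_diagonal k \<mu>" using rectangle_unions_off_diagonal[OF dyadic_union_in] by blast
next
  fix x assume "x \<in> off_diagonal k \<mu>"
  then have x: "x \<in> space (power_measure k \<mu>)" "inj_on x {1..k}" by (auto simp: off_diagonal_alt)
  have sp: "x r \<in> space \<mu>" if "r \<in> {1..k}" for r using x that by (auto simp: space_PiM)
  have "\<forall>\<^sub>F n in sequentially. nat \<lfloor>\<phi> (x r) * 2 ^ n\<rfloor> \<noteq> nat \<lfloor>\<phi> (x s) * 2 ^ n\<rfloor>"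
    if rs: "r \<in> {1..k}" "s \<in> {1..k}" "r \<noteq> s" for r s
  proof -
    define d where "d = \<bar>\<phi> (x r) - \<phi> (x s)\<bar>"
    have "0 < d" using inj_onD[OF x(2), of r s] inj_onD[OF code_inj, of "x r" "x s"] sp rs by (auto simp: d_def)
    then obtain N where N: "1 / d < 2 ^ N" using real_arch_pow[of 2 "1 / d"] by auto
    have "nat \<lfloor>\<phi> (x r) * 2 ^ n\<rfloor> \<noteq> nat \<lfloor>\<phi> (x s) * 2 ^ n\<rfloor>" if "N \<le> n" for n
    proof
      assume eq: "nat \<lfloor>\<phi> (x r) * 2 ^ n\<rfloor> = nat \<lfloor>\<phi> (x s) * 2 ^ n\<rfloor>"
      have "0 \<le> \<phi> (x r) * 2 ^ n" "0 \<le> \<phi> (x s) * 2 ^ n" using code_range sp rs by auto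
      then have "\<bar>\<phi> (x r) * 2 ^ n - \<phi> (x s) * 2 ^ n\<bar> < 1" using eq by linarith
      then have "d * 2 ^ n < 1" by (simp add: d_def abs_mult flip: left_diff_distrib)
      moreover have "d * 2 ^ N \<le> d * 2 ^ n" using that \<open>0 < d\<close> by (intro mult_left_mono power_increasing) auto
      moreover have "1 < d * 2 ^ N" using N \<open>0 < d\<close> by (simp add: field_simps)
      ultimately show False by (metis less_trans less_le_trans less_irrefl)
    qed
    then show ?thesis by (auto simp: eventually_sequentially)
  qed
  then have "\<forall>\<^sub>F n in sequentially. \<forall>r\<in>{1..k}. \<forall>s\<in>{1..k}. r \<noteq> s \<longrightarrow> nat \<lfloor>\<phi> (x r) * 2 ^ n\<rfloor> \<noteq> nat \<lfloor>\<phi> (x s) * 2 ^ n\<rfloor>"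
    by (auto intro!: eventually_ball_finite)
  then obtain n where "\<forall>r\<in>{1..k}. \<forall>s\<in>{1..k}. r \<noteq> s \<longrightarrow> nat \<lfloor>\<phi> (x r) * 2 ^ n\<rfloor> \<noteq> nat \<lfloor>\<phi> (x s) * 2 ^ n\<rfloor>"
    by (auto simp: eventually_sequentially)
  then have "x \<in> dyadic_union k n" using x(1) by (auto simp: dyadic_union_alt inj_on_def)
  then show "x \<in> (\<Union>n. dyadic_union k n)" by blast
qed

lemma off_diagonal_in_sets: "off_diagonal k \<mu> \<in> sets (power_measure k \<mu>)"
  unfolding dyadic_union_UN[symmetric] by (intro sets.countable_UN image_subsetI rectangle_unions_sets dyadic_union_in)

text \<open>The approximable sets contain the rectangles and are closed under complement and
  countable disjoint union. The obstacle is that the off-diagonal set itself is in general no finite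
  union of rectangles, so complements cannot be formed inside the class; \<open>L n\<close> serves
  as a substitute whose defect has small measure.\<close>

lemma rectangle_unions_approx:
  assumes "finite_measure (power_measure k \<mu>)" "A \<in> sets (power_measure k \<mu>)" "0 < e"
  shows "\<exists>U\<in>rectangle_unions k \<mu>.
    emeasure (power_measure k \<mu>) ((U - A \<inter> off_diagonal k \<mu>) \<union> (A \<inter> off_diagonal k \<mu> - U)) < ennreal e"
proof -
  let ?N = "power_measure k \<mu>" and ?O = "off_diagonal k \<mu>"
  interpret N: finite_measure ?N by fact
  let ?D = "\<lambda>A U. (U - A) \<union> (A - U)"
  note O [measurable] = off_diagonal_in_sets[of k]
  have mU [measurable]: "U \<in> rectangle_unions k \<mu> \<Longrightarrow> U \<in> sets ?N" for U by (rule rectangle_unions_sets)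
  have subadd: "measure ?N X \<le> measure ?N Y + measure ?N Z" if "X \<subseteq> Y \<union> Z" "Y \<in> sets ?N" "Z \<in> sets ?N" for X Y Z
    using N.finite_measure_mono[OF that(1)] measure_Un_le[OF that(2,3)] that by (meson order_trans sets.Un)
  define L where "L = dyadic_union k"
  have L: "L n \<in> rectangle_unions k \<mu>" "L n \<subseteq> ?O" for n
    using dyadic_union_in rectangle_unions_off_diagonal unfolding L_def by blast+
  have L_lim: "\<exists>n. measure ?N (?O - L n) < e" if "0 < e" for e
  proof -
    have "(\<lambda>n. measure ?N (L n)) \<longlonglongrightarrow> measure ?N (\<Union>n. L n)"
      by (intro N.finite_Lim_measure_incseq image_subsetI mU L(1)) (simp add: L_def dyadic_union_incseq)
    then have "\<forall>\<^sub>F n in sequentially. measure ?N ?O - e < measure ?N (L n)"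
      unfolding L_def dyadic_union_UN using that by (intro order_tendstoD) auto
    then obtain n where "measure ?N ?O - e < measure ?N (L n)" by (auto simp: eventually_sequentially)
    then have "measure ?N (?O - L n) < e"
      using L mU[OF L(1)] O by (subst N.finite_measure_Diff) auto
    then show ?thesis ..
  qed
  \<comment> \<open>The tolerance is quantified inside the claim, so that the induction may spend
    half of it.\<close>
  have "\<forall>e>0. \<exists>U\<in>rectangle_unions k \<mu>. measure ?N (?D (A \<inter> ?O) U) < e"
  proof -
    have gen: "sets ?N = sigma_sets (\<Pi>\<^sub>E i\<in>{1..k}. space \<mu>) {PiE {1..k} X |X. X \<in> {1..k} \<rightarrow> sets \<mu>}"
      by (simp add: sets_PiM prod_algebra_eq_finite)
    have A: "A \<in> sigma_sets (\<Pi>\<^sub>E i\<in>{1..k}. space \<mu>) {PiE {1..k} X |X. X \<in> {1..k} \<rightarrow> sets \<mu>}"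
      using assms(2) by (simp only: gen)
    have Is: "Int_stable {PiE {1..k} X |X. X \<in> {1..k} \<rightarrow> sets \<mu>}"
    proof (rule Int_stableI, clarify)
      fix X Y :: "nat \<Rightarrow> 'e set" assume "X \<in> {1..k} \<rightarrow> sets \<mu>" "Y \<in> {1..k} \<rightarrow> sets \<mu>"
      moreover have "PiE {1..k} X \<inter> PiE {1..k} Y = PiE {1..k} (\<lambda>r. X r \<inter> Y r)" by (auto simp: PiE_iff)
      ultimately show "\<exists>Z. PiE {1..k} X \<inter> PiE {1..k} Y = PiE {1..k} Z \<and> Z \<in> {1..k} \<rightarrow> sets \<mu>"
        by (intro exI[of _ "\<lambda>r. X r \<inter> Y r"]) auto
    qed
    have cl: "{PiE {1..k} X |X. X \<in> {1..k} \<rightarrow> sets \<mu>} \<subseteq> Pow (\<Pi>\<^sub>E i\<in>{1..k}. space \<mu>)"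
    proof
      fix Y :: "(nat \<Rightarrow> 'e) set" assume "Y \<in> {PiE {1..k} X |X. X \<in> {1..k} \<rightarrow> sets \<mu>}"
      then obtain X where X: "Y = PiE {1..k} X" "X \<in> {1..k} \<rightarrow> sets \<mu>" by blast
      have "PiE {1..k} X \<subseteq> (\<Pi>\<^sub>E i\<in>{1..k}. space \<mu>)"
        using X(2) by (intro PiE_mono sets.sets_into_space) (rule Pi_mem)
      then show "Y \<in> Pow (\<Pi>\<^sub>E i\<in>{1..k}. space \<mu>)" by (simp add: X(1))
    qed
    show ?thesis
      using Is cl A
    proof (induction A rule: sigma_sets_induct_disjoint)
      case (basic A)
      then obtain X where X0: "A = PiE {1..k} X" "X \<in> {1..k} \<rightarrow> sets \<mu>" by blast
      note X = X0(1) Pi_mem[OF X0(2)]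
      show ?case
      proof (intro allI impI)
        fix e :: real assume "0 < e"
        then obtain n where n: "measure ?N (?O - L n) < e" using L_lim by blast
        have "measure ?N (?D (A \<inter> ?O) (L n \<inter> A)) \<le> measure ?N (?O - L n)"
          using L mU[OF L(1)] O by (intro N.finite_measure_mono) auto
        with n show "\<exists>U\<in>rectangle_unions k \<mu>. measure ?N (?D (A \<inter> ?O) U) < e"
          using rectangle_unions_Int[OF L(1)[of n] X(2)] unfolding X(1)
          by (intro bexI[of _ "L n \<inter> PiE {1..k} X"]) auto
      qed
    next
      case empty
      then show ?case by (auto intro!: bexI[of _ "{}"] rectangle_unions_empty)
    next
      case (compl A)
      then have mA: "A \<in> sets ?N" by (simp only: gen)
      show ?case
      proof (intro allI impI)
        fix e :: real assume e: "0 < e"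
        obtain U where U: "U \<in> rectangle_unions k \<mu>" "measure ?N (?D (A \<inter> ?O) U) < e / 2"
          using compl.IH e half_gt_zero by blast
        obtain n where n: "measure ?N (?O - L n) < e / 2" using L_lim e half_gt_zero by blast
        have "?O \<subseteq> (\<Pi>\<^sub>E i\<in>{1..k}. space \<mu>)"
          using sets.sets_into_space[OF O] by (simp add: space_PiM)
        then have "measure ?N (?D (((\<Pi>\<^sub>E i\<in>{1..k}. space \<mu>) - A) \<inter> ?O) (L n - U)) \<le>
          measure ?N (?D (A \<inter> ?O) U) + measure ?N (?O - L n)"
          using L(2)[of n] mA mU[OF U(1)] mU[OF L(1)[of n]] O by (intro subadd) auto
        then have "measure ?N (?D (((\<Pi>\<^sub>E i\<in>{1..k}. space \<mu>) - A) \<inter> ?O) (L n - U)) < e"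
          using U(2) n by linarith
        then show "\<exists>V\<in>rectangle_unions k \<mu>. measure ?N (?D (((\<Pi>\<^sub>E i\<in>{1..k}. space \<mu>) - A) \<inter> ?O) V) < e"
          using rectangle_unions_diff[OF L(1) U(1)] by blast
      qed
    next
      case (union A)
      then have mA: "A i \<in> sets ?N" for i by (auto simp only: gen)
      show ?case
      proof (intro allI impI)
        fix e :: real assume e: "0 < e"
        have "(\<lambda>n. measure ?N (\<Union>i<n. A i)) \<longlonglongrightarrow> measure ?N (\<Union>n. \<Union>i<n. A i)"
          using mA by (intro N.finite_Lim_measure_incseq) (auto simp: incseq_def, meson lessThan_iff less_le_trans)
        moreover have "(\<Union>n. \<Union>i<n. A i) = (\<Union>i. A i)" by auto
        ultimately have "\<forall>\<^sub>F n in sequentially. measure ?N (\<Union>i. A i) - e / 2 < measure ?N (\<Union>i<n. A i)"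
          using e by (intro order_tendstoD) auto
        then obtain n where "measure ?N (\<Union>i. A i) - e / 2 < measure ?N (\<Union>i<n. A i)" by (auto simp: eventually_sequentially)
        then have n: "measure ?N ((\<Union>i. A i) - (\<Union>i<n. A i)) < e / 2"
          using mA by (subst N.finite_measure_Diff) auto
        \<comment> \<open>\<open>Suc n\<close> avoids division by 0, and n such terms still sum to
          at most e / 2.\<close>
        define e' where "e' = e / 2 / Suc n"
        have "0 < e'" using e by (simp add: e'_def)
        then have "\<forall>i. \<exists>U. U \<in> rectangle_unions k \<mu> \<and> measure ?N (?D (A i \<inter> ?O) U) < e'" using union.IH by blast
        then obtain U where U: "\<And>i. U i \<in> rectangle_unions k \<mu>" "\<And>i. measure ?N (?D (A i \<inter> ?O) (U i)) < e'" by metis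
        have "measure ?N (?D ((\<Union>i. A i) \<inter> ?O) (\<Union>i<n. U i)) \<le>
          measure ?N ((\<Union>i. A i) - (\<Union>i<n. A i)) + measure ?N (\<Union>i<n. ?D (A i \<inter> ?O) (U i))"
          using mA mU[OF U(1)] O by (intro subadd) auto
        also have "measure ?N (\<Union>i<n. ?D (A i \<inter> ?O) (U i)) \<le> (\<Sum>i<n. measure ?N (?D (A i \<inter> ?O) (U i)))"
          using mA mU[OF U(1)] O by (intro N.finite_measure_subadditive_finite) auto
        also have "\<dots> \<le> (\<Sum>i<n. e')" using U(2) by (intro sum_mono less_imp_le)
        also have "\<dots> \<le> e / 2" using e by (simp add: e'_def field_simps)
        finally have "measure ?N (?D ((\<Union>i. A i) \<inter> ?O) (\<Union>i<n. U i)) < e" using n by simp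
        then show "\<exists>V\<in>rectangle_unions k \<mu>. measure ?N (?D ((\<Union>i. A i) \<inter> ?O) V) < e"
          using rectangle_unions_UN[of "{..<n}" U] U(1) by (intro bexI[of _ "\<Union>i<n. U i"]) auto
      qed
    qed
  qed
  then obtain U where U: "U \<in> rectangle_unions k \<mu>" "measure ?N (?D (A \<inter> ?O) U) < e" using assms(3) by blast
  have "emeasure ?N ((U - A \<inter> ?O) \<union> (A \<inter> ?O - U)) < ennreal e"
    using U(2) by (simp only: N.emeasure_eq_measure ennreal_less_iff[OF measure_nonneg] Un_commute)
  with U(1) show ?thesis by blast
qed

end

section \<open>Almost sure behaviour of the series\<close>

lemma ennreal_tendsto_0I:
  fixes f :: "nat \<Rightarrow> ennreal"
  assumes "\<And>e. 0 < e \<Longrightarrow> \<forall>\<^sub>F n in sequentially. f n \<le> ennreal e"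
  shows "f \<longlonglongrightarrow> 0"
proof (rule order_tendstoI)
  fix a :: ennreal assume "0 < a"
  then obtain b where "0 < b" "b < a" using dense by blast
  then obtain e where "b = ennreal e" "0 < e" by (cases b) (auto simp: top_unique dest: less_trans)
  then show "\<forall>\<^sub>F n in sequentially. f n < a"
    using assms[of e] \<open>b < a\<close> by (auto elim: eventually_mono intro: le_less_trans)
qed simp

text \<open>The Laplace transform at 1: each unit exponential gap contributes a factor 1/2, split
  off by regeneration.\<close>

lemma nn_integral_exp_arrival:
  assumes "prob_space m"
  shows "(\<integral>\<^sup>+x. ennreal (exp (- arrival (fst x) n)) \<partial>lepage_space m) = ennreal ((1 / 2) ^ Suc n)"
proof -
  interpret m: prob_space m by fact
  interpret S: prob_space "lepage_space m" by (rule prob_space_lepage_space) fact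
  have half: "(\<integral>\<^sup>+s. ennreal (exp (- s)) \<partial>unit_exponential) = ennreal (1 / 2)"
  proof -
    have "(\<integral>\<^sup>+s. ennreal (exp (- s)) \<partial>unit_exponential) = (\<integral>\<^sup>+s. ennreal (exp (- 2 * s)) * indicator {0..} s \<partial>lborel)"
      by (subst nn_integral_unit_exponential) (auto intro!: nn_integral_cong simp: simp flip: ennreal_mult exp_add)
    also have "\<dots> = ennreal (0 - (- exp (- 2 * 0) / 2))"
    proof (rule nn_integral_FTC_atLeast)
      show "((\<lambda>s::real. - exp (- 2 * s) / 2) \<longlongrightarrow> 0) at_top" by real_asymp
    qed (auto intro!: derivative_eq_intros)
    finally show ?thesis by simp
  qed
  show ?thesis
  proof (induction n)
    case 0
    show ?case
      by (subst nn_integral_lepage_space_iter[OF assms])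
         (auto simp: arrival_case_nat S.emeasure_space_1 m.emeasure_space_1 half)
  next
    case (Suc n)
    have "(\<integral>\<^sup>+x. ennreal (exp (- arrival (fst x) (Suc n))) \<partial>lepage_space m) =
      (\<integral>\<^sup>+s. \<integral>\<^sup>+y. \<integral>\<^sup>+x. ennreal (exp (- s)) * ennreal (exp (- arrival (fst x) n)) \<partial>lepage_space m \<partial>m \<partial>unit_exponential)"
      by (subst nn_integral_lepage_space_iter[OF assms])
         (auto simp: arrival_case_nat exp_add[symmetric] algebra_simps simp flip: ennreal_mult)
    also have "\<dots> = (\<integral>\<^sup>+s. ennreal (exp (- s)) * ennreal ((1 / 2) ^ Suc n) \<partial>unit_exponential)"
      by (simp add: nn_integral_cmult Suc m.emeasure_space_1)
    also have "\<dots> = (\<integral>\<^sup>+s. ennreal (exp (- s)) \<partial>unit_exponential) * ennreal ((1 / 2) ^ Suc n)"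
      by (rule nn_integral_multc) measurable
    also have "\<dots> = ennreal (1 / 2 * (1 / 2) ^ Suc n)"
      unfolding half by (rule ennreal_mult[symmetric]) simp_all
    also have "1 / 2 * (1 / 2) ^ Suc n = (1 / 2 :: real) ^ Suc (Suc n)" by simp
    finally show ?case .
  qed
qed

text \<open>A Borel-Cantelli lemma: the sum has finite integral, so it is almost surely finite and
  its terms tend to 0. With indicators it says that almost every point lies in only finitely many of
  the sets.\<close>

lemma AE_suminf_finite_tendsto_0:
  fixes f :: "nat \<Rightarrow> 'a \<Rightarrow> ennreal"
  assumes [measurable]: "\<And>n. f n \<in> borel_measurable N" and "(\<Sum>n. \<integral>\<^sup>+x. f n x \<partial>N) < \<infinity>"
  shows "AE x in N. (\<lambda>n. f n x) \<longlonglongrightarrow> 0"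
proof -
  have "(\<integral>\<^sup>+x. (\<Sum>n. f n x) \<partial>N) \<noteq> \<infinity>"
    using assms(2) by (subst nn_integral_suminf) auto
  then have "AE x in N. (\<Sum>n. f n x) \<noteq> \<infinity>"
    by (intro nn_integral_PInf_AE) auto
  then show ?thesis
  proof eventually_elim
    case (elim x)
    show ?case
    proof (rule ennreal_tendsto_0I)
      fix e :: real assume e: "0 < e"
      have fin: "f n x \<noteq> \<infinity>" for n
        using elim ennreal_suminf_lessD[of "\<lambda>n. f n x" \<infinity> n] by (auto simp: less_top)
      then have eq: "ennreal (enn2real (f n x)) = f n x" for n by (simp add: less_top)
      have "summable (\<lambda>n. enn2real (f n x))"
        using elim by (intro summable_suminf_not_top) (auto simp: eq)
      then have "(\<lambda>n. enn2real (f n x)) \<longlonglongrightarrow> 0" by (rule summable_LIMSEQ_zero)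
      then have "\<forall>\<^sub>F n in sequentially. enn2real (f n x) < e" using e by (intro order_tendstoD)
      then show "\<forall>\<^sub>F n in sequentially. f n x \<le> ennreal e"
        by eventually_elim (metis eq ennreal_leI less_imp_le)
    qed
  qed
qed

text \<open>A linear lower bound is enough, so an exponential Markov bound replaces the law of large
  numbers. Any base strictly between 1 and 2 could stand for 3/2: here the mean of (3/2)^(n+1)
  exp(-arrival) is (3/4)^(n+1), which is summable.\<close>

lemma AE_arrival_growth:
  assumes "prob_space m"
  shows "AE x in lepage_space m. \<forall>\<^sub>F n in sequentially. ln (3 / 2) * real (Suc n) \<le> arrival (fst x) n"
proof -
  have "(\<lambda>n. (3 / 4 :: real) ^ Suc n) sums (1 / (1 - 3 / 4) * (3 / 4))"
    using sums_mult2[OF geometric_sums[of "3 / 4 :: real"], of "3 / 4"] by (simp add: mult.commute)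
  then have s: "summable (\<lambda>n. (3 / 4 :: real) ^ Suc n)" by (rule sums_summable)
  have "AE x in lepage_space m. (\<lambda>n. ennreal ((3 / 2) ^ Suc n) * ennreal (exp (- arrival (fst x) n))) \<longlonglongrightarrow> 0"
  proof (rule AE_suminf_finite_tendsto_0)
    have "(\<integral>\<^sup>+x. ennreal ((3 / 2) ^ Suc n) * ennreal (exp (- arrival (fst x) n)) \<partial>lepage_space m) = ennreal ((3 / 4) ^ Suc n)" for n
    proof -
      have "(\<integral>\<^sup>+x. ennreal ((3 / 2) ^ Suc n) * ennreal (exp (- arrival (fst x) n)) \<partial>lepage_space m) =
        ennreal ((3 / 2) ^ Suc n) * (\<integral>\<^sup>+x. ennreal (exp (- arrival (fst x) n)) \<partial>lepage_space m)"
        by (rule nn_integral_cmult) measurable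
      also have "\<dots> = ennreal ((3 / 2) ^ Suc n * (1 / 2) ^ Suc n)"
        unfolding nn_integral_exp_arrival[OF assms] by (rule ennreal_mult[symmetric]) simp_all
      also have "(3 / 2) ^ Suc n * (1 / 2) ^ Suc n = (3 / 4 :: real) ^ Suc n"
        unfolding power_mult_distrib[symmetric] by simp
      finally show ?thesis .
    qed
    then show "(\<Sum>n. \<integral>\<^sup>+x. ennreal ((3 / 2) ^ Suc n) * ennreal (exp (- arrival (fst x) n)) \<partial>lepage_space m) < \<infinity>"
      using s by (simp add: suminf_ennreal2 del: power_Suc)
  qed measurable
  then show ?thesis
  proof eventually_elim
    case (elim x)
    have "\<forall>\<^sub>F n in sequentially. ennreal ((3 / 2) ^ Suc n) * ennreal (exp (- arrival (fst x) n)) < 1"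
      using elim by (intro order_tendstoD) auto
    then show ?case
    proof eventually_elim
      case (elim n)
      then have "(3 / 2) ^ Suc n * exp (- arrival (fst x) n) < 1"
        by (simp del: power_Suc flip: ennreal_mult ennreal_1 add: ennreal_less_iff)
      then have "(3 / 2) ^ Suc n < exp (arrival (fst x) n)"
        by (simp add: exp_minus field_simps del: power_Suc)
      then have "ln ((3 / 2) ^ Suc n) < ln (exp (arrival (fst x) n))"
        by (subst ln_less_cancel_iff) (auto simp del: power_Suc)
      then have "ln ((3 / 2) ^ Suc n) < arrival (fst x) n" by simp
      then show ?case by (simp add: ln_realpow mult.commute del: power_Suc)
    qed
  qed
qed

lemma nn_integral_mark:
  assumes "prob_space m" and f: "f \<in> borel_measurable m"
  shows "(\<integral>\<^sup>+x. f (snd x n) \<partial>lepage_space m) = (\<integral>\<^sup>+y. f y \<partial>m)"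
proof -
  interpret m: prob_space m by fact
  interpret E: prob_space unit_exponential by (rule prob_space_unit_exponential)
  interpret S: prob_space "lepage_space m" by (rule prob_space_lepage_space) fact
  note [measurable] = f
  show ?thesis
  proof (induction n)
    case 0
    show ?case
      by (subst nn_integral_lepage_space_iter[OF assms(1)])
         (auto simp: S.emeasure_space_1 E.emeasure_space_1[simplified])
  next
    case (Suc n)
    show ?case
      by (subst nn_integral_lepage_space_iter[OF assms(1)])
         (auto simp: Suc m.emeasure_space_1 E.emeasure_space_1[simplified])
  qed
qed

text \<open>For a single value X the number of n with e (n + 1) < X is at most X / e. All marks have
  the same law, so the probabilities that the n-th mark exceeds e (n + 1) add up to at most the
  integral of X divided by e, and Borel-Cantelli applies.\<close>

lemma AE_mark_growth:
  assumes "prob_space m" and X: "X \<in> borel_measurable m" "(\<integral>\<^sup>+y. X y \<partial>m) < \<infinity>" and e: "0 < e"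
  shows "AE x in lepage_space m. \<forall>\<^sub>F n in sequentially. X (snd x n) \<le> ennreal (e * real (Suc n))"
proof -
  note [measurable] = X(1)
  define f where "f n y = (indicator {y. ennreal (e * real (Suc n)) < X y} y :: ennreal)" for n y
  have [measurable]: "f n \<in> borel_measurable m" for n unfolding f_def indicator_def mem_Collect_eq by measurable
  have bound: "(\<Sum>n. f n y) \<le> ennreal (1 / e) * X y" for y
  proof (cases "X y")
    case (real r)
    have "(\<Sum>n<N. f n y) \<le> ennreal (1 / e) * X y" for N
    proof -
      have "(\<Sum>n<N. f n y) = of_nat (card {n\<in>{..<N}. ennreal (e * real (Suc n)) < X y})"
        unfolding f_def by (simp add: indicator_def sum.If_cases Int_def)
      also have "card {n\<in>{..<N}. ennreal (e * real (Suc n)) < X y} \<le> card {..<nat \<lfloor>r / e\<rfloor>}"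
      proof (rule card_mono)
        have "n < nat \<lfloor>r / e\<rfloor>" if "ennreal (e * real (Suc n)) < X y" for n
        proof -
          have "e * real (Suc n) < r" using that e real by (simp add: ennreal_less_iff)
          then have "real (Suc n) \<le> r / e" using e by (simp add: field_simps)
          then show ?thesis by linarith
        qed
        then show "{n\<in>{..<N}. ennreal (e * real (Suc n)) < X y} \<subseteq> {..<nat \<lfloor>r / e\<rfloor>}" by auto
      qed simp
      then have "(of_nat (card {n\<in>{..<N}. ennreal (e * real (Suc n)) < X y}) :: ennreal) \<le> of_nat (nat \<lfloor>r / e\<rfloor>)"
        by simp
      also have "\<dots> = ennreal (real (nat \<lfloor>r / e\<rfloor>))" by (simp add: ennreal_of_nat_eq_real_of_nat)
      also have "\<dots> \<le> ennreal (r / e)" using real e by (intro ennreal_leI) simp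
      also have "\<dots> = ennreal (1 / e) * X y" using real e by (simp flip: ennreal_mult)
      finally show ?thesis .
    qed
    then show ?thesis by (intro suminf_le_const) auto
  qed (use e in \<open>simp add: ennreal_mult_top\<close>)
  have "AE x in lepage_space m. (\<lambda>n. f n (snd x n)) \<longlonglongrightarrow> 0"
  proof (rule AE_suminf_finite_tendsto_0)
    have "(\<Sum>n. \<integral>\<^sup>+x. f n (snd x n) \<partial>lepage_space m) = (\<Sum>n. \<integral>\<^sup>+y. f n y \<partial>m)"
      by (intro suminf_cong nn_integral_mark[OF assms(1)]) measurable
    also have "\<dots> = (\<integral>\<^sup>+y. (\<Sum>n. f n y) \<partial>m)" by (rule nn_integral_suminf[symmetric]) measurable
    also have "\<dots> \<le> (\<integral>\<^sup>+y. ennreal (1 / e) * X y \<partial>m)" by (intro nn_integral_mono bound)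
    also have "\<dots> < \<infinity>" using X(2) by (subst nn_integral_cmult) (auto simp: ennreal_mult_less_top)
    finally show "(\<Sum>n. \<integral>\<^sup>+x. f n (snd x n) \<partial>lepage_space m) < \<infinity>" .
  qed measurable
  then show ?thesis
  proof eventually_elim
    case (elim x)
    have "\<forall>\<^sub>F n in sequentially. f n (snd x n) < 1" using elim by (intro order_tendstoD) auto
    then show ?case
    proof eventually_elim
      case (elim n)
      then show ?case by (cases "ennreal (e * real (Suc n)) < X (snd x n)") (auto simp: f_def not_less)
    qed
  qed
qed

text \<open>Checked on rectangles, where the integral factorizes. It serves to compare null sets of
  powers of \<mu> and of m.\<close>

lemma PiM_density:
  assumes m: "prob_space m" and g: "g \<in> borel_measurable m" and "sigma_finite_measure (density m g)"
  shows "PiM {1..k::nat} (\<lambda>_. density m g) = density (PiM {1..k} (\<lambda>_. m)) (\<lambda>y. \<Prod>r\<in>{1..k}. g (y r))"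
proof -
  interpret m: prob_space m by fact
  interpret D: sigma_finite_measure "density m g" by fact
  interpret product_sigma_finite "\<lambda>_::nat. density m g" by standard
  interpret M: product_sigma_finite "\<lambda>_::nat. m" by standard
  note [measurable] = g
  show ?thesis
  proof (rule PiM_eqI[symmetric])
    show "sets (density (PiM {1..k} (\<lambda>_. m)) (\<lambda>y. \<Prod>r\<in>{1..k}. g (y r))) = sets (PiM {1..k} (\<lambda>_. density m g))"
      unfolding sets_density by (intro sets_PiM_cong) auto
    fix A assume "\<And>i. i \<in> {1..k} \<Longrightarrow> A i \<in> sets (density m g)"
    then have A: "\<And>i. i \<in> {1..k} \<Longrightarrow> A i \<in> sets m" by simp
    have S: "PiE {1..k} A \<in> sets (PiM {1..k} (\<lambda>_. m))" using A by (intro sets_PiM_I_finite) auto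
    have "emeasure (density (PiM {1..k} (\<lambda>_. m)) (\<lambda>y. \<Prod>r\<in>{1..k}. g (y r))) (PiE {1..k} A) =
      (\<integral>\<^sup>+y. (\<Prod>r\<in>{1..k}. g (y r)) * indicator (PiE {1..k} A) y \<partial>PiM {1..k} (\<lambda>_. m))"
      using S by (subst emeasure_density) auto
    also have "\<dots> = (\<integral>\<^sup>+y. (\<Prod>r\<in>{1..k}. g (y r) * indicator (A r) (y r)) \<partial>PiM {1..k} (\<lambda>_. m))"
    proof (intro nn_integral_cong)
      fix y assume "y \<in> space (PiM {1..k} (\<lambda>_. m))"
      then have y: "y \<in> extensional {1..k}" by (auto simp: space_PiM PiE_iff)
      have "(\<Prod>r\<in>{1..k}. indicator (A r) (y r) :: ennreal) = indicator (PiE {1..k} A) y"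
      proof (cases "y \<in> PiE {1..k} A")
        case True then show ?thesis by (auto simp: PiE_iff)
      next
        case False
        then obtain r where r: "r \<in> {1..k}" "y r \<notin> A r" using y by (auto simp: PiE_iff)
        then have "(\<Prod>r\<in>{1..k}. indicator (A r) (y r) :: ennreal) = 0"
          by (intro prod_zero) (auto intro!: bexI[of _ r])
        then show ?thesis using False by simp
      qed
      then show "(\<Prod>r\<in>{1..k}. g (y r)) * indicator (PiE {1..k} A) y = (\<Prod>r\<in>{1..k}. g (y r) * indicator (A r) (y r))"
        by (simp add: prod.distrib)
    qed
    also have "\<dots> = (\<Prod>r\<in>{1..k}. \<integral>\<^sup>+y. g y * indicator (A r) y \<partial>m)"
      using A by (intro M.product_nn_integral_prod) auto
    also have "\<dots> = (\<Prod>r\<in>{1..k}. emeasure (density m g) (A r))"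
      using A by (intro prod.cong refl) (simp add: emeasure_density)
    finally show "emeasure (density (PiM {1..k} (\<lambda>_. m)) (\<lambda>y. \<Prod>r\<in>{1..k}. g (y r))) (PiE {1..k} A) =
      (\<Prod>i\<in>{1..k}. emeasure (density m g) (A i))" .
  qed simp
qed

section \<open>Laws of tuples of marks and decay of the weights\<close>

context lepage_representation
begin

text \<open>Distinct indices select different marks, so the k marks of a tuple are independent with
  law m.\<close>

lemma distr_marks:
  assumes "j \<in> tuples k"
  shows "distr \<Omega> (power_measure k m) (marks k j) = power_measure k m"
proof -
  interpret m: prob_space m by (rule prob_m)
  interpret E: prob_space unit_exponential by (rule prob_space_unit_exponential)
  interpret A: sequence_space unit_exponential by standard
  interpret B: sequence_space m by standard
  have j: "inj_on j {1..k}" "j \<in> {1..k} \<rightarrow> UNIV" using assms by (auto simp: tuples_def)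
  have "distr \<Omega> (power_measure k m) (marks k j) =
    distr (distr \<Omega> B.S snd) (power_measure k m) (\<lambda>v. \<lambda>r\<in>{1..k}. v (j r))"
    unfolding lepage_space_def by (subst distr_distr) (auto simp: comp_def marks_def[abs_def])
  also have "distr \<Omega> B.S snd = B.S"
  proof (rule measure_eqI)
    fix X assume "X \<in> sets (distr \<Omega> B.S snd)"
    then have X: "X \<in> sets B.S" by simp
    then have "snd -` X \<inter> space \<Omega> = space A.S \<times> X"
      using sets.sets_into_space[OF X] by (auto simp: lepage_space_def space_pair_measure)
    then have "emeasure (distr \<Omega> B.S snd) X = emeasure (A.S \<Otimes>\<^sub>M B.S) (space A.S \<times> X)"
      using X by (subst emeasure_distr) (simp_all add: lepage_space_def)
    also have "\<dots> = emeasure B.S X"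
      using X by (subst B.P.emeasure_pair_measure_Times) (auto simp: A.P.emeasure_space_1)
    finally show "emeasure (distr \<Omega> B.S snd) X = emeasure B.S X" .
  qed simp
  also have "distr B.S (power_measure k m) (\<lambda>v. \<lambda>r\<in>{1..k}. v (j r)) = power_measure k m"
    using distr_PiM_reindex[of UNIV "\<lambda>_. m" j "{1..k}"] j prob_m by simp
  finally show ?thesis .
qed

lemma AE_marks:
  assumes "j \<in> tuples k" "AE y in power_measure k m. R y"
  shows "AE x in \<Omega>. R (marks k j x)"
proof -
  have "marks k j \<in> \<Omega> \<rightarrow>\<^sub>M power_measure k m"
    using measurable_marks[of k j] measurable_cong_sets[OF refl sets_PiM_cong[OF refl sets_m]] by blast
  moreover have "AE y in distr \<Omega> (power_measure k m) (marks k j). R y"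
    unfolding distr_marks[OF assms(1)] by (rule assms(2))
  ultimately show ?thesis by (rule AE_distrD)
qed

lemma AE_psi_pos: "AE y in power_measure k m. \<forall>r\<in>{1..k}. 0 < \<psi> (y r)"
proof (intro AE_finite_allI)
  fix r assume "r \<in> {1..k}"
  then show "AE y in power_measure k m. 0 < \<psi> (y r)"
    using psi_pos_finite by (intro AE_PiM_component prob_m) (auto elim: eventually_mono)
qed simp

text \<open>With \<open>S = space \<mu>\<close> this is absolute continuity of the product of \<open>m\<close> with respect to that of \<open>\<mu>\<close>.\<close>

lemma AE_power_restrict:
  assumes S: "S \<in> sets \<mu>" and sf: "sigma_finite_measure (density \<mu> (indicator S))"
    and AE: "AE y in power_measure k (density \<mu> (indicator S)). R y"
  shows "AE y in power_measure k m. y \<in> cube k S \<longrightarrow> R y"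
proof -
  note [measurable] = psi_measurable
  have [measurable]: "S \<in> sets m" using S sets_m by simp
  have d: "density \<mu> (indicator S) = density m (\<lambda>y. \<psi> y * indicator S y)"
    by (subst psi_density, subst density_density_eq) auto
  have "AE y in power_measure k m. 0 < (\<Prod>r\<in>{1..k}. \<psi> (y r) * indicator S (y r)) \<longrightarrow> R y"
    using AE unfolding d
    by (subst (asm) PiM_density[OF prob_m]) (use sf[unfolded d] in \<open>auto simp: AE_density\<close>)
  with AE_psi_pos show ?thesis
  proof eventually_elim
    case (elim y)
    then show ?case by (auto simp: cube_def less_le zero_less_iff_neq_zero)
  qed
qed

text \<open>Each tuple of marks almost surely avoids a given null set of \<mu>^k; this is how
  hypotheses that hold \<mu>^k-almost everywhere reach the series.\<close>

lemma AE_marks_mu: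
  assumes "sigma_finite_measure \<mu>" "j \<in> tuples k" "AE y in power_measure k \<mu>. R y"
  shows "AE x in \<Omega>. R (marks k j x)"
proof -
  have d: "density \<mu> (indicator (space \<mu>)) = \<mu>"
  proof -
    have "density \<mu> (indicator (space \<mu>)) = density \<mu> (\<lambda>_. 1)"
      by (intro density_cong) (auto intro!: AE_I2)
    then show ?thesis by (simp add: density_1)
  qed
  have "AE y in power_measure k m. y \<in> cube k (space \<mu>) \<longrightarrow> R y"
  proof (rule AE_power_restrict)
    show "sigma_finite_measure (density \<mu> (indicator (space \<mu>)))" unfolding d by (rule assms)
    show "AE y in power_measure k (density \<mu> (indicator (space \<mu>))). R y" unfolding d by (rule assms)
  qed simp
  from AE_marks[OF assms(2) this] AE_space show ?thesis
    by eventually_elim (auto simp: cube_def marks_def mark_in_space)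
qed

text \<open>The arrivals grow at least linearly, while \<psi> restricted to \<open>S\<close> has
  finite m-integral, namely the \<mu>-measure of \<open>S\<close>, and so is eventually below any
  given slope along the marks. Hence only finitely many points of \<open>S\<close> carry a weight
  above a given level.\<close>

lemma AE_weight_vanish:
  assumes S: "S \<in> sets \<mu>" "emeasure \<mu> S < \<infinity>"
  shows "AE x in \<Omega>. (\<forall>n. weight n x < \<infinity>) \<and> (\<lambda>n. indicator S (snd x n) * weight n x) \<longlonglongrightarrow> 0"
proof -
  note [measurable] = psi_measurable
  have [measurable]: "S \<in> sets m" using S sets_m by simp
  define c :: real where "c = ln (3 / 2)"
  have c: "0 < c" unfolding c_def by simp
  \<comment> \<open>Countably many levels tending to 0, so that the exceptional sets form one null
    set.\<close>
  define d where "d q = 1 / real (Suc q)" for q :: nat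
  have d: "0 < d q" for q by (simp add: d_def)
  have int: "(\<integral>\<^sup>+y. indicator S y * \<psi> y \<partial>m) < \<infinity>"
  proof -
    have "emeasure \<mu> S = (\<integral>\<^sup>+y. \<psi> y * indicator S y \<partial>m)"
      by (subst psi_density) (simp add: emeasure_density)
    then show ?thesis using S(2) by (simp add: mult.commute)
  qed
  \<comment> \<open>The slope is set so that dividing by the arrival bound c (n + 1) leaves d q powr
    \<alpha>, that is, a weight of at most d q.\<close>
  have "AE x in \<Omega>. \<forall>q. \<forall>\<^sub>F n in sequentially. indicator S (snd x n) * \<psi> (snd x n) \<le> ennreal (c * d q powr \<alpha> * real (Suc n))"
    unfolding AE_all_countable using c d[THEN less_imp_neq] int by (intro allI AE_mark_growth prob_m mult_pos_pos) auto
  with AE_regular AE_arrival_growth[OF prob_m, folded c_def] show ?thesis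
  proof eventually_elim
    case (elim x)
    have "weight n x < \<infinity>" for n
    proof -
      have "ennreal_powr (\<psi> (snd x n)) (1 / \<alpha>) < \<infinity>"
        using elim(1) by (auto simp: ennreal_powr_def less_top)
      then show ?thesis by (simp add: weight_def ennreal_mult_less_top)
    qed
    moreover have "(\<lambda>n. indicator S (snd x n) * weight n x) \<longlonglongrightarrow> 0"
    proof (rule ennreal_tendsto_0I)
      fix e :: real assume "0 < e"
      then obtain q where q: "d q < e" using nat_approx_posE[of e] by (auto simp: d_def)
      from elim(3)[rule_format, of q] elim(2) show "\<forall>\<^sub>F n in sequentially. indicator S (snd x n) * weight n x \<le> ennreal e"
      proof eventually_elim
        case (elim n)
        show ?case
        proof (cases "snd x n \<in> S")
          case True
          have "\<psi> (snd x n) * ennreal (d q powr - \<alpha>) \<le> ennreal (c * d q powr \<alpha> * real (Suc n)) * ennreal (d q powr - \<alpha>)"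
            using elim(1) True by (intro mult_right_mono) auto
          also have "\<dots> = ennreal (c * real (Suc n))"
            using c d[of q] by (simp add: powr_minus flip: ennreal_mult)
          also have "\<dots> \<le> ennreal (arrival (fst x) n)" using elim(2) by (intro ennreal_leI)
          finally have "weight n x \<le> ennreal (d q)"
            using \<open>\<forall>n. 0 < arrival (fst x) n \<and> 0 < \<psi> (snd x n) \<and> \<psi> (snd x n) < \<infinity>\<close> d[of q] by (subst weight_le_iff) auto
          also have "\<dots> \<le> ennreal e" using q by (intro ennreal_leI) simp
          finally show ?thesis using True by simp
        qed simp
      qed
    qed
    ultimately show ?case by blast
  qed
qed

text \<open>A tuple of marks in \<open>S\<close> with one index beyond \<open>N\<close> has a small
  product, as one factor is tiny and the others are bounded. The remaining tuples are finitely many,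
  and each eventually avoids the sets.\<close>

lemma series_vanish:
  assumes x: "\<And>n. weight n x < \<infinity>" "(\<lambda>n. indicator S (snd x n) * weight n x) \<longlonglongrightarrow> 0"
    and B: "\<And>j. j \<in> tuples k \<Longrightarrow> \<forall>\<^sub>F i in sequentially. marks k j x \<notin> B i \<inter> cube k S"
  shows "(\<lambda>i. series k (indicator (B i \<inter> cube k S)) x) \<longlonglongrightarrow> 0"
proof (rule ennreal_tendsto_0I)
  fix e :: real assume e: "0 < e"
  define z where "z n = indicator S (snd x n) * weight n x" for n
  have zfin: "z n < \<infinity>" for n using x(1)[of n] by (auto simp: z_def indicator_def)
  have ev: "\<exists>N. \<forall>n\<ge>N. z n \<le> ennreal d" if "0 < d" for d
  proof -
    have "\<forall>\<^sub>F n in sequentially. z n < ennreal d"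
      using x(2) that unfolding z_def by (intro order_tendstoD) auto
    then show ?thesis by (auto simp: eventually_sequentially intro: less_imp_le)
  qed
  obtain N1 where N1: "\<And>n. N1 \<le> n \<Longrightarrow> z n \<le> ennreal 1" using ev[of 1] by auto
  \<comment> \<open>Bounds the finitely many early weights; the inserted 1 covers the later ones and
    makes the powers of \<open>C\<close> increasing.\<close>
  define C where "C = Max (insert 1 ((\<lambda>n. enn2real (z n)) ` {..<N1}))"
  have C1: "1 \<le> C" unfolding C_def by (intro Max_ge) auto
  have zC: "z n \<le> ennreal C" for n
  proof (cases "n < N1")
    case True
    then have "enn2real (z n) \<le> C" unfolding C_def by (intro Max_ge) auto
    then have "ennreal (enn2real (z n)) \<le> ennreal C" by (rule ennreal_leI)
    then show ?thesis using zfin[of n] by simp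
  next
    case False
    then have "z n \<le> ennreal 1" using N1 by simp
    also have "\<dots> \<le> ennreal C" using C1 by (rule ennreal_leI)
    finally show ?thesis .
  qed
  \<comment> \<open>One factor of at most e / C^k and k - 1 further factors of at most C give a
    product of at most e.\<close>
  obtain N where N: "\<And>n. N \<le> n \<Longrightarrow> z n \<le> ennreal (e / C ^ k)"
    using ev[of "e / C ^ k"] e C1 by auto
  define J where "J = {j \<in> tuples k. \<forall>r\<in>{1..k}. j r < N}"
  have "J \<subseteq> {1..k} \<rightarrow>\<^sub>E {..<N}" unfolding J_def tuples_def by (intro subsetI) (simp add: PiE_iff)
  then have "finite J" by (rule finite_subset) (auto intro!: finite_PiE)
  then have "\<forall>\<^sub>F i in sequentially. \<forall>j\<in>J. marks k j x \<notin> B i \<inter> cube k S"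
    using B by (intro eventually_ball_finite) (auto simp: J_def)
  then show "\<forall>\<^sub>F i in sequentially. series k (indicator (B i \<inter> cube k S)) x \<le> ennreal e"
  proof eventually_elim
    case (elim i)
    show ?case unfolding series_def
    proof (rule SUP_least)
      fix j assume j: "j \<in> tuples k"
      show "indicator (B i \<inter> cube k S) (marks k j x) * (\<Prod>r\<in>{1..k}. weight (j r) x) \<le> ennreal e"
      proof (cases "marks k j x \<in> B i \<inter> cube k S")
        case True
        then have "j \<notin> J" using elim by blast
        then obtain r0 where r0: "r0 \<in> {1..k}" "N \<le> j r0" using j by (auto simp: J_def not_less)
        have "snd x (j r) \<in> S" if "r \<in> {1..k}" for r
          using True that by (auto simp: cube_def marks_def)
        then have "(\<Prod>r\<in>{1..k}. weight (j r) x) = (\<Prod>r\<in>{1..k}. z (j r))"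
          by (intro prod.cong) (auto simp: z_def)
        also have "\<dots> = z (j r0) * (\<Prod>r\<in>{1..k} - {r0}. z (j r))"
          using r0 by (intro prod.remove) auto
        also have "\<dots> \<le> ennreal (e / C ^ k) * (\<Prod>r\<in>{1..k} - {r0}. ennreal C)"
          by (intro mult_mono prod_mono_ennreal zC N r0) auto
        also have "(\<Prod>r\<in>{1..k} - {r0}. ennreal C) = ennreal (C ^ (k - 1))"
          using r0(1) C1 by (simp add: ennreal_power)
        also have "ennreal (e / C ^ k) * ennreal (C ^ (k - 1)) \<le> ennreal (e / C ^ k) * ennreal (C ^ k)"
          using C1 by (intro mult_left_mono ennreal_leI power_increasing) auto
        also have "\<dots> = ennreal e" using C1 e by (simp flip: ennreal_mult)
        finally show ?thesis using True by simp
      qed simp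
    qed
  qed
qed

text \<open>By summability each of the countably many tuples of marks in the cube almost surely
  avoids \<open>B i\<close> for all large i, and \<open>series_vanish\<close> then works path by
  path.\<close>

lemma AE_series_vanish:
  assumes S: "S \<in> sets \<mu>" "emeasure \<mu> S < \<infinity>"
    and B: "\<And>i. B i \<in> sets (power_measure k \<mu>)"
      "(\<Sum>i. emeasure (power_measure k (density \<mu> (indicator S))) (B i)) < \<infinity>"
  shows "AE x in \<Omega>. (\<lambda>i. series k (indicator (B i \<inter> cube k S)) x) \<longlonglongrightarrow> 0"
proof -
  let ?N = "power_measure k (density \<mu> (indicator S))"
  have "finite_measure (density \<mu> (indicator S))"
    using S by (intro finite_measureI) (simp add: emeasure_density)
  then have sf: "sigma_finite_measure (density \<mu> (indicator S))" by (rule finite_measure.axioms)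
  have sets_N: "sets ?N = sets (power_measure k \<mu>)" by (intro sets_PiM_cong) auto
  have "AE y in ?N. (\<lambda>i. indicator (B i) y :: ennreal) \<longlonglongrightarrow> 0"
    using B by (intro AE_suminf_finite_tendsto_0) (auto simp: sets_N)
  then have "AE y in ?N. \<forall>\<^sub>F i in sequentially. y \<notin> B i"
  proof eventually_elim
    case (elim y)
    have "\<forall>\<^sub>F i in sequentially. (indicator (B i) y :: ennreal) < 1" using elim by (intro order_tendstoD) auto
    then show ?case by eventually_elim (auto simp: indicator_def split: if_splits)
  qed
  from AE_power_restrict[OF S(1) sf this]
  have "AE x in \<Omega>. marks k j x \<in> cube k S \<longrightarrow> (\<forall>\<^sub>F i in sequentially. marks k j x \<notin> B i)" if "j \<in> tuples k" for j
    by (rule AE_marks[OF that])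
  then have "AE x in \<Omega>. \<forall>j\<in>tuples k. marks k j x \<in> cube k S \<longrightarrow> (\<forall>\<^sub>F i in sequentially. marks k j x \<notin> B i)"
    by (subst AE_ball_countable[OF countable_tuples]) blast
  with AE_weight_vanish[OF S] show ?thesis
  proof eventually_elim
    case (elim x)
    show ?case
    proof (rule series_vanish)
      fix j assume "j \<in> tuples k"
      then have "marks k j x \<in> cube k S \<longrightarrow> (\<forall>\<^sub>F i in sequentially. marks k j x \<notin> B i)" using elim by blast
      then show "\<forall>\<^sub>F i in sequentially. marks k j x \<notin> B i \<inter> cube k S"
        by (cases "marks k j x \<in> cube k S") (auto elim: eventually_mono)
    qed (use elim in auto)
  qed
qed

end

section \<open>Moments of the series\<close>

text \<open>The powers p and 1/p form an adjunction, from which monotonicity and preservation of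
  suprema follow without treating infinity separately.\<close>

lemma ennreal_powr_le_iff:
  assumes "0 < p" shows "ennreal_powr x p \<le> y \<longleftrightarrow> x \<le> ennreal_powr y (1 / p)"
proof (cases x; cases y)
  fix a b :: real assume ab: "0 \<le> a" "x = ennreal a" "0 \<le> b" "y = ennreal b"
  have "a powr p \<le> b \<longleftrightarrow> a \<le> b powr (1 / p)"
  proof
    assume "a powr p \<le> b"
    then have "(a powr p) powr (1 / p) \<le> b powr (1 / p)" using assms by (intro powr_mono2) auto
    then show "a \<le> b powr (1 / p)" using ab assms by (simp add: powr_powr)
  next
    assume "a \<le> b powr (1 / p)"
    then have "a powr p \<le> (b powr (1 / p)) powr p" using ab assms by (intro powr_mono2) auto
    then show "a powr p \<le> b" using ab assms by (simp add: powr_powr)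
  qed
  then show ?thesis using ab by (simp add: ennreal_powr_def ennreal_le_iff)
qed (use assms in \<open>auto simp: ennreal_powr_def top_unique\<close>)

lemma ennreal_powr_SUP:
  assumes "0 < p" shows "ennreal_powr (SUP i\<in>I. f i) p = (SUP i\<in>I. ennreal_powr (f i) p)"
proof (rule antisym)
  show "ennreal_powr (SUP i\<in>I. f i) p \<le> (SUP i\<in>I. ennreal_powr (f i) p)"
    unfolding ennreal_powr_le_iff[OF assms]
    by (rule SUP_least, subst ennreal_powr_le_iff[OF assms, symmetric], rule SUP_upper)
  show "(SUP i\<in>I. ennreal_powr (f i) p) \<le> ennreal_powr (SUP i\<in>I. f i) p"
  proof (rule SUP_least)
    fix i assume i: "i \<in> I"
    have "f i \<le> ennreal_powr (ennreal_powr (SUP i\<in>I. f i) p) (1 / p)"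
      using SUP_upper[OF i, of f] by (rule order_trans) (simp add: ennreal_powr_le_iff[OF assms, symmetric])
    then show "ennreal_powr (f i) p \<le> ennreal_powr (SUP i\<in>I. f i) p" by (simp add: ennreal_powr_le_iff[OF assms])
  qed
qed

lemma ennreal_powr_mono: "0 < p \<Longrightarrow> x \<le> y \<Longrightarrow> ennreal_powr x p \<le> ennreal_powr y p"
  by (simp add: ennreal_powr_le_iff) (metis ennreal_powr_le_iff order_refl order_trans)

lemma ennreal_powr_0: "0 < p \<Longrightarrow> ennreal_powr 0 p = 0"
  by (simp add: ennreal_powr_def)

lemma ennreal_powr_mult:
  assumes "0 < p" shows "ennreal_powr (x * y) p = ennreal_powr x p * ennreal_powr y p"
proof (cases x; cases y)
  fix a b :: real assume ab: "0 \<le> a" "x = ennreal a" "0 \<le> b" "y = ennreal b"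
  then show ?thesis by (simp add: ennreal_powr_def powr_mult flip: ennreal_mult)
next
  fix a :: real assume ab: "0 \<le> a" "x = ennreal a" "y = \<top>"
  then show ?thesis using assms
    by (cases "a = 0") (auto simp: ennreal_powr_def ennreal_mult_top)
next
  fix b :: real assume ab: "0 \<le> b" "y = ennreal b" "x = \<top>"
  then show ?thesis using assms
    by (cases "b = 0") (auto simp: ennreal_powr_def ennreal_top_mult)
qed (simp add: ennreal_powr_def)

lemma ennreal_powr_prod:
  assumes "0 < p" "finite I" shows "ennreal_powr (\<Prod>i\<in>I. f i) p = (\<Prod>i\<in>I. ennreal_powr (f i) p)"
  using assms(2) by (induction I rule: finite_induct) (simp_all add: ennreal_powr_mult[OF assms(1)], simp add: ennreal_powr_def)

text \<open>From x + y \<le> 2 max x y. It replaces the triangle inequality uniformly for exponents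
  below and above 1.\<close>

lemma ennreal_powr_add_le:
  assumes "0 < p" shows "ennreal_powr (x + y) p \<le> ennreal (2 powr p) * (ennreal_powr x p + ennreal_powr y p)"
proof -
  have "x + y \<le> 2 * max x y"
    using add_mono[OF max.cobounded1[of x y] max.cobounded2[of y x]] by (simp add: mult_2)
  then have "ennreal_powr (x + y) p \<le> ennreal_powr (2 * max x y) p" by (rule ennreal_powr_mono[OF assms])
  also have "\<dots> = ennreal (2 powr p) * ennreal_powr (max x y) p"
    by (simp add: ennreal_powr_mult[OF assms]) (simp add: ennreal_powr_def)
  also have "ennreal_powr (max x y) p \<le> ennreal_powr x p + ennreal_powr y p"
    by (cases "x \<le> y") (auto simp: max_def)
  finally show ?thesis by (simp add: mult_left_mono)
qed

lemma ennreal_powr_tendsto_0: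
  assumes p: "0 < p" and f: "f \<longlonglongrightarrow> 0" shows "(\<lambda>n. ennreal_powr (f n) p) \<longlonglongrightarrow> 0"
proof (rule ennreal_tendsto_0I)
  fix e :: real assume e: "0 < e"
  have "\<forall>\<^sub>F n in sequentially. f n < ennreal (e powr (1 / p))"
    using f e by (intro order_tendstoD) auto
  then show "\<forall>\<^sub>F n in sequentially. ennreal_powr (f n) p \<le> ennreal e"
  proof eventually_elim
    case (elim n)
    then have "f n \<le> ennreal_powr (ennreal e) (1 / p)" using e by (simp add: ennreal_powr_def)
    then show ?case by (simp add: ennreal_powr_le_iff[OF p])
  qed
qed

text \<open>If 2^l < x \<le> 2^(l+1), the term with index l alone dominates x^p; at infinity all
  terms are at least 1. Moments are thereby reduced to tail probabilities at dyadic levels.\<close>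

lemma ennreal_powr_dyadic_bound:
  assumes "0 < p"
  shows "ennreal_powr (max 1 x) p \<le>
    1 + (\<Sum>n. ennreal ((2 powr p) ^ Suc n) * indicator {x. ennreal (2 ^ n) < x} x)"
    (is "_ \<le> 1 + (\<Sum>n. ?f n)")
proof (cases "x \<le> 1")
  case True
  then show ?thesis by (simp add: max_def ennreal_powr_def)
next
  case False
  show ?thesis
  proof (cases "x = \<infinity>")
    case True
    have "of_nat N \<le> (\<Sum>n. ?f n)" for N
    proof -
      have "1 \<le> (2 powr p :: real)" using assms by (simp add: ge_one_powr_ge_zero)
      then have "1 \<le> ennreal ((2 powr p) ^ Suc n)" for n
        by (subst ennreal_1[symmetric], intro ennreal_leI one_le_power)
      then have "(\<Sum>n<N. 1) \<le> (\<Sum>n<N. ?f n)" by (intro sum_mono) (simp add: True)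
      also have "\<dots> \<le> (\<Sum>n. ?f n)" by (intro sum_le_suminf) auto
      finally show ?thesis by simp
    qed
    then have "(SUP N. of_nat N) \<le> (\<Sum>n. ?f n)" by (intro SUP_least)
    then show ?thesis by (simp add: ennreal_SUP_of_nat_eq_top top_unique)
  next
    case fin: False
    then obtain r where r: "x = ennreal r" "0 \<le> r" by (cases x) auto
    then have r1: "1 < r" using False by (simp add: not_le ennreal_less_iff[of 1, simplified])
    obtain N where "r \<le> 2 ^ N" using real_arch_pow[of 2 r] by (auto intro: less_imp_le)
    define n where "n = (LEAST n. r \<le> 2 ^ n)"
    have n: "r \<le> 2 ^ n" unfolding n_def by (rule LeastI) fact
    have "n \<noteq> 0" using n r1 by (cases n) auto
    then obtain l where l: "n = Suc l" by (cases n) auto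
    have "\<not> r \<le> 2 ^ l" using not_less_Least[of l "\<lambda>n. r \<le> 2 ^ n"] by (simp add: n_def[symmetric] l)
    then have "ennreal (2 ^ l) < x" using r by (simp add: ennreal_less_iff)
    have "r powr p \<le> (2 ^ n) powr p" using n r assms by (intro powr_mono2) auto
    also have "\<dots> = (2 powr p) ^ n" by (simp add: powr_realpow[symmetric] powr_powr mult.commute)
    finally have "ennreal_powr (max 1 x) p \<le> ennreal ((2 powr p) ^ Suc l)"
      using r r1 by (simp add: l max_def ennreal_powr_def ennreal_le_iff2 not_le ennreal_leI False split: if_splits)
    also have "\<dots> = ?f l" using \<open>ennreal (2 ^ l) < x\<close> by simp
    also have "\<dots> \<le> (\<Sum>n. ?f n)"
    proof -
      have "f l \<le> (\<Sum>n. f n)" for f :: "nat \<Rightarrow> ennreal" using sum_le_suminf[of f "{l}"] by simp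
      then show ?thesis .
    qed
    finally show ?thesis by (rule order_trans) simp
  qed
qed

section \<open>Moments of the Frechet sup measure\<close>

context frechet_random_sup_measure
begin

text \<open>From 1 - exp(-c) \<le> c.\<close>

lemma tail_bound:
  assumes "A \<in> sets \<mu>" "0 < x"
  shows "emeasure P {w \<in> space P. ennreal x < M A w} \<le> emeasure \<mu> A * ennreal (x powr - \<alpha>)"
proof -
  let ?c = "emeasure \<mu> A * ennreal (x powr - \<alpha>)"
  have [measurable]: "M A \<in> borel_measurable P" by (rule random_variable) fact
  show ?thesis
  proof (cases "?c")
    case (real r)
    have "emeasure P (space P - {w \<in> space P. M A w \<le> ennreal x}) = 1 - exp_neg ?c"
      using emeasure_le[OF assms] by (subst emeasure_compl) (auto simp: emeasure_space_1)
    moreover have "space P - {w \<in> space P. M A w \<le> ennreal x} = {w \<in> space P. ennreal x < M A w}" by auto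
    moreover have "1 - exp_neg ?c \<le> ?c"
    proof -
      have "1 - exp_neg ?c = ennreal (1 - exp (- r))"
        using real by (simp add: exp_neg_def ennreal_minus flip: ennreal_1)
      also have "\<dots> \<le> ennreal r" using exp_ge_add_one_self[of "- r"] by (intro ennreal_leI) simp
      finally show ?thesis using real by simp
    qed
    ultimately show ?thesis by simp
  qed simp
qed

text \<open>Summing the tails at dyadic levels gives a geometric series of ratio 2^(p - \<alpha>) <
  1. One constant serves all sets, and the bound is close to 1 on sets of small measure, so that it
  can be multiplied over many cells.\<close>

lemma moment_bound:
  assumes p: "0 < p" "p < \<alpha>"
  obtains C where "0 \<le> C"
    "\<And>A. A \<in> sets \<mu> \<Longrightarrow> (\<integral>\<^sup>+w. ennreal_powr (max 1 (M A w)) p \<partial>P) \<le> 1 + ennreal C * emeasure \<mu> A"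
proof
  define q where "q = 2 powr (p - \<alpha>)"
  have q: "0 < q" "q < 1" using p by (auto simp: q_def powr_less_one)
  define C where "C = 2 powr p * (1 / (1 - q))"
  show "0 \<le> C" using q by (simp add: C_def)
  fix A assume A: "A \<in> sets \<mu>"
  have [measurable]: "M A \<in> borel_measurable P" by (rule random_variable) fact
  have ind [measurable]: "(\<lambda>w. indicator {x. ennreal (2 ^ n) < x} (M A w) :: ennreal) \<in> borel_measurable P" for n
    unfolding indicator_def mem_Collect_eq by measurable
  have sums: "(\<lambda>n. 2 powr p * q ^ n) sums C"
    unfolding C_def using q by (intro sums_mult geometric_sums) simp
  have tm: "(2 powr p) ^ Suc n * (2 ^ n) powr - \<alpha> = 2 powr p * q ^ n" for n
  proof -
    have "(2 ^ n :: real) powr - \<alpha> = (2 powr - \<alpha>) ^ n"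
      by (simp add: powr_realpow[symmetric] powr_powr mult.commute)
    moreover have "q = 2 powr p * 2 powr - \<alpha>" by (simp add: q_def flip: powr_add)
    ultimately show ?thesis by (simp add: power_mult_distrib mult_ac)
  qed
  have "(\<integral>\<^sup>+w. ennreal_powr (max 1 (M A w)) p \<partial>P) \<le>
    (\<integral>\<^sup>+w. 1 + (\<Sum>n. ennreal ((2 powr p) ^ Suc n) * indicator {x. ennreal (2 ^ n) < x} (M A w)) \<partial>P)"
    by (intro nn_integral_mono ennreal_powr_dyadic_bound p)
  also have "\<dots> = 1 + (\<Sum>n. \<integral>\<^sup>+w. ennreal ((2 powr p) ^ Suc n) * indicator {x. ennreal (2 ^ n) < x} (M A w) \<partial>P)"
    by (subst nn_integral_add) (auto simp: emeasure_space_1 nn_integral_suminf)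
  also have "\<dots> = 1 + (\<Sum>n. ennreal ((2 powr p) ^ Suc n) * emeasure P {w \<in> space P. ennreal (2 ^ n) < M A w})"
  proof (intro arg_cong2[where f = "(+)"] suminf_cong refl)
    fix n
    have "(\<integral>\<^sup>+w. ennreal ((2 powr p) ^ Suc n) * indicator {x. ennreal (2 ^ n) < x} (M A w) \<partial>P) =
      (\<integral>\<^sup>+w. ennreal ((2 powr p) ^ Suc n) * indicator {w \<in> space P. ennreal (2 ^ n) < M A w} w \<partial>P)"
      by (intro nn_integral_cong) (auto simp: indicator_def)
    also have "\<dots> = ennreal ((2 powr p) ^ Suc n) * emeasure P {w \<in> space P. ennreal (2 ^ n) < M A w}"
      by (rule nn_integral_cmult_indicator) measurable
    finally show "(\<integral>\<^sup>+w. ennreal ((2 powr p) ^ Suc n) * indicator {x. ennreal (2 ^ n) < x} (M A w) \<partial>P) =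
      ennreal ((2 powr p) ^ Suc n) * emeasure P {w \<in> space P. ennreal (2 ^ n) < M A w}" .
  qed
  also have "\<dots> \<le> 1 + (\<Sum>n. ennreal (2 powr p * q ^ n) * emeasure \<mu> A)"
  proof (intro add_left_mono suminf_le)
    fix n
    have "ennreal ((2 powr p) ^ Suc n) * emeasure P {w \<in> space P. ennreal (2 ^ n) < M A w} \<le>
      ennreal ((2 powr p) ^ Suc n) * (emeasure \<mu> A * ennreal ((2 ^ n) powr - \<alpha>))"
      by (intro mult_left_mono tail_bound A) auto
    also have "\<dots> = ennreal ((2 powr p) ^ Suc n) * ennreal ((2 ^ n) powr - \<alpha>) * emeasure \<mu> A"
      by (simp only: mult_ac)
    also have "ennreal ((2 powr p) ^ Suc n) * ennreal ((2 ^ n) powr - \<alpha>) = ennreal (2 powr p * q ^ n)"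
      by (subst ennreal_mult[symmetric]) (simp_all add: tm del: power_Suc)
    finally show "ennreal ((2 powr p) ^ Suc n) * emeasure P {w \<in> space P. ennreal (2 ^ n) < M A w} \<le>
      ennreal (2 powr p * q ^ n) * emeasure \<mu> A" .
  qed auto
  also have "(\<Sum>n. ennreal (2 powr p * q ^ n) * emeasure \<mu> A) = ennreal C * emeasure \<mu> A"
  proof -
    have "(\<Sum>n. ennreal (2 powr p * q ^ n)) = ennreal C"
      using sums q by (subst suminf_ennreal_eq) auto
    then show ?thesis by (simp add: ennreal_suminf_multc)
  qed
  finally show "(\<integral>\<^sup>+w. ennreal_powr (max 1 (M A w)) p \<partial>P) \<le> 1 + ennreal C * emeasure \<mu> A" .
qed

text \<open>Independence over disjoint sets and 1 + x \<le> exp x turn the product of moments into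
  one exponential of the total measure. The bound does not depend on the number of cells, which
  permits refining the partition indefinitely.\<close>

lemma prod_moment_bound:
  assumes p: "0 < p" "p < \<alpha>"
  obtains C where "0 \<le> C"
    "\<And>K c S. S \<in> sets \<mu> \<Longrightarrow> emeasure \<mu> S < \<infinity> \<Longrightarrow> (\<And>i. i \<in> {1..K::nat} \<Longrightarrow> c i \<in> sets \<mu>) \<Longrightarrow>
       (\<And>i. i \<in> {1..K} \<Longrightarrow> c i \<subseteq> S) \<Longrightarrow> disjoint_family_on c {1..K} \<Longrightarrow>
       (\<integral>\<^sup>+w. (\<Prod>i\<in>{1..K}. ennreal_powr (max 1 (M (c i) w)) p) \<partial>P) \<le> ennreal (exp (C * measure \<mu> S))"
proof -
  obtain C where C: "0 \<le> C"
    "\<And>A. A \<in> sets \<mu> \<Longrightarrow> (\<integral>\<^sup>+w. ennreal_powr (max 1 (M A w)) p \<partial>P) \<le> 1 + ennreal C * emeasure \<mu> A"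
    by (rule moment_bound[OF p]) blast
  have "(\<integral>\<^sup>+w. (\<Prod>i\<in>{1..K}. ennreal_powr (max 1 (M (c i) w)) p) \<partial>P) \<le> ennreal (exp (C * measure \<mu> S))"
    if S: "S \<in> sets \<mu>" "emeasure \<mu> S < \<infinity>" and c: "\<And>i. i \<in> {1..K::nat} \<Longrightarrow> c i \<in> sets \<mu>"
      "\<And>i. i \<in> {1..K} \<Longrightarrow> c i \<subseteq> S" and disj: "disjoint_family_on c {1..K}" for K c S
  proof -
    have fin: "emeasure \<mu> (c i) = ennreal (measure \<mu> (c i))" if "i \<in> {1..K}" for i
      using emeasure_mono[OF c(2)[OF that] S(1)] S(2) by (intro emeasure_eq_ennreal_measure) (auto simp: top_unique)
    have ind: "indep_vars (\<lambda>_. borel) (\<lambda>i. M (c i)) {1..K}"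
      by (rule independently_scattered[OF c(1) disj])
    have "indep_vars (\<lambda>_. borel) (\<lambda>i w. ennreal_powr (max 1 (M (c i) w)) p) {1..K}"
      by (rule indep_vars_compose2[OF ind]) (unfold ennreal_powr_def, measurable)
    then have "(\<integral>\<^sup>+w. (\<Prod>i\<in>{1..K}. ennreal_powr (max 1 (M (c i) w)) p) \<partial>P) =
      (\<Prod>i\<in>{1..K}. \<integral>\<^sup>+w. ennreal_powr (max 1 (M (c i) w)) p \<partial>P)"
      by (intro indep_vars_nn_integral) auto
    also have "\<dots> \<le> (\<Prod>i\<in>{1..K}. ennreal (exp (C * measure \<mu> (c i))))"
    proof (intro prod_mono_ennreal)
      fix i assume i: "i \<in> {1..K}"
      have "(\<integral>\<^sup>+w. ennreal_powr (max 1 (M (c i) w)) p \<partial>P) \<le> 1 + ennreal C * emeasure \<mu> (c i)"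
        by (intro C c i)
      also have "\<dots> = ennreal (1 + C * measure \<mu> (c i))"
        using C(1) by (simp add: fin[OF i] ennreal_mult)
      also have "\<dots> \<le> ennreal (exp (C * measure \<mu> (c i)))"
        by (intro ennreal_leI exp_ge_add_one_self)
      finally show "(\<integral>\<^sup>+w. ennreal_powr (max 1 (M (c i) w)) p \<partial>P) \<le> ennreal (exp (C * measure \<mu> (c i)))" .
    qed
    also have "\<dots> = ennreal (exp (C * (\<Sum>i\<in>{1..K}. measure \<mu> (c i))))"
      by (simp add: prod_ennreal exp_sum[symmetric] sum_distrib_left)
    also have "\<dots> \<le> ennreal (exp (C * measure \<mu> S))"
    proof -
      have "(\<Sum>i\<in>{1..K}. measure \<mu> (c i)) = measure \<mu> (\<Union>i\<in>{1..K}. c i)"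
        using c disj fin by (intro measure_finite_Union[symmetric]) auto
      also have "\<dots> \<le> measure \<mu> S"
      proof (rule measure_mono_fmeasurable)
        show "(\<Union>i\<in>{1..K}. c i) \<subseteq> S" by (rule UN_least) (rule c(2))
        show "(\<Union>i\<in>{1..K}. c i) \<in> sets \<mu>" by (intro sets.finite_UN c(1)) auto
      qed (use S in \<open>simp add: fmeasurable_def\<close>)
      finally show ?thesis using C(1) by (intro ennreal_leI) (simp add: mult_left_mono)
    qed
    finally show ?thesis .
  qed
  with C(1) show thesis by (rule that)
qed

end

section \<open>Moments of the series over sets of finite measure\<close>

locale lepage_coded = lepage_transfer \<alpha> \<mu> m \<psi> P M + coded_space \<mu> \<phi>
  for \<alpha> :: real and \<mu> m :: "'e measure" and \<psi> and P :: "'w measure" and M and \<phi>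
begin

text \<open>Factors of at least 1 may be added freely, so one bound serves all choices of cells. The
  cells, numbered from 0, are shifted by one to match the index sets {1..K} of independent
  scattering.\<close>

lemma series_dyadic_le:
  "series k (indicator (dyadic_union k n \<inter> cube k S)) x \<le>
    (\<Prod>i\<in>{1..2 ^ n + 1}. max 1 (mass (cell n (i - 1) \<inter> S) x))"
proof -
  let ?T = "{t \<in> {1..k} \<rightarrow>\<^sub>E {0..2 ^ n :: nat}. inj_on t {1..k}}"
  define a where "a i = mass (cell n (i - 1) \<inter> S) x" for i
  have "(\<lambda>u. indicator (dyadic_union k n \<inter> cube k S) u :: ennreal) =
    (\<lambda>u. SUP t\<in>?T. indicator (PiE {1..k} (\<lambda>r. cell n (t r) \<inter> S)) u)"
  proof
    fix u
    have *: "PiE {1..k} (\<lambda>r. cell n (t r) \<inter> S) = PiE {1..k} (\<lambda>r. cell n (t r)) \<inter> cube k S" for t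
      by (auto simp: cube_def PiE_iff)
    show "(indicator (dyadic_union k n \<inter> cube k S) u :: ennreal) = (SUP t\<in>?T. indicator (PiE {1..k} (\<lambda>r. cell n (t r) \<inter> S)) u)"
    proof (cases "u \<in> dyadic_union k n \<inter> cube k S")
      case True
      then obtain t where "t \<in> ?T" "u \<in> PiE {1..k} (\<lambda>r. cell n (t r) \<inter> S)" unfolding * dyadic_union_def by blast
      then show ?thesis using True by (intro antisym SUP_least) (auto intro: SUP_upper2 simp: indicator_def)
    next
      case False
      then have "u \<notin> PiE {1..k} (\<lambda>r. cell n (t r) \<inter> S)" if "t \<in> ?T" for t
        using that unfolding * dyadic_union_def by blast
      then have "(SUP t\<in>?T. indicator (PiE {1..k} (\<lambda>r. cell n (t r) \<inter> S)) u) \<le> (0 :: ennreal)"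
        by (intro SUP_least) simp
      then show ?thesis using False by simp
    qed
  qed
  then have "series k (indicator (dyadic_union k n \<inter> cube k S)) x =
    (SUP t\<in>?T. series k (indicator (PiE {1..k} (\<lambda>r. cell n (t r) \<inter> S))) x)"
    by (simp add: series_SUP)
  also have "\<dots> \<le> (\<Prod>i\<in>{1..2 ^ n + 1}. max 1 (a i))"
  proof (rule SUP_least)
    fix t assume "t \<in> ?T"
    then have t: "t \<in> {1..k} \<rightarrow> {0..2 ^ n}" "inj_on t {1..k}" by auto
    have "disjoint_family_on (\<lambda>r. cell n (t r) \<inter> S) {1..k}"
      unfolding disjoint_family_on_def
    proof (intro ballI impI)
      fix r s assume "r \<in> {1..k}" "s \<in> {1..k}" "r \<noteq> s"
      then have "t r \<noteq> t s" using t(2) by (auto dest: inj_onD)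
      then show "cell n (t r) \<inter> S \<inter> (cell n (t s) \<inter> S) = {}" using cell_disjoint by blast
    qed
    then have "series k (indicator (PiE {1..k} (\<lambda>r. cell n (t r) \<inter> S))) x = (\<Prod>r\<in>{1..k}. mass (cell n (t r) \<inter> S) x)"
      by (rule series_rectangle)
    also have "\<dots> = (\<Prod>r\<in>{1..k}. a (Suc (t r)))" by (simp add: a_def)
    \<comment> \<open>The cells of a tuple are pairwise different, so the product over coordinates
      is one over a set of cells.\<close>
    also have "\<dots> = (\<Prod>i\<in>(\<lambda>r. Suc (t r)) ` {1..k}. a i)"
    proof (subst prod.reindex)
      show "inj_on (\<lambda>r. Suc (t r)) {1..k}" using comp_inj_on[OF t(2), of Suc] by (simp add: comp_def)
    qed (simp only: comp_def)
    also have "\<dots> \<le> (\<Prod>i\<in>(\<lambda>r. Suc (t r)) ` {1..k}. max 1 (a i))"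
      by (intro prod_mono_ennreal) simp
    also have "\<dots> \<le> (\<Prod>i\<in>(\<lambda>r. Suc (t r)) ` {1..k}. max 1 (a i)) * (\<Prod>i\<in>{1..2 ^ n + 1} - (\<lambda>r. Suc (t r)) ` {1..k}. max 1 (a i))"
    proof -
      have "(\<Prod>i\<in>{1..2 ^ n + 1} - (\<lambda>r. Suc (t r)) ` {1..k}. 1) \<le> (\<Prod>i\<in>{1..2 ^ n + 1} - (\<lambda>r. Suc (t r)) ` {1..k}. max 1 (a i))"
        by (intro prod_mono_ennreal) simp
      then show ?thesis using mult_left_mono by fastforce
    qed
    also have "\<dots> = (\<Prod>i\<in>{1..2 ^ n + 1}. max 1 (a i))"
      using t(1) by (subst prod.subset_diff[of "(\<lambda>r. Suc (t r)) ` {1..k}" "{1..2 ^ n + 1}"]) (auto simp: mult.commute)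
    finally show "series k (indicator (PiE {1..k} (\<lambda>r. cell n (t r) \<inter> S))) x \<le> (\<Prod>i\<in>{1..2 ^ n + 1}. max 1 (a i))" .
  qed
  finally show ?thesis by (simp add: a_def)
qed

lemma cube_Int_sets:
  assumes "S \<in> sets \<mu>" "B \<in> sets (power_measure k \<mu>)"
  shows "B \<inter> cube k S \<in> sets (power_measure k \<mu>)"
proof -
  note [measurable] = assms
  have "B \<inter> cube k S = B \<inter> {u \<in> space (power_measure k \<mu>). \<forall>r\<in>{1..k}. u r \<in> S}"
    using sets.sets_into_space[OF assms(2)] by (auto simp: cube_def)
  also have "\<dots> \<in> sets (power_measure k \<mu>)" by measurable
  finally show ?thesis .
qed

text \<open>The moment bound is uniform in the dyadic level, and the dyadic unions increase to the
  off-diagonal set, so monotone convergence applies.\<close>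

lemma series_moment:
  assumes S: "S \<in> sets \<mu>" "emeasure \<mu> S < \<infinity>" and p: "0 < p" "p < \<alpha>"
  shows "(\<integral>\<^sup>+x. ennreal_powr (series k (indicator (off_diagonal k \<mu> \<inter> cube k S)) x) p \<partial>\<Omega>) < \<infinity>"
proof -
  obtain C where C: "0 \<le> C"
    "\<And>K c S. S \<in> sets \<mu> \<Longrightarrow> emeasure \<mu> S < \<infinity> \<Longrightarrow> (\<And>i. i \<in> {1..K::nat} \<Longrightarrow> c i \<in> sets \<mu>) \<Longrightarrow>
       (\<And>i. i \<in> {1..K} \<Longrightarrow> c i \<subseteq> S) \<Longrightarrow> disjoint_family_on c {1..K} \<Longrightarrow>
       (\<integral>\<^sup>+w. (\<Prod>i\<in>{1..K}. ennreal_powr (max 1 (M (c i) w)) p) \<partial>P) \<le> ennreal (exp (C * measure \<mu> S))"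
    by (rule prod_moment_bound[OF p]) blast
  define D where "D n x = series k (indicator (dyadic_union k n \<inter> cube k S)) x" for n x
  have "(\<lambda>u. indicator (off_diagonal k \<mu> \<inter> cube k S) u :: ennreal) = (\<lambda>u. SUP n. indicator (dyadic_union k n \<inter> cube k S) u)"
    unfolding dyadic_union_UN[symmetric]
    by (intro ext antisym SUP_least) (auto simp: indicator_def intro: SUP_upper2)
  then have SUP: "series k (indicator (off_diagonal k \<mu> \<inter> cube k S)) x = (SUP n. D n x)" for x
    by (simp add: series_SUP D_def)
  have D_meas [measurable]: "D n \<in> borel_measurable \<Omega>" for n
    unfolding D_def[abs_def]
    by (intro measurable_series borel_measurable_indicator cube_Int_sets S rectangle_unions_sets dyadic_union_in)
  have incD: "D n x \<le> D (Suc n) x" for n x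
    unfolding D_def using dyadic_union_incseq[of k]
    by (intro series_mono) (auto simp: indicator_def incseq_Suc_iff)
  have bound: "(\<integral>\<^sup>+x. ennreal_powr (D n x) p \<partial>\<Omega>) \<le> ennreal (exp (C * measure \<mu> S))" for n
  proof -
    define c where "c i = cell n (i - 1) \<inter> S" for i
    have c: "c i \<in> sets \<mu>" "c i \<subseteq> S" for i using cell_sets S(1) by (auto simp: c_def)
    have "disjoint_family_on c {1..2 ^ n + 1}"
      unfolding disjoint_family_on_def c_def
    proof (intro ballI impI)
      fix i j :: nat assume "i \<in> {1..2 ^ n + 1}" "j \<in> {1..2 ^ n + 1}" "i \<noteq> j"
      then have "i - 1 \<noteq> j - 1" by auto
      then show "cell n (i - 1) \<inter> S \<inter> (cell n (j - 1) \<inter> S) = {}" using cell_disjoint by blast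
    qed
    note P = C(2)[OF S c(1) c(2) this]
    \<comment> \<open>Independence is available on the side of \<open>M\<close>; the expectation is
      computed there and carried over to \<open>mass\<close>.\<close>
    have "corr (\<lambda>w. \<Prod>i\<in>{1..2 ^ n + 1}. ennreal_powr (max 1 (M (c i) w)) p)
      (\<lambda>x. \<Prod>i\<in>{1..2 ^ n + 1}. ennreal_powr (max 1 (mass (c i) x)) p)"
      by (intro corr_prod corr_compose1[OF corr_basic[OF c(1)], where f = "\<lambda>y. ennreal_powr (max 1 y) p"]) auto
    then have eq: "(\<integral>\<^sup>+w. (\<Prod>i\<in>{1..2 ^ n + 1}. ennreal_powr (max 1 (M (c i) w)) p) \<partial>P) =
      (\<integral>\<^sup>+x. (\<Prod>i\<in>{1..2 ^ n + 1}. ennreal_powr (max 1 (mass (c i) x)) p) \<partial>\<Omega>)"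
      by (rule corr_nn_integral)
    have "(\<integral>\<^sup>+x. ennreal_powr (D n x) p \<partial>\<Omega>) \<le> (\<integral>\<^sup>+x. ennreal_powr (\<Prod>i\<in>{1..2 ^ n + 1}. max 1 (mass (c i) x)) p \<partial>\<Omega>)"
      unfolding D_def c_def by (intro nn_integral_mono ennreal_powr_mono p series_dyadic_le)
    also have "\<dots> = (\<integral>\<^sup>+x. (\<Prod>i\<in>{1..2 ^ n + 1}. ennreal_powr (max 1 (mass (c i) x)) p) \<partial>\<Omega>)"
      by (subst ennreal_powr_prod[OF p(1)]) auto
    also have "\<dots> \<le> ennreal (exp (C * measure \<mu> S))" using P eq by simp
    finally show ?thesis .
  qed
  have "(\<integral>\<^sup>+x. ennreal_powr (series k (indicator (off_diagonal k \<mu> \<inter> cube k S)) x) p \<partial>\<Omega>) =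
    (\<integral>\<^sup>+x. (SUP n. ennreal_powr (D n x) p) \<partial>\<Omega>)"
    unfolding SUP by (simp add: ennreal_powr_SUP[OF p(1)])
  also have "\<dots> = (SUP n. \<integral>\<^sup>+x. ennreal_powr (D n x) p \<partial>\<Omega>)"
    by (intro nn_integral_monotone_convergence_SUP incseq_SucI le_funI ennreal_powr_mono p incD) measurable
  also have "\<dots> \<le> ennreal (exp (C * measure \<mu> S))" by (intro SUP_least bound)
  finally show ?thesis using le_less_trans by fastforce
qed

text \<open>Otherwise some selection of indices keeps the moments above e while the measures are at
  most 2^(-n). Along it the series vanish almost surely and are dominated by the series over the
  whole off-diagonal cube, which contradicts dominated convergence.\<close>

lemma Lp_series_vanish:
  assumes S: "S \<in> sets \<mu>" "emeasure \<mu> S < \<infinity>" and p: "0 < p" "p < \<alpha>"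
    and B: "\<And>i. B i \<in> sets (power_measure k \<mu>)" "\<And>i. B i \<subseteq> off_diagonal k \<mu>"
      "(\<lambda>i. emeasure (power_measure k (density \<mu> (indicator S))) (B i)) \<longlonglongrightarrow> 0"
  shows "(\<lambda>i. \<integral>\<^sup>+x. ennreal_powr (series k (indicator (B i \<inter> cube k S)) x) p \<partial>\<Omega>) \<longlonglongrightarrow> 0"
    (is "?a \<longlonglongrightarrow> 0")
proof (rule ccontr)
  let ?N = "power_measure k (density \<mu> (indicator S))"
  assume "\<not> ?a \<longlonglongrightarrow> 0"
  then obtain e where e: "0 < e" "\<not> (\<forall>\<^sub>F i in sequentially. ?a i \<le> ennreal e)"
    using ennreal_tendsto_0I[of ?a] by blast
  have "\<exists>i. ennreal e < ?a i \<and> emeasure ?N (B i) \<le> ennreal ((1 / 2) ^ n)" for n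
  proof -
    have "\<forall>\<^sub>F i in sequentially. emeasure ?N (B i) < ennreal ((1 / 2) ^ n)"
      using B(3) by (intro order_tendstoD) auto
    moreover have "\<exists>\<^sub>F i in sequentially. \<not> ?a i \<le> ennreal e" using e(2) by (simp add: frequently_def)
    ultimately have "\<exists>\<^sub>F i in sequentially. \<not> ?a i \<le> ennreal e \<and> emeasure ?N (B i) < ennreal ((1 / 2) ^ n)"
      by (auto intro: frequently_rev_mp elim: eventually_mono)
    then show ?thesis by (auto dest!: frequently_ex simp: not_le less_imp_le)
  qed
  then obtain r where r: "\<And>n. ennreal e < ?a (r n)" "\<And>n. emeasure ?N (B (r n)) \<le> ennreal ((1 / 2) ^ n)" by metis
  have [measurable]: "(\<lambda>x. series k (indicator (B i \<inter> cube k S)) x) \<in> borel_measurable \<Omega>" for i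
    using cube_Int_sets[OF S(1) B(1)] by measurable
  have Om: "off_diagonal k \<mu> \<inter> cube k S \<in> sets (power_measure k \<mu>)"
    by (intro cube_Int_sets S off_diagonal_in_sets)
  then have [measurable]: "(\<lambda>x. series k (indicator (off_diagonal k \<mu> \<inter> cube k S)) x) \<in> borel_measurable \<Omega>"
    by measurable
  have "AE x in \<Omega>. (\<lambda>n. series k (indicator (B (r n) \<inter> cube k S)) x) \<longlonglongrightarrow> 0"
  proof (rule AE_series_vanish[OF S])
    have "(\<Sum>n. emeasure ?N (B (r n))) \<le> (\<Sum>n. ennreal ((1 / 2) ^ n))"
      by (intro suminf_le r) auto
    also have "\<dots> < \<infinity>" by (simp add: suminf_ennreal2 summable_geometric)
    finally show "(\<Sum>n. emeasure ?N (B (r n))) < \<infinity>" .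
  qed (rule B)
  then have "AE x in \<Omega>. (\<lambda>n. ennreal_powr (series k (indicator (B (r n) \<inter> cube k S)) x) p) \<longlonglongrightarrow> 0"
    by eventually_elim (rule ennreal_powr_tendsto_0[OF p(1)])
  then have "(\<lambda>n. ?a (r n)) \<longlonglongrightarrow> (\<integral>\<^sup>+x. 0 \<partial>\<Omega>)"
  proof (rule nn_integral_dominated_convergence[rotated -1])
    show "(\<integral>\<^sup>+x. ennreal_powr (series k (indicator (off_diagonal k \<mu> \<inter> cube k S)) x) p \<partial>\<Omega>) < \<infinity>"
      by (rule series_moment[OF S p])
    show "AE x in \<Omega>. ennreal_powr (series k (indicator (B (r n) \<inter> cube k S)) x) p \<le>
      ennreal_powr (series k (indicator (off_diagonal k \<mu> \<inter> cube k S)) x) p" for n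
      using B(2) by (intro AE_I2 ennreal_powr_mono p series_mono) (auto simp: indicator_def)
  qed measurable
  then have "\<forall>\<^sub>F n in sequentially. ?a (r n) < ennreal e"
    using e(1) by (intro order_tendstoD) auto
  then show False using r(1) by (auto simp: eventually_sequentially dest: less_asym)
qed

end

section \<open>Versions of the product sup measure\<close>

text \<open>The distance inside \<open>Lp_tendsto\<close>. Because \<infinity> - \<infinity> =
  \<infinity>, it is infinite whenever an argument is, even for equal arguments; finiteness is
  therefore carried along.\<close>

definition ennreal_dist :: "ennreal \<Rightarrow> ennreal \<Rightarrow> ennreal" where
  "ennreal_dist x y = max x y - min x y"

lemma ennreal_dist_triangle: "ennreal_dist x y \<le> ennreal_dist v x + ennreal_dist v y"
proof (cases "x = \<top> \<or> y = \<top> \<or> v = \<top>")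
  case True
  have "ennreal_dist v \<top> = \<top>" "ennreal_dist \<top> v = \<top>" for v
    by (cases v; simp add: ennreal_dist_def max_def min_def top_unique)+
  then show ?thesis using True by auto
next
  case False
  then obtain a b c where r: "x = ennreal a" "0 \<le> a" "y = ennreal b" "0 \<le> b" "v = ennreal c" "0 \<le> c"
    by (cases x; cases y; cases v) auto
  have d: "ennreal_dist (ennreal s) (ennreal t) = ennreal \<bar>s - t\<bar>" if "0 \<le> s" "0 \<le> t" for s t
    using that by (auto simp: ennreal_dist_def max_def min_def ennreal_minus ennreal_le_iff)
  show ?thesis using r by (simp add: d flip: ennreal_plus)
qed

lemma ennreal_dist_eq_0: "ennreal_dist x y = 0 \<Longrightarrow> x = y"
  unfolding ennreal_dist_def by (auto simp: max_def min_def split: if_splits dest!: ennreal_minus_eq_0)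

text \<open>If the values differ, the larger one is itself at most z, so no subtraction has to be
  estimated. This ultrametric form is what suprema provide.\<close>

lemma ennreal_dist_le:
  assumes "x \<le> max y z" "y \<le> max x z" "x < \<infinity>" "y < \<infinity>"
  shows "ennreal_dist x y \<le> z"
proof (cases "x \<le> y")
  case True
  then have "ennreal_dist x y = y - x" by (simp add: ennreal_dist_def max_def min_def)
  also have "\<dots> \<le> z"
  proof (cases "y \<le> x")
    case True
    then have "y = x" using \<open>x \<le> y\<close> by simp
    then show ?thesis using assms by simp
  next
    case False
    then have "y \<le> z" using assms(2) by (auto simp: le_max_iff_disj)
    then show ?thesis using diff_le_self_ennreal order_trans by blast
  qed
  finally show ?thesis .
next
  case False
  then have "ennreal_dist x y = x - y" by (simp add: ennreal_dist_def max_def min_def)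
  also have "\<dots> \<le> x" by (rule diff_le_self_ennreal)
  also have "\<dots> \<le> z" using assms(1) False by (auto simp: le_max_iff_disj)
  finally show ?thesis .
qed

lemma ennreal_tendsto_of_dist:
  assumes "(\<lambda>n. ennreal_dist (f n) x) \<longlonglongrightarrow> 0" "x < \<infinity>"
  shows "f \<longlonglongrightarrow> x"
proof (rule order_tendstoI)
  fix a assume "a < x"
  then obtain b where b: "a < b" "b < x" using dense by blast
  then have "0 < x - b" by (simp add: diff_gr0_ennreal less_imp_le)
  with assms(1) have "\<forall>\<^sub>F n in sequentially. ennreal_dist (f n) x < x - b" by (intro order_tendstoD) auto
  then show "\<forall>\<^sub>F n in sequentially. a < f n"
  proof eventually_elim
    case (elim n)
    show ?case
    proof (rule ccontr)
      assume "\<not> a < f n"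
      then have "f n \<le> b" using b by (auto intro: order_trans less_imp_le)
      then have "x - b \<le> ennreal_dist (f n) x"
        using b by (auto simp: ennreal_dist_def max_def min_def intro: ennreal_mono_minus)
      then show False using elim by simp
    qed
  qed
next
  fix a assume a: "x < a"
  then obtain b where b: "x < b" "b < a" using dense by blast
  then have "0 < b - x" by (simp add: diff_gr0_ennreal assms(2))
  with assms(1) have "\<forall>\<^sub>F n in sequentially. ennreal_dist (f n) x < b - x" by (intro order_tendstoD) auto
  then show "\<forall>\<^sub>F n in sequentially. f n < a"
  proof eventually_elim
    case (elim n)
    show ?case
    proof (rule ccontr)
      assume "\<not> f n < a"
      then have "b \<le> f n" using b by (auto intro: order_trans less_imp_le)
      then have "b - x \<le> ennreal_dist (f n) x"
        using b by (auto simp: ennreal_dist_def max_def min_def intro: ennreal_minus_mono)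
      then show False using elim by simp
    qed
  qed
qed

lemma measurable_ennreal_dist [measurable]: "case_prod ennreal_dist \<in> borel_measurable (borel \<Otimes>\<^sub>M borel)"
  unfolding ennreal_dist_def split_beta' by measurable

lemma off_diagonal_sets_iff:
  assumes "off_diagonal k \<mu> \<in> sets (power_measure k \<mu>)"
  shows "A \<in> off_diagonal_sets k \<mu> \<longleftrightarrow> A \<in> sets (power_measure k \<mu>) \<and> A \<subseteq> off_diagonal k \<mu>"
  using assms unfolding off_diagonal_sets_def off_diagonal_def[symmetric] by (auto simp: image_iff)

locale lepage_sigma_finite = lepage_coded + sigma_finite_measure \<mu>
begin

lemma corr_rectangles:
  assumes R: "off_diagonal_rectangles k \<nu> n R" and "sets \<nu> = sets \<mu>" and S: "S \<in> sets \<mu>"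
  shows "corr (rectangles_value (\<lambda>B. M (B \<inter> S)) k n R)
    (series k (indicator (rectangles_union k n R \<inter> cube k S)))"
proof -
  have sets: "R i r \<inter> S \<in> sets \<mu>" if "i \<in> {1..n}" "r \<in> {1..k}" for i r
    using assms that by (auto simp: off_diagonal_rectangles_def)
  have "corr (\<lambda>w. SUP i\<in>{1..n}. \<Prod>r\<in>{1..k}. M (R i r \<inter> S) w) (\<lambda>x. SUP i\<in>{1..n}. \<Prod>r\<in>{1..k}. mass (R i r \<inter> S) x)"
    by (intro corr_SUP corr_prod corr_basic sets) auto
  moreover have "rectangles_value (\<lambda>B. M (B \<inter> S)) k n R = (\<lambda>w. SUP i\<in>{1..n}. \<Prod>r\<in>{1..k}. M (R i r \<inter> S) w)"
    by (simp add: rectangles_value_def fun_eq_iff)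
  moreover have "series k (indicator (rectangles_union k n R \<inter> cube k S)) = (\<lambda>x. SUP i\<in>{1..n}. \<Prod>r\<in>{1..k}. mass (R i r \<inter> S) x)"
    unfolding rectangles_value_mass[OF R, symmetric] rectangles_value_def ..
  ultimately show ?thesis by simp
qed

text \<open>The rate 2^(-n) makes the errors summable, as \<open>AE_series_vanish\<close> requires.
  The approximation is carried out for \<mu> restricted to \<open>S\<close>, whose k-fold power is
  finite.\<close>

lemma rectangle_approximation:
  assumes S: "S \<in> sets \<mu>" "emeasure \<mu> S < \<infinity>" and A: "A \<in> off_diagonal_sets k \<mu>"
  obtains c R where "\<And>n. off_diagonal_rectangles k (density \<mu> (indicator S)) (c n) (R n)"
    "\<And>n. emeasure (power_measure k (density \<mu> (indicator S)))
       ((rectangles_union k (c n) (R n) - A) \<union> (A - rectangles_union k (c n) (R n))) \<le> ennreal ((1 / 2) ^ n)"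
proof -
  define \<nu> where "\<nu> = density \<mu> (indicator S)"
  have [simp]: "sets \<nu> = sets \<mu>" "space \<nu> = space \<mu>" by (simp_all add: \<nu>_def)
  have power_sets: "sets (power_measure k \<nu>) = sets (power_measure k \<mu>)" by (intro sets_PiM_cong) auto
  have power_space: "space (power_measure k \<nu>) = space (power_measure k \<mu>)" by (simp add: space_PiM)
  interpret \<nu>: coded_space \<nu> \<phi>
  proof
    show "\<phi> \<in> borel_measurable \<nu>" by (subst measurable_cong_sets[of \<nu> \<mu> borel borel]) (simp_all add: code_measurable)
    show "inj_on \<phi> (space \<nu>)" using code_inj by simp
    show "\<phi> y \<in> {0..1}" if "y \<in> space \<nu>" for y using that code_range by simp
  qed
  have od: "off_diagonal k \<nu> = off_diagonal k \<mu>" unfolding off_diagonal_alt power_space ..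
  have A0: "A \<in> sets (power_measure k \<mu>)" "A \<subseteq> off_diagonal k \<mu>"
    using A off_diagonal_sets_iff[OF off_diagonal_in_sets] by auto
  have A': "A \<in> sets (power_measure k \<nu>)" "A \<inter> off_diagonal k \<nu> = A"
    unfolding power_sets od using A0 by auto
  have fin\<nu>: "finite_measure \<nu>"
    using S by (intro finite_measureI) (simp add: \<nu>_def emeasure_density)
  interpret F: finite_measure \<nu> by fact
  interpret product_sigma_finite "\<lambda>_::nat. \<nu>" by standard
  have "finite_measure (power_measure k \<nu>)"
  proof (rule finite_measureI)
    have "space (power_measure k \<nu>) = PiE {1..k} (\<lambda>_. space \<nu>)" by (simp add: space_PiM)
    then have "emeasure (power_measure k \<nu>) (space (power_measure k \<nu>)) = (\<Prod>r\<in>{1..k}. emeasure \<nu> (space \<nu>))"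
      by (simp only:) (rule emeasure_PiM, auto)
    then show "emeasure (power_measure k \<nu>) (space (power_measure k \<nu>)) \<noteq> \<infinity>"
      using F.emeasure_finite by (simp add: ennreal_prod_eq_top power_eq_top_ennreal)
  qed
  note approx = \<nu>.rectangle_unions_approx[OF this A'(1), unfolded A'(2)]
  have "\<exists>c R. off_diagonal_rectangles k \<nu> c R \<and>
    emeasure (power_measure k \<nu>) ((rectangles_union k c R - A) \<union> (A - rectangles_union k c R)) \<le> ennreal ((1 / 2) ^ n)" for n
  proof -
    have "0 < (1 / 2 :: real) ^ n" by simp
    from approx[OF this] obtain U where U: "U \<in> rectangle_unions k \<nu>"
      "emeasure (power_measure k \<nu>) ((U - A) \<union> (A - U)) < ennreal ((1 / 2) ^ n)" by blast
    from U(1) obtain c R where "off_diagonal_rectangles k \<nu> c R" "rectangles_union k c R = U"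
      by (rule rectangle_unionsE)
    then show ?thesis using U(2) by (intro exI[of _ c] exI[of _ R]) simp
  qed
  then obtain c R where "\<And>n. off_diagonal_rectangles k \<nu> (c n) (R n)"
    "\<And>n. emeasure (power_measure k \<nu>) ((rectangles_union k (c n) (R n) - A) \<union> (A - rectangles_union k (c n) (R n))) \<le> ennreal ((1 / 2) ^ n)"
    by metis
  then show thesis unfolding \<nu>_def by (rule that)
qed

text \<open>Off the symmetric difference the two suprema run over the same tuples, so each is at
  most the maximum of the other and of the supremum over that difference.\<close>

lemma series_dist_le:
  assumes "series k (indicator (off_diagonal k \<mu> \<inter> cube k S)) x < \<infinity>" "A \<subseteq> off_diagonal k \<mu>" "U \<subseteq> off_diagonal k \<mu>"
  shows "ennreal_dist (series k (indicator (U \<inter> cube k S)) x) (series k (indicator (A \<inter> cube k S)) x)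
    \<le> series k (indicator (((U - A) \<union> (A - U)) \<inter> cube k S)) x"
proof (rule ennreal_dist_le)
  have le: "series k (indicator (B \<inter> cube k S)) x \<le> series k (indicator (off_diagonal k \<mu> \<inter> cube k S)) x"
    if "B \<subseteq> off_diagonal k \<mu>" for B
    using that by (intro series_mono) (auto simp: indicator_def)
  show "series k (indicator (U \<inter> cube k S)) x < \<infinity>" "series k (indicator (A \<inter> cube k S)) x < \<infinity>"
    using le[OF assms(2)] le[OF assms(3)] assms(1) by (auto intro: le_less_trans)
  show "series k (indicator (U \<inter> cube k S)) x \<le>
    max (series k (indicator (A \<inter> cube k S)) x) (series k (indicator (((U - A) \<union> (A - U)) \<inter> cube k S)) x)"
    unfolding series_max[symmetric] by (intro series_mono) (auto simp: indicator_def)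
  show "series k (indicator (A \<inter> cube k S)) x \<le>
    max (series k (indicator (U \<inter> cube k S)) x) (series k (indicator (((U - A) \<union> (A - U)) \<inter> cube k S)) x)"
    unfolding series_max[symmetric] by (intro series_mono) (auto simp: indicator_def)
qed

text \<open>The candidate X0 comes from one fast approximating sequence and corresponds to the
  series over \<open>A\<close>. Its specification refers to L^\<gamma> distances, which are
  expectations of corresponding variables and can be computed for the series. Any two variables
  meeting the specification agree almost surely.\<close>

lemma corr_product_sup_measure_finite:
  assumes S: "S \<in> sets \<mu>" "emeasure \<mu> S < \<infinity>" and A: "A \<in> off_diagonal_sets k \<mu>"
  shows "corr (product_sup_measure_finite \<alpha> (density \<mu> (indicator S)) P (\<lambda>B. M (B \<inter> S)) k A)
    (series k (indicator (A \<inter> cube k S)))"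
proof -
  let ?\<nu> = "density \<mu> (indicator S)"
  let ?V = "\<lambda>n R. rectangles_value (\<lambda>B. M (B \<inter> S)) k n R"
  let ?U = "rectangles_union k"
  let ?D = "\<lambda>U. (U - A) \<union> (A - U)"
  define spec where "spec X \<longleftrightarrow> X \<in> borel_measurable P \<and>
     (\<forall>c R. (\<forall>n. off_diagonal_rectangles k ?\<nu> (c n) (R n)) \<longrightarrow>
        (\<lambda>n. emeasure (power_measure k ?\<nu>) (?D (?U (c n) (R n)))) \<longlonglongrightarrow> 0 \<longrightarrow>
        (\<forall>\<gamma>. 0 < \<gamma> \<and> \<gamma> < \<alpha> \<longrightarrow> Lp_tendsto P \<gamma> (\<lambda>n. ?V (c n) (R n)) X))" for X
  define Z where "Z = series k (indicator (A \<inter> cube k S))"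
  have A': "A \<in> sets (power_measure k \<mu>)" "A \<subseteq> off_diagonal k \<mu>"
    using A off_diagonal_sets_iff[OF off_diagonal_in_sets] by auto
  have U: "?U n R \<in> sets (power_measure k \<mu>)" "?U n R \<subseteq> off_diagonal k \<mu>"
    if "off_diagonal_rectangles k ?\<nu> n R" for n R
  proof -
    have "off_diagonal_rectangles k \<mu> n R" using that by (simp add: off_diagonal_rectangles_def)
    then have "?U n R \<in> rectangle_unions k \<mu>" by (rule rectangles_union_in)
    then show "?U n R \<in> sets (power_measure k \<mu>)" "?U n R \<subseteq> off_diagonal k \<mu>"
      by (rule rectangle_unions_sets, rule rectangle_unions_off_diagonal)
  qed
  have Z_meas [measurable]: "Z \<in> borel_measurable \<Omega>"
    unfolding Z_def by (intro measurable_series borel_measurable_indicator cube_Int_sets S A')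
  \<comment> \<open>A finite moment of order \<alpha>/2 forces finiteness, without which the
    distances would be infinite.\<close>
  have fin: "AE x in \<Omega>. series k (indicator (off_diagonal k \<mu> \<inter> cube k S)) x < \<infinity>"
  proof -
    have [measurable]: "series k (indicator (off_diagonal k \<mu> \<inter> cube k S)) \<in> borel_measurable \<Omega>"
      by (intro measurable_series borel_measurable_indicator cube_Int_sets S off_diagonal_in_sets)
    have "AE x in \<Omega>. ennreal_powr (series k (indicator (off_diagonal k \<mu> \<inter> cube k S)) x) (\<alpha> / 2) \<noteq> \<infinity>"
      using series_moment[OF S, of "\<alpha> / 2" k] alpha_pos by (intro nn_integral_PInf_AE) auto
    then show ?thesis
    proof eventually_elim
      case (elim x)
      then show ?case
        by (cases "series k (indicator (off_diagonal k \<mu> \<inter> cube k S)) x") (simp_all add: ennreal_powr_def)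
    qed
  qed
  obtain c0 R0 where R0: "\<And>n. off_diagonal_rectangles k ?\<nu> (c0 n) (R0 n)"
    "\<And>n. emeasure (power_measure k ?\<nu>) (?D (?U (c0 n) (R0 n))) \<le> ennreal ((1 / 2) ^ n)"
    by (rule rectangle_approximation[OF S A]) blast
  define V where "V n = ?V (c0 n) (R0 n)" for n
  define Y where "Y n = series k (indicator (?U (c0 n) (R0 n) \<inter> cube k S))" for n
  have VY: "corr (V n) (Y n)" for n unfolding V_def Y_def by (rule corr_rectangles[OF R0(1) _ S(1)]) simp
  \<comment> \<open>The limsup is a measurable functional on every path, also where the sequence
    diverges; almost surely it turns out to be the limit.\<close>
  define X0 where "X0 w = limsup (\<lambda>n. V n w)" for w
  have "AE x in \<Omega>. (\<lambda>n. series k (indicator (?D (?U (c0 n) (R0 n)) \<inter> cube k S)) x) \<longlonglongrightarrow> 0"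
  proof (rule AE_series_vanish[OF S])
    show "?D (?U (c0 n) (R0 n)) \<in> sets (power_measure k \<mu>)" for n using U(1)[OF R0(1)] A'(1) by auto
    have "(\<Sum>n. emeasure (power_measure k ?\<nu>) (?D (?U (c0 n) (R0 n)))) \<le> (\<Sum>n. ennreal ((1 / 2) ^ n))"
      by (intro suminf_le R0) auto
    also have "\<dots> < \<infinity>" by (simp add: suminf_ennreal2 summable_geometric)
    finally show "(\<Sum>n. emeasure (power_measure k ?\<nu>) (?D (?U (c0 n) (R0 n)))) < \<infinity>" .
  qed
  with fin have lim: "AE x in \<Omega>. (\<lambda>n. Y n x) \<longlonglongrightarrow> Z x"
  proof eventually_elim
    case (elim x)
    have "(\<lambda>n. ennreal_dist (Y n x) (Z x)) \<longlonglongrightarrow> 0"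
    proof (rule tendsto_sandwich[OF _ _ tendsto_const elim(2)])
      show "\<forall>\<^sub>F n in sequentially. ennreal_dist (Y n x) (Z x) \<le> series k (indicator (?D (?U (c0 n) (R0 n)) \<inter> cube k S)) x"
        unfolding Y_def Z_def using series_dist_le[OF elim(1) A'(2) U(2)[OF R0(1)]] by simp
    qed simp
    moreover have "Z x < \<infinity>"
    proof -
      have "Z x \<le> series k (indicator (off_diagonal k \<mu> \<inter> cube k S)) x"
        unfolding Z_def using A'(2) by (intro series_mono) (auto simp: indicator_def)
      then show ?thesis using elim(1) by (rule le_less_trans)
    qed
    ultimately show ?case by (rule ennreal_tendsto_of_dist)
  qed
  have XL: "corr X0 (\<lambda>x. limsup (\<lambda>n. Y n x))"
    unfolding X0_def[abs_def] by (rule corr_compose[where \<Theta> = limsup, OF VY]) measurable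
  have XZ: "corr X0 Z"
  proof (rule corr_AE_cong[OF XL])
    show "AE x in \<Omega>. Z x = limsup (\<lambda>n. Y n x)"
      using lim by eventually_elim (simp add: lim_imp_Limsup)
  qed (use corr_measurable[OF XL] Z_meas in auto)
  have "spec X0"
    unfolding spec_def
  proof (intro conjI allI impI)
    show "X0 \<in> borel_measurable P" by (rule corr_measurable[OF XL])
    fix c R \<gamma> assume R: "\<forall>n. off_diagonal_rectangles k ?\<nu> (c n) (R n)"
      and conv: "(\<lambda>n. emeasure (power_measure k ?\<nu>) (?D (?U (c n) (R n)))) \<longlonglongrightarrow> 0"
      and \<gamma>: "0 < \<gamma> \<and> \<gamma> < \<alpha>"
    have eq: "(\<integral>\<^sup>+w. ennreal_powr (ennreal_dist (?V (c n) (R n) w) (X0 w)) \<gamma> \<partial>P) =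
      (\<integral>\<^sup>+x. ennreal_powr (ennreal_dist (series k (indicator (?U (c n) (R n) \<inter> cube k S)) x) (Z x)) \<gamma> \<partial>\<Omega>)" for n
      by (rule corr_nn_integral)
         (rule corr_compose1[OF corr_compose2[OF corr_rectangles[OF R[rule_format] sets_density S(1)] XZ measurable_ennreal_dist]
            measurable_ennreal_powr])
    \<comment> \<open>For an arbitrary admissible sequence the errors merely tend to 0, so
      convergence of moments takes the place of almost sure convergence.\<close>
    have small: "(\<lambda>n. \<integral>\<^sup>+x. ennreal_powr (series k (indicator (?D (?U (c n) (R n)) \<inter> cube k S)) x) \<gamma> \<partial>\<Omega>) \<longlonglongrightarrow> 0"
    proof (rule Lp_series_vanish[OF S _ _ _ _ conv])
      show "?D (?U (c n) (R n)) \<in> sets (power_measure k \<mu>)" for n using U(1) R A'(1) by blast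
      show "?D (?U (c n) (R n)) \<subseteq> off_diagonal k \<mu>" for n using U(2) R A'(2) by blast
    qed (use \<gamma> in auto)
    have le: "(\<integral>\<^sup>+x. ennreal_powr (ennreal_dist (series k (indicator (?U (c n) (R n) \<inter> cube k S)) x) (Z x)) \<gamma> \<partial>\<Omega>) \<le>
      (\<integral>\<^sup>+x. ennreal_powr (series k (indicator (?D (?U (c n) (R n)) \<inter> cube k S)) x) \<gamma> \<partial>\<Omega>)" for n
    proof (rule nn_integral_mono_AE)
      show "AE x in \<Omega>. ennreal_powr (ennreal_dist (series k (indicator (?U (c n) (R n) \<inter> cube k S)) x) (Z x)) \<gamma> \<le>
        ennreal_powr (series k (indicator (?D (?U (c n) (R n)) \<inter> cube k S)) x) \<gamma>"
        using fin
      proof eventually_elim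
        case (elim x)
        show ?case
          unfolding Z_def
          by (rule ennreal_powr_mono[OF conjunct1[OF \<gamma>] series_dist_le[OF elim A'(2) U(2)[OF R[rule_format]]]])
      qed
    qed
    have "(\<lambda>n. \<integral>\<^sup>+w. ennreal_powr (ennreal_dist (?V (c n) (R n) w) (X0 w)) \<gamma> \<partial>P) \<longlonglongrightarrow> 0"
      unfolding eq
    proof (rule tendsto_sandwich[OF _ _ tendsto_const small])
      show "\<forall>\<^sub>F n in sequentially. (\<integral>\<^sup>+x. ennreal_powr (ennreal_dist (series k (indicator (?U (c n) (R n) \<inter> cube k S)) x) (Z x)) \<gamma> \<partial>\<Omega>) \<le>
        (\<integral>\<^sup>+x. ennreal_powr (series k (indicator (?D (?U (c n) (R n)) \<inter> cube k S)) x) \<gamma> \<partial>\<Omega>)"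
        using le by (rule always_eventually[OF allI])
    qed (rule always_eventually, simp)
    then show "Lp_tendsto P \<gamma> (\<lambda>n. ?V (c n) (R n)) X0"
      by (simp add: Lp_tendsto_def ennreal_dist_def)
  qed
  define X1 where "X1 = product_sup_measure_finite \<alpha> ?\<nu> P (\<lambda>B. M (B \<inter> S)) k A"
  have "X1 = (SOME X. spec X)" by (simp add: X1_def product_sup_measure_finite_def spec_def)
  then have spec1: "spec X1" using someI[of spec, OF \<open>spec X0\<close>] by (simp only:)
  note [measurable] = corr_measurable(1)[OF XL] corr_measurable(1)[OF VY]
  have X1_meas [measurable]: "X1 \<in> borel_measurable P" using spec1 by (simp add: spec_def)
  have conv0: "(\<lambda>n. emeasure (power_measure k ?\<nu>) (?D (?U (c0 n) (R0 n)))) \<longlonglongrightarrow> 0"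
  proof (rule tendsto_sandwich[OF _ _ tendsto_const])
    show "\<forall>\<^sub>F n in sequentially. emeasure (power_measure k ?\<nu>) (?D (?U (c0 n) (R0 n))) \<le> ennreal ((1 / 2) ^ n)"
      using R0(2) by simp
    show "(\<lambda>n. ennreal ((1 / 2) ^ n)) \<longlonglongrightarrow> 0"
      by (subst ennreal_0[symmetric], intro tendsto_ennrealI LIMSEQ_power_zero) simp
  qed simp
  \<comment> \<open>One exponent in (0, \<alpha>) is enough to identify the limit.\<close>
  define \<gamma> where "\<gamma> = \<alpha> / 2"
  have \<gamma>: "0 < \<gamma>" "\<gamma> < \<alpha>" using alpha_pos by (auto simp: \<gamma>_def)
  have tends: "(\<lambda>n. \<integral>\<^sup>+w. ennreal_powr (ennreal_dist (V n w) (X w)) \<gamma> \<partial>P) \<longlonglongrightarrow> 0" if "spec X" for X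
    using that R0(1) conv0 \<gamma> unfolding spec_def Lp_tendsto_def V_def ennreal_dist_def by blast
  \<comment> \<open>X1 and X0 are limits of the same V n, so the quasi-triangle inequality bounds
    their distance by a null sequence.\<close>
  have "(\<integral>\<^sup>+w. ennreal_powr (ennreal_dist (X1 w) (X0 w)) \<gamma> \<partial>P) \<le> 0"
  proof (rule LIMSEQ_le_const)
    show "(\<lambda>n. ennreal (2 powr \<gamma>) * ((\<integral>\<^sup>+w. ennreal_powr (ennreal_dist (V n w) (X1 w)) \<gamma> \<partial>P) +
      (\<integral>\<^sup>+w. ennreal_powr (ennreal_dist (V n w) (X0 w)) \<gamma> \<partial>P))) \<longlonglongrightarrow> 0"
      using ennreal_tendsto_cmult[OF _ tendsto_add[OF tends[OF spec1] tends[OF \<open>spec X0\<close>]], of "ennreal (2 powr \<gamma>)"] by simp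
    have "(\<integral>\<^sup>+w. ennreal_powr (ennreal_dist (X1 w) (X0 w)) \<gamma> \<partial>P) \<le>
      ennreal (2 powr \<gamma>) * ((\<integral>\<^sup>+w. ennreal_powr (ennreal_dist (V n w) (X1 w)) \<gamma> \<partial>P) +
      (\<integral>\<^sup>+w. ennreal_powr (ennreal_dist (V n w) (X0 w)) \<gamma> \<partial>P))" for n
    proof -
      have "(\<integral>\<^sup>+w. ennreal_powr (ennreal_dist (X1 w) (X0 w)) \<gamma> \<partial>P) \<le>
        (\<integral>\<^sup>+w. ennreal (2 powr \<gamma>) * (ennreal_powr (ennreal_dist (V n w) (X1 w)) \<gamma> + ennreal_powr (ennreal_dist (V n w) (X0 w)) \<gamma>) \<partial>P)"
        by (intro nn_integral_mono order_trans[OF ennreal_powr_mono[OF \<gamma>(1) ennreal_dist_triangle] ennreal_powr_add_le] \<gamma>)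
      also have "\<dots> = ennreal (2 powr \<gamma>) * ((\<integral>\<^sup>+w. ennreal_powr (ennreal_dist (V n w) (X1 w)) \<gamma> \<partial>P) +
        (\<integral>\<^sup>+w. ennreal_powr (ennreal_dist (V n w) (X0 w)) \<gamma> \<partial>P))"
        by (simp add: nn_integral_cmult nn_integral_add)
      finally show ?thesis .
    qed
    then show "\<exists>N. \<forall>n\<ge>N. (\<integral>\<^sup>+w. ennreal_powr (ennreal_dist (X1 w) (X0 w)) \<gamma> \<partial>P) \<le>
      ennreal (2 powr \<gamma>) * ((\<integral>\<^sup>+w. ennreal_powr (ennreal_dist (V n w) (X1 w)) \<gamma> \<partial>P) +
      (\<integral>\<^sup>+w. ennreal_powr (ennreal_dist (V n w) (X0 w)) \<gamma> \<partial>P))" by blast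
  qed
  then have "AE w in P. ennreal_powr (ennreal_dist (X1 w) (X0 w)) \<gamma> = 0"
    by (subst nn_integral_0_iff_AE[symmetric]) auto
  then have eq: "AE w in P. X1 w = X0 w"
  proof eventually_elim
    case (elim w)
    then have "ennreal_dist (X1 w) (X0 w) \<le> ennreal_powr 0 (1 / \<gamma>)"
      using \<gamma> by (subst ennreal_powr_le_iff[symmetric]) auto
    then have "ennreal_dist (X1 w) (X0 w) = 0" using \<gamma> by (simp add: ennreal_powr_0)
    then show ?case by (rule ennreal_dist_eq_0)
  qed
  show ?thesis
    using corr_AE_cong[OF XZ eq _ X1_meas Z_meas] by (simp add: X1_def Z_def)
qed

lemma exhausting_exists:
  assumes "emeasure \<mu> (space \<mu>) \<noteq> 0" obtains S where "exhausting_sequence \<mu> S"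
proof -
  obtain A :: "nat \<Rightarrow> 'a set" where A: "range A \<subseteq> sets \<mu>" "(\<Union>i. A i) = space \<mu>" "\<And>i. emeasure \<mu> (A i) \<noteq> \<infinity>" "incseq A"
    by (rule sigma_finite_incseq) blast
  have "(SUP i. emeasure \<mu> (A i)) = emeasure \<mu> (space \<mu>)"
    using SUP_emeasure_incseq[OF A(1,4)] A(2) by simp
  then have "0 < (SUP i. emeasure \<mu> (A i))" using assms by (simp add: zero_less_iff_neq_zero)
  then obtain N where N: "0 < emeasure \<mu> (A N)" by (auto simp: less_SUP_iff)
  \<comment> \<open>Dropping the first N sets gives every member positive measure.\<close>
  have "exhausting_sequence \<mu> (\<lambda>n. A (n + N))"
    unfolding exhausting_sequence_def
  proof (intro conjI allI)
    show "range (\<lambda>n. A (n + N)) \<subseteq> sets \<mu>" using A(1) by auto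
    show "incseq (\<lambda>n. A (n + N))" using A(4) by (auto simp: incseq_def)
    show "(\<Union>n. A (n + N)) = space \<mu>"
    proof -
      have "A i \<subseteq> A (i + N)" for i using A(4) by (auto simp: incseq_def)
      then show ?thesis unfolding A(2)[symmetric] by blast
    qed
    fix n
    have "A N \<subseteq> A (n + N)" using A(4) by (auto simp: incseq_def)
    then have "emeasure \<mu> (A N) \<le> emeasure \<mu> (A (n + N))" using A(1) by (intro emeasure_mono) auto
    then show "0 < emeasure \<mu> (A (n + N))" using N by (rule less_le_trans[rotated])
    show "emeasure \<mu> (A (n + N)) < \<infinity>" using A(3)[of "n + N"] by (simp add: less_top)
  qed
  then show thesis by (rule that)
qed

text \<open>Every exhausting sequence leads to the same series, since a point of \<open>A\<close>
  has finitely many coordinates and thus lies in all late cubes. Suprema along different exhaustions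
  correspond to one variable on \<Omega> and therefore agree almost surely.\<close>

lemma corr_product_sup_measure:
  assumes nonzero: "emeasure \<mu> (space \<mu>) \<noteq> 0" and A: "A \<in> off_diagonal_sets k \<mu>"
  shows "corr (product_sup_measure \<alpha> \<mu> P M k A) (series k (indicator A))"
proof -
  let ?X = "\<lambda>S w. SUP n. product_sup_measure_finite \<alpha> (density \<mu> (indicator (S n))) P (\<lambda>B. M (B \<inter> S n)) k A w"
  define spec where "spec X \<longleftrightarrow> X \<in> borel_measurable P \<and>
    (\<forall>S. exhausting_sequence \<mu> S \<longrightarrow> (AE w in P. X w = ?X S w))" for X
  have A': "A \<in> sets (power_measure k \<mu>)" "A \<subseteq> off_diagonal k \<mu>"
    using A off_diagonal_sets_iff[OF off_diagonal_in_sets] by auto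
  have X: "corr (?X S) (series k (indicator A))" if S: "exhausting_sequence \<mu> S" for S
  proof -
    have S': "S n \<in> sets \<mu>" "emeasure \<mu> (S n) < \<infinity>" for n using S by (auto simp: exhausting_sequence_def)
    have inc: "incseq S" and un: "(\<Union>n. S n) = space \<mu>" using S by (auto simp: exhausting_sequence_def)
    have "corr (?X S) (\<lambda>x. SUP n. series k (indicator (A \<inter> cube k (S n))) x)"
      by (intro corr_SUP corr_product_sup_measure_finite S' A) auto
    moreover have "(\<lambda>u. indicator A u :: ennreal) = (\<lambda>u. SUP n. indicator (A \<inter> cube k (S n)) u)"
    proof
      fix u
      show "(indicator A u :: ennreal) = (SUP n. indicator (A \<inter> cube k (S n)) u)"
      proof (cases "u \<in> A")
        case True
        then have "u \<in> space (power_measure k \<mu>)" using sets.sets_into_space[OF A'(1)] by auto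
        then have "u r \<in> (\<Union>n. S n)" if "r \<in> {1..k}" for r using that by (auto simp: un space_PiM)
        then have "\<exists>N. u r \<in> S N" if "r \<in> {1..k}" for r using that by blast
        then have "\<forall>\<^sub>F n in sequentially. u r \<in> S n" if r: "r \<in> {1..k}" for r
        proof -
          obtain N where "u r \<in> S N" using \<open>\<And>r. r \<in> {1..k} \<Longrightarrow> \<exists>N. u r \<in> S N\<close>[OF r] by blast
          then have "u r \<in> S n" if "N \<le> n" for n using incseqD[OF inc that] by blast
          then show ?thesis by (auto simp: eventually_sequentially)
        qed
        then have "\<forall>\<^sub>F n in sequentially. \<forall>r\<in>{1..k}. u r \<in> S n" by (intro eventually_ball_finite) auto
        then obtain n where "u \<in> cube k (S n)" by (auto simp: cube_def eventually_sequentially)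
        then show ?thesis using True
          by (intro antisym SUP_least) (auto intro!: SUP_upper2[of n] simp: indicator_def)
      qed (simp add: bot_ennreal)
    qed
    then have "series k (indicator A) = (\<lambda>x. SUP n. series k (indicator (A \<inter> cube k (S n))) x)"
      by (intro ext) (subst series_SUP[symmetric], simp only:)
    ultimately show ?thesis by simp
  qed
  obtain S0 where S0: "exhausting_sequence \<mu> S0" by (rule exhausting_exists[OF nonzero])
  have "spec (?X S0)"
    unfolding spec_def
  proof (intro conjI allI impI)
    show "?X S0 \<in> borel_measurable P" by (rule corr_measurable[OF X[OF S0]])
    fix S assume "exhausting_sequence \<mu> S"
    then show "AE w in P. ?X S0 w = ?X S w"
      by (intro corr_AE2[OF X[OF S0] X, where R = "(=)"]) auto
  qed
  define X1 where "X1 = product_sup_measure \<alpha> \<mu> P M k A"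
  have "X1 = (SOME X. spec X)" by (simp add: X1_def product_sup_measure_def spec_def)
  then have spec1: "spec X1" using someI[of spec, OF \<open>spec (?X S0)\<close>] by (simp only:)
  then have "AE w in P. X1 w = ?X S0 w" "X1 \<in> borel_measurable P" using S0 by (auto simp: spec_def)
  then show ?thesis
    using corr_AE_cong[OF X[OF S0], of X1] corr_measurable(2)[OF X[OF S0]] by (simp add: X1_def)
qed

end

section \<open>Versions of the integral\<close>

text \<open>The sets are the level sets of the nonzero values: coefficients must be positive, and a
  point where h is positive lies off the diagonals.\<close>

lemma simple_representation_exists:
  assumes h: "simple_function (power_measure k \<mu>) h" and fin: "\<And>x. h x < \<top>"
    and diag: "\<And>x. x \<in> diagonals k \<mu> \<Longrightarrow> h x = 0"
  shows "\<exists>N a A. simple_representation k \<mu> N a A \<and>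
    (\<forall>x\<in>space (power_measure k \<mu>). simple_value N a A x = h x)"
proof -
  let ?X = "space (power_measure k \<mu>)"
  define W where "W = h ` ?X - {0}"
  have finW: "finite W" using h by (simp add: W_def simple_function_def)
  obtain g where g: "bij_betw g {1..card W} W" using ex_bij_betw_nat_finite_1[OF finW] by blast
  have gW: "g i \<in> W" if "i \<in> {1..card W}" for i using g that by (auto simp: bij_betw_def)
  define a where "a i = enn2real (g i)" for i
  define A where "A i = h -` {g i} \<inter> ?X" for i
  have g_fin: "g i < \<top>" "0 < g i" if "i \<in> {1..card W}" for i
    using gW[OF that] fin by (auto simp: W_def zero_less_iff_neq_zero)
  have ag: "ennreal (a i) = g i" if "i \<in> {1..card W}" for i using g_fin[OF that] by (simp add: a_def)
  have "simple_representation k \<mu> (card W) a A"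
    unfolding simple_representation_def
  proof (intro conjI ballI)
    fix i assume i: "i \<in> {1..card W}"
    show "0 < a i" using g_fin[OF i] by (simp add: a_def enn2real_positive_iff)
    have "A i \<in> sets (power_measure k \<mu>)"
      unfolding A_def using simple_functionD(2)[OF h] .
    moreover have "A i = A i \<inter> (?X - diagonals k \<mu>)"
      using diag g_fin(2)[OF i] by (auto simp: A_def)
    ultimately show "A i \<in> off_diagonal_sets k \<mu>" unfolding off_diagonal_sets_def by (rule rev_image_eqI)
  next
    show "disjoint_family_on A {1..card W}"
      unfolding disjoint_family_on_def
    proof (intro ballI impI)
      fix i j assume "i \<in> {1..card W}" "j \<in> {1..card W}" "i \<noteq> j"
      then have "g i \<noteq> g j" using g by (auto simp: bij_betw_def dest: inj_onD)
      then show "A i \<inter> A j = {}" by (auto simp: A_def)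
    qed
  qed
  moreover have "simple_value (card W) a A x = h x" if x: "x \<in> ?X" for x
  proof -
    have "simple_value (card W) a A x = (\<Sum>i\<in>{1..card W}. g i * (if h x = g i then 1 else 0))"
      unfolding simple_value_def using x by (intro sum.cong) (auto simp: ag A_def indicator_def)
    also have "\<dots> = (\<Sum>w\<in>W. w * (if h x = w then 1 else 0))"
      using g by (rule sum.reindex_bij_betw)
    also have "\<dots> = (\<Sum>w\<in>W. if h x = w then w else 0)" by (intro sum.cong) auto
    also have "\<dots> = (if h x \<in> W then h x else 0)" using finW by (rule sum.delta')
    also have "\<dots> = h x" using x by (auto simp: W_def)
    finally show ?thesis .
  qed
  ultimately show ?thesis by blast
qed

text \<open>By disjointness at most one summand is nonzero, so the sum is a maximum and passes
  through the series.\<close>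

lemma simple_value_SUP:
  assumes "simple_representation k \<mu> N a A"
  shows "simple_value N a A x = (SUP i\<in>{1..N}. ennreal (a i) * indicator (A i) x)"
proof (cases "\<exists>i\<in>{1..N}. x \<in> A i")
  case True
  then obtain i where i: "i \<in> {1..N}" "x \<in> A i" by blast
  have other: "x \<notin> A j" if "j \<in> {1..N}" "j \<noteq> i" for j
    using assms i that unfolding simple_representation_def disjoint_family_on_def by blast
  have "simple_value N a A x = (\<Sum>j\<in>{1..N}. if i = j then ennreal (a j) else 0)"
    unfolding simple_value_def using i other by (intro sum.cong) (auto simp: indicator_def)
  also have "\<dots> = ennreal (a i)" using i by simp
  also have "\<dots> = (SUP j\<in>{1..N}. ennreal (a j) * indicator (A j) x)"
  proof (rule antisym)
    show "ennreal (a i) \<le> (SUP j\<in>{1..N}. ennreal (a j) * indicator (A j) x)"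
      using i by (intro SUP_upper2[of i]) auto
    show "(SUP j\<in>{1..N}. ennreal (a j) * indicator (A j) x) \<le> ennreal (a i)"
    proof (rule SUP_least)
      fix j assume "j \<in> {1..N}"
      then show "ennreal (a j) * indicator (A j) x \<le> ennreal (a i)" using other by (cases "j = i") (auto simp: indicator_def)
    qed
  qed
  finally show ?thesis .
next
  case False
  then have "simple_value N a A x = 0" unfolding simple_value_def by (intro sum.neutral) auto
  moreover have "(SUP i\<in>{1..N}. ennreal (a i) * indicator (A i) x) \<le> 0" using False by (intro SUP_least) auto
  ultimately show ?thesis by simp
qed

section \<open>Correspondence of the integral with the series\<close>

locale extremal_integration = lepage_sigma_finite +
  assumes nonzero: "emeasure \<mu> (space \<mu>) \<noteq> 0"
begin

lemma corr_simple:
  assumes rep: "simple_representation k \<mu> N a A"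
  shows "corr (simple_extremal_integral \<alpha> \<mu> P M k N a A) (series k (simple_value N a A))"
proof -
  have A: "A i \<in> off_diagonal_sets k \<mu>" if "i \<in> {1..N}" for i
    using rep that by (simp add: simple_representation_def)
  have "corr (\<lambda>w. SUP i\<in>{1..N}. ennreal (a i) * product_sup_measure \<alpha> \<mu> P M k (A i) w)
    (\<lambda>x. SUP i\<in>{1..N}. ennreal (a i) * series k (indicator (A i)) x)"
  proof (rule corr_SUP)
    fix i assume "i \<in> {1..N}"
    then show "corr (\<lambda>w. ennreal (a i) * product_sup_measure \<alpha> \<mu> P M k (A i) w) (\<lambda>x. ennreal (a i) * series k (indicator (A i)) x)"
      by (intro corr_compose1[OF corr_product_sup_measure[OF nonzero A], where f = "\<lambda>y. ennreal (a i) * y"]) auto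
  qed auto
  moreover have "simple_extremal_integral \<alpha> \<mu> P M k N a A = (\<lambda>w. SUP i\<in>{1..N}. ennreal (a i) * product_sup_measure \<alpha> \<mu> P M k (A i) w)"
    by (simp add: simple_extremal_integral_def fun_eq_iff)
  moreover have "series k (simple_value N a A) = (\<lambda>x. SUP i\<in>{1..N}. ennreal (a i) * series k (indicator (A i)) x)"
  proof
    fix x
    have "simple_value N a A = (\<lambda>u. SUP i\<in>{1..N}. ennreal (a i) * indicator (A i) u)"
      using simple_value_SUP[OF rep] by (rule ext)
    then show "series k (simple_value N a A) x = (SUP i\<in>{1..N}. ennreal (a i) * series k (indicator (A i)) x)"
      by (simp only: series_SUP series_cmult)
  qed
  ultimately show ?thesis by simp
qed

lemma marks_in_space: "x \<in> space \<Omega> \<Longrightarrow> marks k j x \<in> space (power_measure k \<mu>)"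
  by (auto simp: marks_def space_PiM mark_in_space)

lemma AE_all_marks:
  assumes "AE u in power_measure k \<mu>. R u" shows "AE x in \<Omega>. \<forall>j\<in>tuples k. R (marks k j x)"
  using AE_marks_mu[OF sigma_finite_measure_axioms _ assms]
  by (subst AE_ball_countable[OF countable_tuples]) blast

text \<open>An increasing limit is a supremum, which the series preserves. The almost everywhere
  hypothesis is evaluated only at the countably many tuples of marks.\<close>

lemma AE_series_tendsto:
  assumes mono: "\<And>n x. x \<in> space (power_measure k \<mu>) \<Longrightarrow> s n x \<le> s (Suc n) x"
    and lim: "AE u in power_measure k \<mu>. (\<lambda>n. s n u) \<longlonglongrightarrow> f u"
  shows "AE x in \<Omega>. (\<lambda>n. series k (s n) x) \<longlonglongrightarrow> series k f x"
  using AE_all_marks[OF lim] AE_space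
proof eventually_elim
  case (elim x)
  have inc: "incseq (\<lambda>n. s n (marks k j x))" for j
    using mono[OF marks_in_space[OF elim(2)]] by (rule incseq_SucI)
  have "f (marks k j x) = (SUP n. s n (marks k j x))" if "j \<in> tuples k" for j
    using LIMSEQ_unique[OF bspec[OF elim(1) that] LIMSEQ_SUP[OF inc]] .
  then have "series k f x = series k (\<lambda>u. SUP n. s n u) x" by (rule series_cong)
  also have "\<dots> = (SUP n. series k (s n) x)" by (rule series_SUP)
  finally have "series k f x = (SUP n. series k (s n) x)" .
  moreover have "incseq (\<lambda>n. series k (s n) x)"
    by (intro incseq_SucI series_mono mono marks_in_space elim)
  ultimately show ?case using LIMSEQ_SUP by metis
qed

text \<open>The scheme of the product sup measure again, with limits of increasing simple functions.
  That another approximating sequence converges to the candidate is a property of all these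
  variables together, so it transfers through their joint law.\<close>

lemma corr_extremal_integral:
  assumes f: "f \<in> integrand_class k \<mu>"
  shows "corr (extremal_integral \<alpha> \<mu> P M k f) (series k f)"
proof -
  let ?E = "power_measure k \<mu>"
  let ?I = "\<lambda>N a A. simple_extremal_integral \<alpha> \<mu> P M k N a A"
  define spec where "spec X \<longleftrightarrow> X \<in> borel_measurable P \<and>
       (\<forall>N a A.
          (\<forall>n. simple_representation k \<mu> (N n) (a n) (A n)) \<longrightarrow>
          (\<forall>n. \<forall>x\<in>space ?E. simple_value (N n) (a n) (A n) x \<le> simple_value (N (Suc n)) (a (Suc n)) (A (Suc n)) x) \<longrightarrow>
          (AE x in ?E. (\<lambda>n. simple_value (N n) (a n) (A n) x) \<longlonglongrightarrow> f x) \<longrightarrow>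
          (AE w in P. (\<lambda>n. ?I (N n) (a n) (A n) w) \<longlonglongrightarrow> X w))" for X
  have f_meas: "f \<in> borel_measurable ?E" and f_diag: "\<And>x. x \<in> diagonals k \<mu> \<Longrightarrow> f x = 0"
    using f by (auto simp: integrand_class_def)
  have S_meas [measurable]: "series k f \<in> borel_measurable \<Omega>" by (rule measurable_series[OF f_meas])
  obtain h where h: "\<And>n. simple_function ?E (h n)" "incseq h" "\<And>n x. h n x < \<top>" "\<And>x. (SUP n. h n x) = f x"
    by (rule borel_measurable_implies_simple_function_sequence'[OF f_meas]) blast
  have "\<exists>N a A. simple_representation k \<mu> N a A \<and> (\<forall>x\<in>space ?E. simple_value N a A x = h n x)" for n
  proof (rule simple_representation_exists[OF h(1,3)])
    fix x assume "x \<in> diagonals k \<mu>"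
    then have "h n x \<le> 0" using SUP_upper[of n UNIV "\<lambda>n. h n x"] f_diag by (simp add: h(4))
    then show "h n x = 0" by simp
  qed
  then obtain N0 a0 A0 where rep0: "\<And>n. simple_representation k \<mu> (N0 n) (a0 n) (A0 n)"
    and val0: "\<And>n x. x \<in> space ?E \<Longrightarrow> simple_value (N0 n) (a0 n) (A0 n) x = h n x" by metis
  have mono0: "simple_value (N0 n) (a0 n) (A0 n) x \<le> simple_value (N0 (Suc n)) (a0 (Suc n)) (A0 (Suc n)) x"
    if "x \<in> space ?E" for n x
    using h(2) that by (simp add: val0 incseq_Suc_iff le_fun_def)
  have lim0: "AE x in ?E. (\<lambda>n. simple_value (N0 n) (a0 n) (A0 n) x) \<longlonglongrightarrow> f x"
  proof (rule AE_I2)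
    fix x assume x: "x \<in> space ?E"
    have "incseq (\<lambda>n. h n x)" using h(2) by (auto simp: incseq_def le_fun_def)
    then have "(\<lambda>n. h n x) \<longlonglongrightarrow> f x" using LIMSEQ_SUP[of "\<lambda>n. h n x"] by (simp add: h(4))
    then show "(\<lambda>n. simple_value (N0 n) (a0 n) (A0 n) x) \<longlonglongrightarrow> f x" by (simp add: val0[OF x])
  qed
  define X0 where "X0 w = limsup (\<lambda>n. ?I (N0 n) (a0 n) (A0 n) w)" for w
  have XL: "corr X0 (\<lambda>x. limsup (\<lambda>n. series k (simple_value (N0 n) (a0 n) (A0 n)) x))"
    unfolding X0_def[abs_def] by (rule corr_compose[where \<Theta> = limsup, OF corr_simple[OF rep0]]) measurable
  have XZ: "corr X0 (series k f)"
  proof (rule corr_AE_cong[OF XL])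
    show "AE x in \<Omega>. series k f x = limsup (\<lambda>n. series k (simple_value (N0 n) (a0 n) (A0 n)) x)"
      using AE_series_tendsto[of k "\<lambda>n. simple_value (N0 n) (a0 n) (A0 n)" f, OF _ lim0] mono0
      by (auto elim!: eventually_mono simp: lim_imp_Limsup)
  qed (use corr_measurable[OF XL] S_meas in auto)
  have "spec X0"
    unfolding spec_def
  proof (intro conjI allI impI)
    show "X0 \<in> borel_measurable P" by (rule corr_measurable[OF XL])
    fix N a A assume rep: "\<forall>n. simple_representation k \<mu> (N n) (a n) (A n)"
      and mono: "\<forall>n. \<forall>x\<in>space ?E. simple_value (N n) (a n) (A n) x \<le> simple_value (N (Suc n)) (a (Suc n)) (A (Suc n)) x"
      and lim: "AE x in ?E. (\<lambda>n. simple_value (N n) (a n) (A n) x) \<longlonglongrightarrow> f x"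
    \<comment> \<open>Convergence of y 1, y 2, ... to y 0, written with limsup and liminf so that it
      is visibly measurable.\<close>
    define R where "R y \<longleftrightarrow> limsup (\<lambda>n. y (Suc n)) = y 0 \<and> liminf (\<lambda>n. y (Suc n)) = y 0" for y :: "nat \<Rightarrow> ennreal"
    have R_iff: "R y \<longleftrightarrow> (\<lambda>n. y (Suc n)) \<longlonglongrightarrow> y 0" for y
      unfolding R_def by (subst tendsto_iff_Liminf_eq_Limsup) auto
    have R_meas: "Measurable.pred (PiM UNIV (\<lambda>_. borel)) R"
    proof -
      have m12: "(\<lambda>y :: nat \<Rightarrow> ennreal. limsup (\<lambda>n. y (Suc n))) \<in> borel_measurable (PiM UNIV (\<lambda>_. borel))"
        "(\<lambda>y :: nat \<Rightarrow> ennreal. liminf (\<lambda>n. y (Suc n))) \<in> borel_measurable (PiM UNIV (\<lambda>_. borel))"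
        by (intro borel_measurable_limsup borel_measurable_liminf measurable_component_singleton, simp)+
      have m3: "(\<lambda>y :: nat \<Rightarrow> ennreal. y 0) \<in> borel_measurable (PiM UNIV (\<lambda>_. borel))"
        by (rule measurable_component_singleton) simp
      show ?thesis
        unfolding R_def order.eq_iff pred_def
        by (intro sets.sets_Collect_conj borel_measurable_le m12 m3)
    qed
    \<comment> \<open>Component 0 carries the candidate limit, the later components the
      approximations.\<close>
    define X where "X n = (case n of 0 \<Rightarrow> X0 | Suc n \<Rightarrow> ?I (N n) (a n) (A n))" for n
    define Z where "Z n = (case n of 0 \<Rightarrow> series k f | Suc n \<Rightarrow> series k (simple_value (N n) (a n) (A n)))" for n
    have "AE w in P. R (\<lambda>n. X n w)"
    proof (rule corr_AE[OF _ R_meas])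
      show "corr (X n) (Z n)" for n using XZ corr_simple rep by (cases n) (auto simp: X_def Z_def)
      show "AE x in \<Omega>. R (\<lambda>n. Z n x)"
        using AE_series_tendsto[of k "\<lambda>n. simple_value (N n) (a n) (A n)" f] mono lim by (simp add: R_iff Z_def)
    qed
    then show "AE w in P. (\<lambda>n. ?I (N n) (a n) (A n) w) \<longlonglongrightarrow> X0 w" by (simp add: R_iff X_def)
  qed
  define X1 where "X1 = extremal_integral \<alpha> \<mu> P M k f"
  have "X1 = (SOME X. spec X)" by (simp add: X1_def extremal_integral_def spec_def)
  then have spec1: "spec X1" using someI[of spec, OF \<open>spec X0\<close>] by (simp only:)
  have tends: "AE w in P. (\<lambda>n. ?I (N0 n) (a0 n) (A0 n) w) \<longlonglongrightarrow> X w" if "spec X" for X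
    using that rep0 mono0 lim0 unfolding spec_def by blast
  have "AE w in P. X1 w = X0 w"
    using tends[OF spec1] tends[OF \<open>spec X0\<close>] by eventually_elim (rule LIMSEQ_unique)
  moreover have "X1 \<in> borel_measurable P" using spec1 by (simp add: spec_def)
  ultimately show ?thesis using corr_AE_cong[OF XZ, of X1 "series k f"] S_meas by (simp add: X1_def)
qed

text \<open>For the series the identity holds on every path, and both sides are measurable
  functionals of corresponding variables.\<close>

lemma integral_max_linear:
  assumes "f \<in> integrand_class k \<mu>" "g \<in> integrand_class k \<mu>"
  shows "AE w in P. extremal_integral \<alpha> \<mu> P M k (\<lambda>u. max (ennreal a * f u) (ennreal b * g u)) w =
    max (ennreal a * extremal_integral \<alpha> \<mu> P M k f w) (ennreal b * extremal_integral \<alpha> \<mu> P M k g w)"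
proof -
  have "(\<lambda>u. max (ennreal a * f u) (ennreal b * g u)) \<in> integrand_class k \<mu>"
    using assms by (auto simp: integrand_class_def)
  note c = corr_extremal_integral[OF this] corr_extremal_integral[OF assms(1)] corr_extremal_integral[OF assms(2)]
  have "corr (\<lambda>w. max (ennreal a * extremal_integral \<alpha> \<mu> P M k f w) (ennreal b * extremal_integral \<alpha> \<mu> P M k g w))
    (\<lambda>x. max (ennreal a * series k f x) (ennreal b * series k g x))"
    by (rule corr_compose2[OF c(2,3), where f = "\<lambda>y z. max (ennreal a * y) (ennreal b * z)"]) (simp add: split_beta')
  then show ?thesis
    by (rule corr_AE2[OF c(1), where R = "(=)"]) (simp_all add: series_max series_cmult)
qed

lemma integral_mono:
  assumes "f \<in> integrand_class k \<mu>" "g \<in> integrand_class k \<mu>" "AE u in power_measure k \<mu>. f u \<le> g u"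
  shows "AE w in P. extremal_integral \<alpha> \<mu> P M k f w \<le> extremal_integral \<alpha> \<mu> P M k g w"
proof (rule corr_AE2[OF corr_extremal_integral[OF assms(1)] corr_extremal_integral[OF assms(2)], where R = "(\<le>)"])
  show "AE x in \<Omega>. series k f x \<le> series k g x"
    using AE_all_marks[OF assms(3)] by eventually_elim (rule series_mono, blast)
qed (simp add: split_beta')

lemma integral_add_le:
  assumes "f \<in> integrand_class k \<mu>" "g \<in> integrand_class k \<mu>"
  shows "AE w in P. extremal_integral \<alpha> \<mu> P M k (\<lambda>u. f u + g u) w \<le>
    extremal_integral \<alpha> \<mu> P M k f w + extremal_integral \<alpha> \<mu> P M k g w"
proof -
  have "(\<lambda>u. f u + g u) \<in> integrand_class k \<mu>" using assms by (auto simp: integrand_class_def)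
  note c = corr_extremal_integral[OF this] corr_extremal_integral[OF assms(1)] corr_extremal_integral[OF assms(2)]
  have "corr (\<lambda>w. extremal_integral \<alpha> \<mu> P M k f w + extremal_integral \<alpha> \<mu> P M k g w) (\<lambda>x. series k f x + series k g x)"
    by (rule corr_compose2[OF c(2,3), where f = "(+)"]) (simp add: split_beta')
  then show ?thesis
    by (rule corr_AE2[OF c(1), where R = "(\<le>)"]) (simp_all add: series_add split_beta')
qed

lemma same_fdd_series:
  "same_fdd (SIGMA k:{1..}. integrand_class k \<mu>) P (\<lambda>(k, f). extremal_integral \<alpha> \<mu> P M k f) \<Omega> (\<lambda>(k, f). series k f)"
proof -
  let ?J = "SIGMA k:{1..}. integrand_class k \<mu>"
  define X where "X = (\<lambda>(k, f). extremal_integral \<alpha> \<mu> P M k f)"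
  define Y where "Y = (\<lambda>(k, f). series k f)"
  have c: "corr (X i) (Y i)" if "i \<in> ?J" for i
    using that corr_extremal_integral by (auto simp: X_def Y_def)
  have law: "distr P (PiM F (\<lambda>_. borel)) (\<lambda>w. \<lambda>i\<in>F. X i w) = distr \<Omega> (PiM F (\<lambda>_. borel)) (\<lambda>w. \<lambda>i\<in>F. Y i w)"
    if F: "finite F" "F \<subseteq> ?J" for F
  proof -
    obtain e where e: "bij_betw e F {0..<card F}" using ex_bij_betw_finite_nat[OF F(1)] by blast
    define d where "d = inv_into F e"
    have de: "d (e i) = i" if "i \<in> F" for i using e that by (simp add: d_def bij_betw_def)
    have dF: "d n \<in> F" if "n < card F" for n
      using e that unfolding d_def bij_betw_def by (intro inv_into_into) auto
    \<comment> \<open>The finite family is padded by zeros to a sequence, to which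
      \<open>corr_law\<close> applies.\<close>
    define X' where "X' n = (if n < card F then X (d n) else (\<lambda>_. 0))" for n
    define Y' where "Y' n = (if n < card F then Y (d n) else (\<lambda>_. 0))" for n
    have c0: "corr (\<lambda>_. 0) (\<lambda>_. 0)" using corr_SUP[of "{}"] by (simp add: bot_ennreal)
    have c': "corr (X' n) (Y' n)" for n
      using c[of "d n"] dF[of n] F(2) c0 by (auto simp: X'_def Y'_def)
    have e_lt: "e i < card F" if "i \<in> F" for i using e that by (auto simp: bij_betw_def)
    define G where "G y = (\<lambda>i\<in>F. y (e i))" for y :: "nat \<Rightarrow> ennreal"
    have [measurable]: "G \<in> PiM UNIV (\<lambda>_. borel) \<rightarrow>\<^sub>M PiM F (\<lambda>_. borel)"
      unfolding G_def by (rule measurable_restrict) auto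
    have [measurable]: "(\<lambda>w n. X' n w) \<in> P \<rightarrow>\<^sub>M PiM UNIV (\<lambda>_. borel)" "(\<lambda>w n. Y' n w) \<in> \<Omega> \<rightarrow>\<^sub>M PiM UNIV (\<lambda>_. borel)"
      using c' by (auto intro!: measurable_PiM_single' dest: corr_measurable)
    have GX: "G (\<lambda>n. X' n w) = (\<lambda>i\<in>F. X i w)" for w
      by (auto simp: G_def X'_def de e_lt intro!: restrict_ext)
    have GY: "G (\<lambda>n. Y' n w) = (\<lambda>i\<in>F. Y i w)" for w
      by (auto simp: G_def Y'_def de e_lt intro!: restrict_ext)
    have "distr P (PiM F (\<lambda>_. borel)) (\<lambda>w. \<lambda>i\<in>F. X i w) = distr (distr P (PiM UNIV (\<lambda>_. borel)) (\<lambda>w n. X' n w)) (PiM F (\<lambda>_. borel)) G"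
      by (subst distr_distr) (auto simp: comp_def GX)
    also have "\<dots> = distr (distr \<Omega> (PiM UNIV (\<lambda>_. borel)) (\<lambda>w n. Y' n w)) (PiM F (\<lambda>_. borel)) G"
      using corr_law[of X' Y'] c' by simp
    also have "\<dots> = distr \<Omega> (PiM F (\<lambda>_. borel)) (\<lambda>w. \<lambda>i\<in>F. Y i w)"
      by (subst distr_distr) (auto simp: comp_def GY)
    finally show ?thesis .
  qed
  show ?thesis
    unfolding same_fdd_def X_def[symmetric] Y_def[symmetric]
  proof (intro conjI ballI allI impI)
    fix i assume "i \<in> ?J"
    then have "corr (X i) (Y i)" by (rule c)
    then show "X i \<in> borel_measurable P" "Y i \<in> borel_measurable \<Omega>" by (rule corr_measurable(1), rule corr_measurable(2))
  next
    fix F assume "finite F \<and> F \<subseteq> ?J"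
    then show "distr P (PiM F (\<lambda>_. borel)) (\<lambda>w. \<lambda>i\<in>F. X i w) = distr \<Omega> (PiM F (\<lambda>_. borel)) (\<lambda>w. \<lambda>i\<in>F. Y i w)"
      by (elim conjE) (rule law)
  qed
qed

end

section \<open>LePage data\<close>

text \<open>The claims about the integral alone mention no reference measure, so one is built: a
  strictly positive integrable function is normalized to a probability density, and \<psi> is its
  reciprocal.\<close>

lemma exists_lepage_representation:
  assumes "sigma_finite_measure \<mu>" "emeasure \<mu> (space \<mu>) \<noteq> 0" "0 < \<alpha>"
  shows "\<exists>m \<psi>. lepage_representation \<alpha> \<mu> m \<psi>"
proof -
  interpret sigma_finite_measure \<mu> by fact
  obtain h where h [measurable]: "h \<in> borel_measurable \<mu>" and fin: "(\<integral>\<^sup>+y. h y \<partial>\<mu>) \<noteq> \<infinity>"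
    and pos: "\<And>y. y \<in> space \<mu> \<Longrightarrow> 0 < h y" "\<And>y. y \<in> space \<mu> \<Longrightarrow> h y < \<infinity>"
    using Ex_finite_integrable_function by blast
  define c where "c = (\<integral>\<^sup>+y. h y \<partial>\<mu>)"
  have c: "0 < c" "c < \<infinity>"
  proof -
    have "c \<noteq> 0"
    proof
      assume "c = 0"
      then have "AE y in \<mu>. h y = 0" unfolding c_def by (subst (asm) nn_integral_0_iff_AE) auto
      then have "AE y in \<mu>. False" using AE_space by eventually_elim (use pos in force)
      then show False using assms(2) by (simp add: AE_iff_measurable[OF sets.top])
    qed
    then show "0 < c" by (simp add: zero_less_iff_neq_zero)
    show "c < \<infinity>" using fin by (simp add: c_def less_top)
  qed
  define m where "m = density \<mu> (\<lambda>y. h y / c)"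
  define \<psi> where "\<psi> y = c / h y" for y
  have "lepage_representation \<alpha> \<mu> m \<psi>"
  proof (rule lepage_representation.intro)
    show "prob_space m"
    proof (rule prob_spaceI)
      have "emeasure m (space m) = (\<integral>\<^sup>+y. h y / c \<partial>\<mu>)"
        by (simp add: m_def emeasure_density nn_integral_set_ennreal[symmetric] cong: nn_integral_cong)
      also have "\<dots> = c / c" by (simp add: nn_integral_divide c_def)
      also have "\<dots> = 1" using c by (intro ennreal_divide_self) auto
      finally show "emeasure m (space m) = 1" .
    qed
    show "sets m = sets \<mu>" by (simp add: m_def)
    have [measurable]: "\<psi> \<in> borel_measurable \<mu>" unfolding \<psi>_def by measurable
    then show "\<psi> \<in> borel_measurable m" by (simp add: m_def)
    have one: "h y / c * \<psi> y = 1" if y: "y \<in> space \<mu>" for y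
    proof -
      obtain a b where ab: "h y = ennreal a" "0 < a" "c = ennreal b" "0 < b"
        using pos[OF y] c by (cases "h y"; cases c) auto
      then show ?thesis by (simp add: \<psi>_def divide_ennreal flip: ennreal_mult)
    qed
    have "density m \<psi> = density \<mu> (\<lambda>y. h y / c * \<psi> y)"
      unfolding m_def by (rule density_density_eq) measurable
    also have "\<dots> = density \<mu> (\<lambda>_. 1)" using one by (intro density_cong) (auto intro!: AE_I2)
    finally show "\<mu> = density m \<psi>" by (simp add: density_1)
    have "0 < \<psi> y \<and> \<psi> y < \<infinity>" if y: "y \<in> space \<mu>" for y
    proof -
      obtain a b where ab: "h y = ennreal a" "0 < a" "c = ennreal b" "0 < b"
        using pos[OF y] c by (cases "h y"; cases c) auto
      then show ?thesis by (simp add: \<psi>_def divide_ennreal)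
    qed
    then show "AE y in m. 0 < \<psi> y \<and> \<psi> y < \<infinity>" by (intro AE_I2) (simp add: m_def)
  qed fact
  then show ?thesis by blast
qed

lemma borel_space_code:
  assumes "is_borel_space \<mu>" obtains \<phi> where "coded_space \<mu> \<phi>"
proof -
  obtain B \<phi> where B: "B \<in> sets (borel :: real measure)" "B \<subseteq> {0..1}" and bij: "bij_betw \<phi> (space \<mu>) B"
    and meas: "\<phi> \<in> \<mu> \<rightarrow>\<^sub>M restrict_space borel B"
    using assms unfolding is_borel_space_def by blast
  have "coded_space \<mu> \<phi>"
  proof
    show "\<phi> \<in> borel_measurable \<mu>" using meas by (simp add: measurable_restrict_space2_iff)
    show "inj_on \<phi> (space \<mu>)" using bij by (simp add: bij_betw_def)
    show "\<phi> y \<in> {0..1}" if "y \<in> space \<mu>" for y using bij that B(2) by (auto simp: bij_betw_def)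
  qed
  then show thesis by (rule that)
qed

section \<open>From LePage data to the canonical space\<close>

context lepage_data
begin

text \<open>The given arrival times are numbered from 1 and \<open>\<Gamma> 0\<close> is
  unspecified, hence the separate case n = 0, where the previous arrival is taken to be 0.\<close>

definition gaps :: "'v \<Rightarrow> nat \<Rightarrow> real" where
  "gaps w n = \<Gamma> (Suc n) w - (if n = 0 then 0 else \<Gamma> n w)"

definition locations :: "'v \<Rightarrow> nat \<Rightarrow> 'e" where
  "locations w n = T (Suc n) w"

lemma arrival_gaps: "arrival (gaps w) n = \<Gamma> (Suc n) w"
  by (induction n) (simp_all add: arrival_def gaps_def)

text \<open>Independence with a common law means that the joint law is a product; shifting the index
  by one moves it from {1..} to all natural numbers.\<close>

lemma indep_vars_sequence_law:
  fixes X :: "nat \<Rightarrow> 'v \<Rightarrow> 'a"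
  assumes ind: "indep_vars (\<lambda>_. N) X {1..}" and law: "\<And>i. 1 \<le> i \<Longrightarrow> distr Q N (X i) = D" and "prob_space D"
  shows "(\<lambda>w n. X (Suc n) w) \<in> Q \<rightarrow>\<^sub>M PiM UNIV (\<lambda>_. N)"
    and "distr Q (PiM UNIV (\<lambda>_. N)) (\<lambda>w n. X (Suc n) w) = PiM UNIV (\<lambda>_. D)"
proof -
  have rv: "X i \<in> Q \<rightarrow>\<^sub>M N" if "1 \<le> i" for i using ind that by (auto simp: indep_vars_def)
  have sets: "sets D = sets N" using law[of 1] by (metis order_refl sets_distr)
  have "distr Q (PiM {1..} (\<lambda>_. N)) (\<lambda>w. \<lambda>i\<in>{1..}. X i w) = PiM {1..} (\<lambda>i. distr Q N (X i))"
    using ind rv by (subst (asm) indep_vars_iff_distr_eq_PiM') auto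
  also have "\<dots> = PiM {1..} (\<lambda>_. D)" by (intro PiM_cong) (auto simp: law)
  finally have l: "distr Q (PiM {1..} (\<lambda>_. N)) (\<lambda>w. \<lambda>i\<in>{1..}. X i w) = PiM {1..} (\<lambda>_. D)" .
  show meas: "(\<lambda>w n. X (Suc n) w) \<in> Q \<rightarrow>\<^sub>M PiM UNIV (\<lambda>_. N)"
    using measurable_space[OF rv] rv by (intro measurable_PiM_single') (auto simp: PiE_iff)
  have m1: "(\<lambda>w. \<lambda>i\<in>{1..}. X i w) \<in> Q \<rightarrow>\<^sub>M PiM {1..} (\<lambda>_. N)"
    by (intro measurable_restrict rv) auto
  have m2: "(\<lambda>v. \<lambda>n\<in>UNIV. v (Suc n)) \<in> PiM {1..} (\<lambda>_. N) \<rightarrow>\<^sub>M PiM UNIV (\<lambda>_. N)"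
    by (intro measurable_restrict measurable_component_singleton) auto
  have "distr Q (PiM UNIV (\<lambda>_. N)) (\<lambda>w n. X (Suc n) w) =
    distr (distr Q (PiM {1..} (\<lambda>_. N)) (\<lambda>w. \<lambda>i\<in>{1..}. X i w)) (PiM UNIV (\<lambda>_. N)) (\<lambda>v. \<lambda>n\<in>UNIV. v (Suc n))"
    by (subst distr_distr[OF m2 m1]) (simp add: comp_def restrict_def)
  also have "\<dots> = distr (PiM {1..} (\<lambda>_. D)) (PiM UNIV (\<lambda>_. D)) (\<lambda>v. \<lambda>n\<in>UNIV. v (Suc n))"
    unfolding l by (intro distr_cong refl sets_PiM_cong) (simp add: sets)
  also have "\<dots> = PiM UNIV (\<lambda>_. D)"
    using distr_PiM_reindex[of "{1..}" "\<lambda>_. D" Suc UNIV] assms(3) by simp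
  finally show "distr Q (PiM UNIV (\<lambda>_. N)) (\<lambda>w n. X (Suc n) w) = PiM UNIV (\<lambda>_. D)" .
qed

text \<open>Gaps and locations are measurable functions of the sequences \<open>\<Gamma>\<close> and
  \<open>T\<close>, so they inherit the independence of the generated \<sigma>-algebras. Hence
  arbitrary LePage data have the law of the coordinates of \<open>lepage_space\<close>, and what is
  proved there applies to them.\<close>

lemma law_gaps_locations:
  shows "(\<lambda>w. (gaps w, locations w)) \<in> Q \<rightarrow>\<^sub>M lepage_space m"
    and "distr Q (lepage_space m) (\<lambda>w. (gaps w, locations w)) = lepage_space m"
proof -
  let ?SE = "PiM UNIV (\<lambda>_::nat. unit_exponential)" and ?SM = "PiM UNIV (\<lambda>_::nat. m)"
  define W where "W i w = \<Gamma> i w - (if i = 1 then 0 else \<Gamma> (i - 1) w)" for i w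
  have W: "indep_vars (\<lambda>_. borel) W {1..}" "\<And>i. 1 \<le> i \<Longrightarrow> distributed Q lborel (W i) (exponential_density 1)"
    using arrival_times unfolding poisson_arrival_times_def Let_def W_def[abs_def] by auto
  have law_W: "distr Q borel (W i) = unit_exponential" if "1 \<le> i" for i
    using W(2)[OF that] unfolding distributed_def unit_exponential_def
    by (metis distr_cong sets_lborel)
  have gaps_W: "gaps w = (\<lambda>n. W (Suc n) w)" for w by (auto simp: gaps_def W_def)
  have sets_SE: "sets (PiM UNIV (\<lambda>_::nat. borel)) = sets ?SE" by (intro sets_PiM_cong) auto
  have g: "gaps \<in> Q \<rightarrow>\<^sub>M ?SE" "distr Q ?SE gaps = ?SE"
  proof -
    note l = indep_vars_sequence_law[OF W(1) law_W prob_space_unit_exponential]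
    show "gaps \<in> Q \<rightarrow>\<^sub>M ?SE" using l(1) unfolding gaps_W[abs_def] measurable_cong_sets[OF refl sets_SE] .
    have "distr Q ?SE gaps = distr Q (PiM UNIV (\<lambda>_. borel)) gaps" by (intro distr_cong) (auto simp: sets_SE)
    then show "distr Q ?SE gaps = ?SE" using l(2) by (simp add: gaps_W[abs_def])
  qed
  have t: "locations \<in> Q \<rightarrow>\<^sub>M ?SM" "distr Q ?SM locations = ?SM"
    using indep_vars_sequence_law[OF T_indep _ prob_m] T_law by (auto simp: locations_def[abs_def])
  show meas: "(\<lambda>w. (gaps w, locations w)) \<in> Q \<rightarrow>\<^sub>M lepage_space m"
    unfolding lepage_space_def using g(1) t(1) by measurable
  interpret m: prob_space m by (rule prob_m)
  interpret E: prob_space unit_exponential by (rule prob_space_unit_exponential)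
  interpret A: sequence_space unit_exponential by standard
  interpret B: sequence_space m by standard
  show "distr Q (lepage_space m) (\<lambda>w. (gaps w, locations w)) = lepage_space m"
    unfolding lepage_space_def
  proof (rule pair_measure_eqI[symmetric])
    show "sigma_finite_measure A.S" "sigma_finite_measure B.S" by unfold_locales
    show "sets (A.S \<Otimes>\<^sub>M B.S) = sets (distr Q (A.S \<Otimes>\<^sub>M B.S) (\<lambda>w. (gaps w, locations w)))" by simp
    fix a b assume a: "a \<in> sets A.S" and b: "b \<in> sets B.S"
    \<comment> \<open>\<open>G\<close> and \<open>H\<close> act on sequences over {1..}, so that the
      events in question are preimages under the given data and lie in the \<sigma>-algebras they
      generate.\<close>
    define G where "G v n = v (Suc n) - (if n = 0 then 0 else v n)" for v :: "nat \<Rightarrow> real" and n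
    define H where "H v n = v (Suc n)" for v :: "nat \<Rightarrow> 'e" and n
    have G_meas: "G \<in> PiM {1..} (\<lambda>_. borel) \<rightarrow>\<^sub>M A.S"
    proof (rule measurable_PiM_single')
      fix n :: nat
      have "(\<lambda>v. v (Suc n)) \<in> borel_measurable (PiM {1..} (\<lambda>_. borel))" by measurable
      moreover have "(\<lambda>v. if n = 0 then 0 else v n) \<in> borel_measurable (PiM {1..} (\<lambda>_. borel))"
        by (cases "n = 0") auto
      ultimately show "(\<lambda>v. G v n) \<in> PiM {1..} (\<lambda>_. borel) \<rightarrow>\<^sub>M unit_exponential"
        unfolding G_def measurable_cong_sets[OF refl sets_unit_exponential] by (rule borel_measurable_diff)
    qed auto
    have H_meas: "H \<in> PiM {1..} (\<lambda>_. m) \<rightarrow>\<^sub>M B.S"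
      unfolding H_def
      by (rule measurable_PiM_single') (auto simp: space_PiM PiE_iff)
    have va: "gaps -` a \<inter> space Q \<in> sets (vimage_algebra (space Q) (\<lambda>w. \<lambda>i\<in>{1..}. \<Gamma> i w) (PiM {1..} (\<lambda>_. borel)))"
    proof -
      have "gaps w = G (\<lambda>i\<in>{1..}. \<Gamma> i w)" for w by (auto simp: gaps_def G_def fun_eq_iff)
      then have "gaps -` a \<inter> space Q = (\<lambda>w. \<lambda>i\<in>{1..}. \<Gamma> i w) -` (G -` a \<inter> space (PiM {1..} (\<lambda>_. borel))) \<inter> space Q"
        by (auto simp: space_PiM)
      also have "\<dots> \<in> sets (vimage_algebra (space Q) (\<lambda>w. \<lambda>i\<in>{1..}. \<Gamma> i w) (PiM {1..} (\<lambda>_. borel)))"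
        by (intro in_vimage_algebra measurable_sets[OF G_meas a])
      finally show ?thesis .
    qed
    have vb: "locations -` b \<inter> space Q \<in> sets (vimage_algebra (space Q) (\<lambda>w. \<lambda>i\<in>{1..}. T i w) (PiM {1..} (\<lambda>_. m)))"
    proof -
      have "locations w = H (\<lambda>i\<in>{1..}. T i w)" for w by (auto simp: locations_def H_def fun_eq_iff)
      moreover have "(\<lambda>i\<in>{1..}. T i w) \<in> space (PiM {1..} (\<lambda>_. m))" if "w \<in> space Q" for w
        using that T_law[THEN conjunct1, THEN measurable_space] by (auto simp: space_PiM)
      ultimately have "locations -` b \<inter> space Q = (\<lambda>w. \<lambda>i\<in>{1..}. T i w) -` (H -` b \<inter> space (PiM {1..} (\<lambda>_. m))) \<inter> space Q"
        by auto
      also have "\<dots> \<in> sets (vimage_algebra (space Q) (\<lambda>w. \<lambda>i\<in>{1..}. T i w) (PiM {1..} (\<lambda>_. m)))"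
        by (intro in_vimage_algebra measurable_sets[OF H_meas b])
      finally show ?thesis .
    qed
    have "emeasure (distr Q (A.S \<Otimes>\<^sub>M B.S) (\<lambda>w. (gaps w, locations w))) (a \<times> b) =
      emeasure Q ((\<lambda>w. (gaps w, locations w)) -` (a \<times> b) \<inter> space Q)"
      using a b meas by (intro emeasure_distr) (auto simp: lepage_space_def)
    also have "(\<lambda>w. (gaps w, locations w)) -` (a \<times> b) \<inter> space Q = (locations -` b \<inter> space Q) \<inter> (gaps -` a \<inter> space Q)" by auto
    also have "emeasure Q \<dots> = ennreal (prob (locations -` b \<inter> space Q) * prob (gaps -` a \<inter> space Q))"
      using indep_setD[OF T_Gamma_indep vb va] by (simp add: emeasure_eq_measure)
    also have "\<dots> = emeasure (distr Q A.S gaps) a * emeasure (distr Q B.S locations) b"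
      using a b g(1) t(1) by (simp add: emeasure_distr emeasure_eq_measure ennreal_mult mult.commute)
    finally show "emeasure A.S a * emeasure B.S b = emeasure (distr Q (A.S \<Otimes>\<^sub>M B.S) (\<lambda>w. (gaps w, locations w))) (a \<times> b)"
      using g(2) t(2) by simp
  qed
qed

lemma lepage_representation: "0 < \<alpha> \<Longrightarrow> lepage_representation \<alpha> \<mu> m \<psi>"
  using prob_m sets_m psi_measurable psi_density psi_pos_finite by (simp add: lepage_representation_def)

end

text \<open>Shifting indices by one maps \<open>tuples\<close> onto \<open>distinct_indices\<close>,
  and \<open>arrival_gaps\<close> recovers the arrival times from the gaps.\<close>

lemma lepage_series_eq:
  assumes "lepage_data \<mu> m \<psi> Q \<Gamma> T" "lepage_representation \<alpha> \<mu> m \<psi>"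
  shows "lepage_series \<alpha> \<psi> \<Gamma> T k f w =
    lepage_representation.series \<alpha> \<psi> k f (lepage_data.gaps \<Gamma> w, lepage_data.locations T w)"
proof -
  interpret lepage_data \<mu> m \<psi> Q \<Gamma> T by fact
  interpret R: lepage_representation \<alpha> \<mu> m \<psi> by fact
  define z where "z j = f (\<lambda>r\<in>{1..k}. T (j r) w) *
    (\<Prod>r\<in>{1..k}. ennreal (\<Gamma> (j r) w powr (- 1 / \<alpha>)) * ennreal_powr (\<psi> (T (j r) w)) (1 / \<alpha>))" for j
  define s where "s j = (\<lambda>r\<in>{1..k}. Suc (j r))" for j
  have img: "distinct_indices k = s ` R.tuples k"
  proof (intro set_eqI iffI)
    fix i assume "i \<in> distinct_indices k"
    then have i: "i \<in> {1..k} \<rightarrow>\<^sub>E {1..}" "inj_on i {1..k}" by (auto simp: distinct_indices_def)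
    have pos: "1 \<le> i r" if "r \<in> {1..k}" for r using PiE_mem[OF i(1) that] by simp
    define j where "j = (\<lambda>r\<in>{1..k}. i r - 1)"
    have "inj_on (\<lambda>r. i r - 1) {1..k}"
    proof (rule inj_onI)
      fix r t assume "r \<in> {1..k}" "t \<in> {1..k}" "i r - 1 = i t - 1"
      then show "r = t" using pos[of r] pos[of t] inj_onD[OF i(2), of r t] by linarith
    qed
    then have "inj_on j {1..k}" using inj_on_cong[of "{1..k}" j "\<lambda>r. i r - 1"] by (simp add: j_def)
    then have "j \<in> R.tuples k" unfolding R.tuples_def j_def by (intro CollectI conjI restrict_PiE_iff[THEN iffD2]) auto
    moreover have "i = s j"
    proof
      fix r show "i r = s j r"
      proof (cases "r \<in> {1..k}")
        case True
        then show ?thesis using pos[OF True] by (simp add: s_def j_def)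
      next
        case False
        show ?thesis unfolding PiE_arb[OF i(1) False] s_def using False by (simp only: restrict_def if_False)
      qed
    qed
    ultimately show "i \<in> s ` R.tuples k" by blast
  next
    fix i assume "i \<in> s ` R.tuples k"
    then obtain j where j: "j \<in> {1..k} \<rightarrow>\<^sub>E UNIV" "inj_on j {1..k}" "i = s j" by (auto simp: R.tuples_def)
    have "inj_on (\<lambda>r. Suc (j r)) {1..k}" using comp_inj_on[OF j(2), of Suc] by (simp add: comp_def)
    then have "inj_on i {1..k}" using inj_on_cong[of "{1..k}" i "\<lambda>r. Suc (j r)"] by (simp add: j(3) s_def)
    moreover have "i \<in> {1..k} \<rightarrow>\<^sub>E {1..}" unfolding j(3) s_def by auto
    ultimately show "i \<in> distinct_indices k" by (simp add: distinct_indices_def)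
  qed
  have "z (s j) = f (R.marks k j (gaps w, locations w)) * (\<Prod>r\<in>{1..k}. R.weight (j r) (gaps w, locations w))" for j
  proof -
    have "(\<lambda>r\<in>{1..k}. T (s j r) w) = R.marks k j (gaps w, locations w)"
      unfolding R.marks_def by (intro restrict_ext) (simp add: s_def locations_def)
    moreover have "(\<Prod>r\<in>{1..k}. ennreal (\<Gamma> (s j r) w powr (- 1 / \<alpha>)) * ennreal_powr (\<psi> (T (s j r) w)) (1 / \<alpha>)) =
      (\<Prod>r\<in>{1..k}. R.weight (j r) (gaps w, locations w))"
      by (intro prod.cong refl) (simp add: s_def R.weight_def arrival_gaps locations_def)
    ultimately show ?thesis by (simp only: z_def)
  qed
  then have "(SUP j\<in>R.tuples k. z (s j)) = R.series k f (gaps w, locations w)"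
    unfolding R.series_def by simp
  then show ?thesis
    unfolding lepage_series_def z_def[symmetric] img image_image .
qed

theorem corollary2p10:
  fixes \<alpha> :: real and \<mu> :: "'e measure" and P :: "'w measure"
    and M :: "'e set \<Rightarrow> 'w \<Rightarrow> ennreal"
  assumes "\<alpha> > 0"
    and "is_borel_space \<mu>" and "sigma_finite_measure \<mu>" and "emeasure \<mu> (space \<mu>) \<noteq> 0"
    and "frechet_random_sup_measure \<alpha> \<mu> P M"
  shows
    "let I = extremal_integral \<alpha> \<mu> P M in
     (\<forall>k\<ge>1. \<forall>f\<in>integrand_class k \<mu>. \<forall>g\<in>integrand_class k \<mu>.
        (\<forall>a\<ge>0. \<forall>b\<ge>0. AE w in P.
           I k (\<lambda>u. max (ennreal a * f u) (ennreal b * g u)) w =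
           max (ennreal a * I k f w) (ennreal b * I k g w)) \<and>
        ((AE u in power_measure k \<mu>. f u \<le> g u) \<longrightarrow> (AE w in P. I k f w \<le> I k g w)) \<and>
        (AE w in P. I k (\<lambda>u. f u + g u) w \<le> I k f w + I k g w)) \<and>
     (\<forall>(m :: 'e measure) \<psi> (Q :: 'v measure) \<Gamma> T. lepage_data \<mu> m \<psi> Q \<Gamma> T \<longrightarrow>
        same_fdd (SIGMA k:{1..}. integrand_class k \<mu>)
          P (\<lambda>(k, f). I k f) Q (\<lambda>(k, f). lepage_series \<alpha> \<psi> \<Gamma> T k f))"
proof -
  obtain \<phi> where \<phi>: "coded_space \<mu> \<phi>" by (rule borel_space_code[OF assms(2)])
  have integration: "extremal_integration \<alpha> \<mu> m \<psi> P M \<phi>" if "lepage_representation \<alpha> \<mu> m \<psi>" for m \<psi>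
    using assms that \<phi>
    by (simp add: extremal_integration_def extremal_integration_axioms_def lepage_sigma_finite_def
        lepage_coded_def lepage_transfer_def)
  \<comment> \<open>Any reference measure serves for the claims about the integral alone.\<close>
  obtain m0 \<psi>0 where "lepage_representation \<alpha> \<mu> m0 \<psi>0"
    using exists_lepage_representation[OF assms(3,4,1)] by blast
  then interpret I: extremal_integration \<alpha> \<mu> m0 \<psi>0 P M \<phi> by (rule integration)
  have "same_fdd (SIGMA k:{1..}. integrand_class k \<mu>) P (\<lambda>(k, f). extremal_integral \<alpha> \<mu> P M k f)
      Q (\<lambda>(k, f). lepage_series \<alpha> \<psi> \<Gamma> T k f)"
    if data: "lepage_data \<mu> m \<psi> Q \<Gamma> T" for m \<psi> and Q :: "'v measure" and \<Gamma> T
  proof -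
    let ?J = "SIGMA k:{1..}. integrand_class k \<mu>"
    interpret D: lepage_data \<mu> m \<psi> Q \<Gamma> T by fact
    have rep: "lepage_representation \<alpha> \<mu> m \<psi>" by (rule D.lepage_representation) fact
    \<comment> \<open>\<open>extremal_integral\<close> is defined without a reference measure, so
      the same integral corresponds to the series built from the given m and \<psi>.\<close>
    interpret R: extremal_integration \<alpha> \<mu> m \<psi> P M \<phi> by (rule integration[OF rep])
    define h where "h w = (D.gaps w, D.locations w)" for w
    have h: "h \<in> Q \<rightarrow>\<^sub>M lepage_space m" "distr Q (lepage_space m) h = lepage_space m"
      using D.law_gaps_locations by (simp_all add: h_def[abs_def])
    define Y where "Y = (\<lambda>(k, f). R.series k f)"
    have L: "(\<lambda>(k, f). lepage_series \<alpha> \<psi> \<Gamma> T k f) = (\<lambda>i w. Y i (h w))"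
      using lepage_series_eq[OF data rep] by (auto simp: fun_eq_iff Y_def h_def)
    note S = R.same_fdd_series[folded Y_def]
    have Y_meas: "Y i \<in> borel_measurable (lepage_space m)" if "i \<in> ?J" for i
      using S that unfolding same_fdd_def by blast
    have law: "distr (lepage_space m) (PiM F (\<lambda>_. borel)) (\<lambda>x. \<lambda>i\<in>F. Y i x) = distr Q (PiM F (\<lambda>_. borel)) (\<lambda>w. \<lambda>i\<in>F. Y i (h w))"
      if "F \<subseteq> ?J" for F
    proof -
      have m: "(\<lambda>x. \<lambda>i\<in>F. Y i x) \<in> lepage_space m \<rightarrow>\<^sub>M PiM F (\<lambda>_. borel)"
        using that by (intro measurable_restrict Y_meas) auto
      have "distr (lepage_space m) (PiM F (\<lambda>_. borel)) (\<lambda>x. \<lambda>i\<in>F. Y i x) =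
        distr (distr Q (lepage_space m) h) (PiM F (\<lambda>_. borel)) (\<lambda>x. \<lambda>i\<in>F. Y i x)"
        by (simp only: h(2))
      also have "\<dots> = distr Q (PiM F (\<lambda>_. borel)) (\<lambda>w. \<lambda>i\<in>F. Y i (h w))"
        by (subst distr_distr[OF m h(1)]) (simp add: comp_def)
      finally show ?thesis .
    qed
    show ?thesis
      unfolding L same_fdd_def
    proof (intro conjI ballI allI impI)
      fix i assume i: "i \<in> ?J"
      show "(case i of (k, f) \<Rightarrow> extremal_integral \<alpha> \<mu> P M k f) \<in> borel_measurable P"
        using S i unfolding same_fdd_def by blast
      show "(\<lambda>w. Y i (h w)) \<in> borel_measurable Q" by (rule measurable_compose[OF h(1) Y_meas[OF i]])
    next
      fix F assume F: "finite F \<and> F \<subseteq> ?J"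
      have "distr P (PiM F (\<lambda>_. borel)) (\<lambda>w. \<lambda>i\<in>F. (case i of (k, f) \<Rightarrow> extremal_integral \<alpha> \<mu> P M k f) w) =
        distr (lepage_space m) (PiM F (\<lambda>_. borel)) (\<lambda>x. \<lambda>i\<in>F. Y i x)"
        using S F unfolding same_fdd_def by blast
      then show "distr P (PiM F (\<lambda>_. borel)) (\<lambda>w. \<lambda>i\<in>F. (case i of (k, f) \<Rightarrow> extremal_integral \<alpha> \<mu> P M k f) w) =
        distr Q (PiM F (\<lambda>_. borel)) (\<lambda>w. \<lambda>i\<in>F. Y i (h w))"
        using law[OF conjunct2[OF F]] by (simp only:)
    qed
  qed
  then show ?thesis
    unfolding Let_def by (intro conjI allI ballI impI I.integral_max_linear I.integral_mono I.integral_add_le)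
qed

end
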